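(* Let $(X,d_X)$ be a metric space. For every homology degree $i$, the map $\mathrm{PH}_i\circ\mathcal{T}:C(S^1,X)\to\mathbf{Dgm}$ is continuous with respect to the bottleneck distance on $\mathbf{Dgm}$. Furthermore, $\mathrm{PH}_i\circ\mathsf{T}:C(S^1,X)\to\mathbf{Dgm}$ is $2$-Lipschitz.
   Context: $\mathbf{F}_2(S^1)$ is the set of non-empty subsets $\{z_1,z_2\}\subset S^1$ of cardinality at most $2$, with the quotient topology from $S^1\times S^1$; it is homeomorphic to a Möbius band, hence finitely triangulable. For $\gamma\in C(S^1,X)$, $\mathsf{T}_\gamma(\{z_1,z_2\})=d_X(\gamma(z_1),\gamma(z_2))$ and $\mathcal{T}_\gamma=\tfrac12\mathsf{T}_\gamma^2$. $C(S^1,X)$ has the metric $d(\gamma,\tilde\gamma)=\sup_{z}d_X(\gamma(z),\tilde\gamma(z))$. For a continuous $f:Y\to\mathbb{R}$ on a finitely triangulable space $Y$, the persistence module $V^t=H_i(f^{-1}(-\infty,t])$ (coefficients in a fixed field, maps $v_s^t$ induced by inclusion) is q-tame: $r_s^t=\mathrm{rank}(v_s^t)<\infty$ for $s<t$. Its persistence diagram $\mathrm{PH}_i(f)$ is the multiset of points $(b,d)$, $-\infty\le b<d\le\infty$, in which $(b,d)$ has multiplicity the minimum, over rectangles $[a,b']\times[c,d']$ with $a<b'<c<d'$ containing $(b,d)$ in the interior relative to the extended plane, of $r_{b'}^{c}-r_a^{c}-r_{b'}^{d'}+r_a^{d'}$ (with $V^{\pm\infty}=0$). $\mathbf{Dgm}$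 is the space of such diagrams (multisets in the open extended half plane $\{b<d\}$, finite on each rectangle $[a,b']\times[c,d']$ with $a<b'<c<d'$), with the bottleneck distance: the infimum over partial matchings of two diagrams of the largest $\ell^\infty$-cost, where matched points pay their $\ell^\infty$-distance and unmatched points pay their $\ell^\infty$-distance to the diagonal (an extended pseudometric). *)

theory Defs
  imports "HOL-Analysis.Analysis" "HOL-Homology.Homology"
begin

section \<open>Singular homology with coefficients in a field\<close>

text \<open>
  \<open>HOL-Homology\<close> provides integral coefficients only. The singular simplices and their faces are
  the library's; a chain is a finitely supported function from simplices to the field \<open>'k\<close>.
\<close>

type_synonym ('a, 'k) field_chain = "((nat \<Rightarrow> real) \<Rightarrow> 'a) \<Rightarrow>\<^sub>0 'k"

definition fchain_scale :: "'k::field \<Rightarrow> ('b \<Rightarrow>\<^sub>0 'k) \<Rightarrow> ('b \<Rightarrow>\<^sub>0 'k)" where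
  "fchain_scale a c = Poly_Mapping.map ((*) a) c"

definition fchain_boundary :: "nat \<Rightarrow> ('a, 'k::field) field_chain \<Rightarrow> ('a, 'k) field_chain" where
  "fchain_boundary p c =
    (if p = 0 then 0
     else \<Sum>\<sigma>\<in>Poly_Mapping.keys c. \<Sum>k\<le>p.
            Poly_Mapping.single (singular_face p k \<sigma>) ((-1) ^ k * Poly_Mapping.lookup c \<sigma>))"

definition fchains :: "nat \<Rightarrow> 'a topology \<Rightarrow> ('a, 'k::field) field_chain set" where
  "fchains p X = {c. Poly_Mapping.keys c \<subseteq> singular_simplex_set p X}"

definition fcycles :: "nat \<Rightarrow> 'a topology \<Rightarrow> ('a, 'k::field) field_chain set" where
  "fcycles p X = {c \<in> fchains p X. fchain_boundary p c = 0}"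

definition fboundaries :: "nat \<Rightarrow> 'a topology \<Rightarrow> ('a, 'k::field) field_chain set" where
  "fboundaries p X = fchain_boundary (Suc p) ` fchains (Suc p) X"

definition fclass :: "nat \<Rightarrow> 'a topology \<Rightarrow> ('a, 'k::field) field_chain \<Rightarrow> ('a, 'k) field_chain set"
  where "fclass p X z = {z'. z' - z \<in> fboundaries p X}"

definition fhomology :: "nat \<Rightarrow> 'a topology \<Rightarrow> ('a, 'k::field) field_chain set set" where
  "fhomology p X = fclass p X ` fcycles p X"

text \<open>
  Linear independence in the quotient space \<open>fhomology p X\<close>: a linear combination of classes is the
  class of the same combination of representatives (the choice of which is immaterial), and it
  vanishes when the latter is a boundary.
\<close>

definition fhomology_independent ::
    "nat \<Rightarrow> 'a topology \<Rightarrow> ('a, 'k::field) field_chain set set \<Rightarrow> bool" where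
  "fhomology_independent p X H \<longleftrightarrow> finite H \<and> H \<subseteq> fhomology p X \<and>
     (\<forall>c z. (\<forall>h\<in>H. z h \<in> h) \<longrightarrow> (\<Sum>h\<in>H. fchain_scale (c h) (z h)) \<in> fboundaries p X
        \<longrightarrow> (\<forall>h\<in>H. c h = 0))"

definition fhomology_dim ::
    "nat \<Rightarrow> 'a topology \<Rightarrow> ('a, 'k::field) field_chain set set \<Rightarrow> enat" where
  "fhomology_dim p X W = Sup {enat (card H) |H. H \<subseteq> W \<and> fhomology_independent p X H}"

text \<open>
  The map \<open>H\<^sub>p(X) \<rightarrow> H\<^sub>p(Y)\<close> induced by inclusion when \<open>X\<close> is a subspace of \<open>Y\<close>. The union is that
  of copies of a single class, \<open>fclass p Y z\<close> for any representative \<open>z\<close> of \<open>h\<close>.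
\<close>

definition fhomology_incl ::
    "nat \<Rightarrow> 'a topology \<Rightarrow> ('a, 'k::field) field_chain set \<Rightarrow> ('a, 'k) field_chain set" where
  "fhomology_incl p Y h = (\<Union>z\<in>h. fclass p Y z)"

definition fhomology_incl_rank :: "'k::field itself \<Rightarrow> nat \<Rightarrow> 'a topology \<Rightarrow> 'a topology \<Rightarrow> enat" where
  "fhomology_incl_rank K p X Y =
     fhomology_dim p Y (fhomology_incl p Y ` (fhomology p X :: ('a, 'k) field_chain set set))"


section \<open>Persistence diagrams\<close>

definition sublevel :: "'a topology \<Rightarrow> ('a \<Rightarrow> real) \<Rightarrow> real \<Rightarrow> 'a topology" where
  "sublevel Y f t = subtopology Y {y \<in> topspace Y. f y \<le> t}"

text \<open>
  The rank of \<open>V\<^sup>s \<rightarrow> V\<^sup>t\<close> for \<open>s < t\<close>, where \<open>V\<close> vanishes at \<open>\<plusminus>\<infinity>\<close>. For a continuous function on a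
  finitely triangulable space these ranks are finite, so \<^const>\<open>the_enat\<close> loses nothing.
\<close>

definition persistence_rank ::
    "'k::field itself \<Rightarrow> nat \<Rightarrow> 'a topology \<Rightarrow> ('a \<Rightarrow> real) \<Rightarrow> ereal \<Rightarrow> ereal \<Rightarrow> int" where
  "persistence_rank K p Y f s t =
     (if \<bar>s\<bar> = \<infinity> \<or> \<bar>t\<bar> = \<infinity> then 0
      else int (the_enat (fhomology_incl_rank K p
                  (sublevel Y f (real_of_ereal s)) (sublevel Y f (real_of_ereal t)))))"

text \<open>
  A diagram is a multiset in the extended plane, given by its multiplicity function; it may have
  infinitely many points, which rules out the type \<open>multiset\<close>.
\<close>

type_synonym diagram = "ereal \<times> ereal \<Rightarrow> nat"

definition Dgm :: "diagram set" where
  "Dgm = {D. (\<forall>b d. D (b, d) \<noteq> 0 \<longrightarrow> b < d) \<and>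
             (\<forall>a b' c d'. a < b' \<and> b' < c \<and> c < d' \<longrightarrow>
                finite {p \<in> {a..b'} \<times> {c..d'}. D p \<noteq> 0})}"

text \<open>
  The interior is taken in \<open>ereal \<times> ereal\<close>, so it contains the points with \<open>b = -\<infinity> = a\<close> or
  \<open>d = \<infinity> = d'\<close>. The infimum of a nonempty set of naturals is its minimum, and the alternating sum of
  ranks is nonnegative, being the dimension of a subquotient of \<open>V\<close>.
\<close>

definition PH :: "'k::field itself \<Rightarrow> nat \<Rightarrow> 'a topology \<Rightarrow> ('a \<Rightarrow> real) \<Rightarrow> diagram" where
  "PH K i Y f = (\<lambda>(b, d). if b < d then
     (let r = persistence_rank K i Y f in
      Inf {nat (r b' c - r a c - r b' d' + r a d') |a b' c d'.
             a < b' \<and> b' < c \<and> c < d' \<and> (b, d) \<in> interior ({a..b'} \<times> {c..d'})})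
     else 0)"


section \<open>Bottleneck distance\<close>

text \<open>Here \<open>\<infinity>\<close> has distance \<open>0\<close> from itself, although \<open>\<infinity> - \<infinity> = \<infinity>\<close> in \<^typ>\<open>ereal\<close>.\<close>

definition ext_dist :: "ereal \<Rightarrow> ereal \<Rightarrow> ennreal" where
  "ext_dist x y = (if x = y then 0 else e2ennreal \<bar>x - y\<bar>)"

definition linf_dist :: "ereal \<times> ereal \<Rightarrow> ereal \<times> ereal \<Rightarrow> ennreal" where
  "linf_dist p q = max (ext_dist (fst p) (fst q)) (ext_dist (snd p) (snd q))"

definition diag_dist :: "ereal \<times> ereal \<Rightarrow> ennreal" where
  "diag_dist p = (INF x. linf_dist p (x, x))"

text \<open>The points of a diagram with their repetitions told apart by an index.\<close>

definition dgm_points :: "diagram \<Rightarrow> ((ereal \<times> ereal) \<times> nat) set" where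
  "dgm_points D = {(p, k). k < D p}"

definition partial_matching :: "'a set \<Rightarrow> 'b set \<Rightarrow> ('a \<times> 'b) set \<Rightarrow> bool" where
  "partial_matching A B M \<longleftrightarrow> M \<subseteq> A \<times> B \<and> inj_on fst M \<and> inj_on snd M"

definition matching_cost ::
    "diagram \<Rightarrow> diagram \<Rightarrow> (((ereal \<times> ereal) \<times> nat) \<times> ((ereal \<times> ereal) \<times> nat)) set \<Rightarrow> ennreal" where
  "matching_cost D E M =
     Sup ({linf_dist (fst x) (fst y) |x y. (x, y) \<in> M} \<union>
          {diag_dist (fst x) |x. x \<in> dgm_points D - fst ` M} \<union>
          {diag_dist (fst y) |y. y \<in> dgm_points E - snd ` M})"

definition bottleneck :: "diagram \<Rightarrow> diagram \<Rightarrow> ennreal" where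
  "bottleneck D E =
     Inf {matching_cost D E M |M. partial_matching (dgm_points D) (dgm_points E) M}"

definition Dgm_topology :: "diagram topology" where
  "Dgm_topology = topology (\<lambda>U. U \<subseteq> Dgm \<and>
     (\<forall>D\<in>U. \<exists>\<epsilon>>0. \<forall>E\<in>Dgm. bottleneck D E < \<epsilon> \<longrightarrow> E \<in> U))"

lemma openin_Dgm_topology:
  "openin Dgm_topology U \<longleftrightarrow>
     U \<subseteq> Dgm \<and> (\<forall>D\<in>U. \<exists>\<epsilon>>0. \<forall>E\<in>Dgm. bottleneck D E < \<epsilon> \<longrightarrow> E \<in> U)"
proof -
  let ?P = "\<lambda>U. U \<subseteq> Dgm \<and> (\<forall>D\<in>U. \<exists>\<epsilon>>0. \<forall>E\<in>Dgm. bottleneck D E < \<epsilon> \<longrightarrow> E \<in> U)"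
  have "istopology ?P"
    unfolding istopology_def
  proof (intro conjI allI impI)
    fix S T assume S: "?P S" and T: "?P T"
    show "S \<inter> T \<subseteq> Dgm" using S by blast
    show "\<forall>D\<in>S \<inter> T. \<exists>\<epsilon>>0. \<forall>E\<in>Dgm. bottleneck D E < \<epsilon> \<longrightarrow> E \<in> S \<inter> T"
    proof
      fix D assume D: "D \<in> S \<inter> T"
      obtain e1 where e1: "e1 > 0" "\<forall>E\<in>Dgm. bottleneck D E < e1 \<longrightarrow> E \<in> S"
        using S D by blast
      obtain e2 where e2: "e2 > 0" "\<forall>E\<in>Dgm. bottleneck D E < e2 \<longrightarrow> E \<in> T"
        using T D by blast
      show "\<exists>\<epsilon>>0. \<forall>E\<in>Dgm. bottleneck D E < \<epsilon> \<longrightarrow> E \<in> S \<inter> T"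
        by (rule exI[of _ "min e1 e2"]) (use e1 e2 in auto)
    qed
  next
    fix \<K> assume \<K>: "\<forall>U\<in>\<K>. ?P U"
    show "\<Union>\<K> \<subseteq> Dgm" using \<K> by blast
    show "\<forall>D\<in>\<Union>\<K>. \<exists>\<epsilon>>0. \<forall>E\<in>Dgm. bottleneck D E < \<epsilon> \<longrightarrow> E \<in> \<Union>\<K>"
    proof
      fix D assume "D \<in> \<Union>\<K>"
      then obtain U where U: "U \<in> \<K>" "D \<in> U" by blast
      then obtain e where "e > 0" "\<forall>E\<in>Dgm. bottleneck D E < e \<longrightarrow> E \<in> U"
        using \<K> by blast
      then show "\<exists>\<epsilon>>0. \<forall>E\<in>Dgm. bottleneck D E < \<epsilon> \<longrightarrow> E \<in> \<Union>\<K>"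
        using U by blast
    qed
  qed
  then show ?thesis
    by (simp add: Dgm_topology_def topology_inverse')
qed

lemma topspace_Dgm_topology [simp]: "topspace Dgm_topology = Dgm"
proof
  show "topspace Dgm_topology \<subseteq> Dgm"
    using openin_Dgm_topology openin_topspace by blast
  have "openin Dgm_topology Dgm"
    unfolding openin_Dgm_topology using zero_less_one by blast
  then show "Dgm \<subseteq> topspace Dgm_topology"
    by (rule openin_subset)
qed


section \<open>Loops and unordered pairs of points of the circle\<close>

abbreviation circle :: "complex topology" where
  "circle \<equiv> top_of_set (sphere 0 1)"

text \<open>Boundedness, which \<^const>\<open>cfunspace\<close> demands, is automatic as the circle is compact.\<close>

definition loop_space :: "'x metric \<Rightarrow> (complex \<Rightarrow> 'x) metric" where
  "loop_space X = cfunspace circle X"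

definition F2_carrier :: "complex set set" where
  "F2_carrier = {A. A \<subseteq> sphere 0 1 \<and> A \<noteq> {} \<and> finite A \<and> card A \<le> 2}"

definition F2_circle :: "complex set topology" where
  "F2_circle = topology (\<lambda>U. U \<subseteq> F2_carrier \<and>
     openin (prod_topology circle circle)
       {w \<in> topspace (prod_topology circle circle). {fst w, snd w} \<in> U})"

lemma openin_F2_circle:
  "openin F2_circle U \<longleftrightarrow> U \<subseteq> F2_carrier \<and>
     openin (prod_topology circle circle)
       {w \<in> topspace (prod_topology circle circle). {fst w, snd w} \<in> U}"
proof -
  let ?Z = "prod_topology circle circle"
  let ?pre = "\<lambda>U. {w \<in> topspace ?Z. {fst w, snd w} \<in> U}"
  have "istopology (\<lambda>U. U \<subseteq> F2_carrier \<and> openin ?Z (?pre U))"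
    unfolding istopology_def
  proof (rule conjI; intro allI impI)
    fix S T
    assume S: "S \<subseteq> F2_carrier \<and> openin ?Z (?pre S)" and T: "T \<subseteq> F2_carrier \<and> openin ?Z (?pre T)"
    have "?pre (S \<inter> T) = ?pre S \<inter> ?pre T" by blast
    then have "openin ?Z (?pre (S \<inter> T))" using S T by (simp only: openin_Int)
    then show "S \<inter> T \<subseteq> F2_carrier \<and> openin ?Z (?pre (S \<inter> T))" using S by blast
  next
    fix \<K> assume K: "\<forall>U\<in>\<K>. U \<subseteq> F2_carrier \<and> openin ?Z (?pre U)"
    have "?pre (\<Union>\<K>) = \<Union>(?pre ` \<K>)" by blast
    moreover have "openin ?Z (\<Union>(?pre ` \<K>))" using K by (intro openin_Union) blast
    ultimately have "openin ?Z (?pre (\<Union>\<K>))" by (simp only:)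
    then show "\<Union>\<K> \<subseteq> F2_carrier \<and> openin ?Z (?pre (\<Union>\<K>))" using K by blast
  qed
  then show ?thesis
    unfolding F2_circle_def by (simp only: topology_inverse')
qed

lemma F2_carrier_image: "(\<lambda>w. {fst w, snd w}) ` (sphere 0 1 \<times> sphere 0 1) = F2_carrier"
proof
  show "(\<lambda>w. {fst w, snd w}) ` (sphere 0 1 \<times> sphere 0 1) \<subseteq> F2_carrier"
    by (auto simp: F2_carrier_def card_insert_if)
  show "F2_carrier \<subseteq> (\<lambda>w. {fst w, snd w}) ` (sphere 0 1 \<times> sphere 0 1)"
  proof
    fix A assume A: "A \<in> F2_carrier"
    then have "card A = 1 \<or> card A = 2"
      using card_gt_0_iff[of A] by (auto simp: F2_carrier_def)
    then obtain z1 z2 where "A = {z1, z2}"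
      by (metis card_1_singletonE card_2_iff insert_absorb2)
    then show "A \<in> (\<lambda>w. {fst w, snd w}) ` (sphere 0 1 \<times> sphere 0 1)"
      using A by (force simp: F2_carrier_def)
  qed
qed

lemma topspace_F2_circle [simp]: "topspace F2_circle = F2_carrier"
proof
  show "topspace F2_circle \<subseteq> F2_carrier"
    using openin_F2_circle openin_topspace by blast
  have "{w \<in> topspace (prod_topology circle circle). {fst w, snd w} \<in> F2_carrier}
          = topspace (prod_topology circle circle)"
    unfolding F2_carrier_image[symmetric] by auto
  then have "openin F2_circle F2_carrier"
    unfolding openin_F2_circle by (simp only: openin_topspace subset_refl simp_thms)
  then show "F2_carrier \<subseteq> topspace F2_circle"
    by (rule openin_subset)
qed

lemma quotient_map_F2_circle:
  "quotient_map (prod_topology circle circle) F2_circle (\<lambda>w. {fst w, snd w})"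
  unfolding quotient_map_def openin_F2_circle topspace_F2_circle
  using F2_carrier_image by auto

text \<open>
  The function \<open>{z\<^sub>1, z\<^sub>2} \<mapsto> d(\<gamma> z\<^sub>1, \<gamma> z\<^sub>2)\<close>; well defined since the metric is
  symmetric.
\<close>

definition pair_dist :: "'x metric \<Rightarrow> (complex \<Rightarrow> 'x) \<Rightarrow> complex set \<Rightarrow> real" where
  "pair_dist X \<gamma> A = (THE r. \<exists>z1 z2. A = {z1, z2} \<and> r = mdist X (\<gamma> z1) (\<gamma> z2))"

definition pair_energy :: "'x metric \<Rightarrow> (complex \<Rightarrow> 'x) \<Rightarrow> complex set \<Rightarrow> real" where
  "pair_energy X \<gamma> A = (pair_dist X \<gamma> A)\<^sup>2 / 2"

lemma pair_dist_eq: "pair_dist X \<gamma> {z1, z2} = mdist X (\<gamma> z1) (\<gamma> z2)"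
  unfolding pair_dist_def
  by (rule the_equality) (auto simp: doubleton_eq_iff mdist_commute)

end

theory Submission
  imports Defs
begin

text \<open>
  The Moebius band \<open>F2_circle\<close> is a retract of an open subset of \<open>\<complex>\<^sup>2\<close>. Hence, for \<open>s < t\<close>, the inclusion
  of the sublevel set at \<open>s\<close> into the one at \<open>t\<close> factors through a finite union of open balls,
  whose homology is finite-dimensional by Mayer-Vietoris; this is q-tameness. The sublevel sets of two
  functions at distance at most \<open>\<eta>\<close> form interlaced chains, so a rectangle contains at most as many
  points of one diagram as its \<open>\<eta>\<close>-thickening contains points of the other. If \<open>\<eta>\<close> is small compared
  with the gaps in the first diagram, this matches the points away from the diagonal. Two arbitrary
  functions \<open>f\<close> and \<open>g\<close> are joined by the segment \<open>(1 - u) f + u g\<close>, along which the local matchings are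
  composed. Finally \<open>\<gamma> \<mapsto> d(\<gamma> z\<^sub>1, \<gamma> z\<^sub>2)\<close> is \<open>2\<close>-Lipschitz for the supremum distances.
\<close>

section \<open>Dimension of a subspace modulo another\<close>

text \<open>Sublevel sets of a continuous function can be arbitrarily wild, so finiteness has to
  come from the gap between two levels and not from the sets themselves. All ranks are expressed
  inside one chain space, as dimensions of cycles of one level modulo boundaries of another;
  comparing two filtrations then means comparing subspaces, and no induced maps have to be tracked.
  The alternating sum of ranks is an additive nonnegative function of rectangles off the diagonal,
  and compactness of rectangles in the extended plane shows that it counts points of the diagram, up
  to effects on the border. Such counts yield a matching only while the points of the first diagram
  are isolated at the scale of the perturbation. Infinitely many points may accumulate at the
  diagonal, so those of small persistence are dropped at a cost \<kappa> that tends to 0 at the end.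
  The squared distance has no global Lipschitz constant, which is why only continuity is obtained
  for the energy.\<close>

locale quotient_dimension = vector_space scale
  for scale :: "'a::field \<Rightarrow> 'b::ab_group_add \<Rightarrow> 'b"
begin

definition indep_mod :: "'b set \<Rightarrow> 'b set \<Rightarrow> bool" where
  "indep_mod B S \<longleftrightarrow> finite S \<and> (\<forall>c. (\<Sum>s\<in>S. scale (c s) s) \<in> B \<longrightarrow> (\<forall>s\<in>S. c s = 0))"

definition basis_mod :: "'b set \<Rightarrow> 'b set \<Rightarrow> 'b set \<Rightarrow> bool" where
  "basis_mod A B S \<longleftrightarrow> S \<subseteq> A \<and> indep_mod B S \<and> A \<subseteq> span (S \<union> B)"

definition fin_mod :: "'b set \<Rightarrow> 'b set \<Rightarrow> bool" where
  "fin_mod A B \<longleftrightarrow> (\<exists>T. finite T \<and> A \<subseteq> span (T \<union> B))"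

text \<open>\<open>B\<close> need not lie in \<open>A\<close>: for a subspace \<open>A\<close> this
  is dim (A + B)/B, the dimension of the image of \<open>A\<close> modulo \<open>B\<close>. With
  cycles of one level as \<open>A\<close> and boundaries of a later level as \<open>B\<close> it is
  the rank of the map in homology. It is meaningful under \<open>fin_mod\<close>.\<close>

definition dim_mod :: "'b set \<Rightarrow> 'b set \<Rightarrow> nat" where
  "dim_mod A B = card (SOME S. basis_mod A B S)"

lemma span_Un_subspaceE:
  assumes "x \<in> span (T \<union> B)" "subspace B"
  obtains y b where "y \<in> span T" "b \<in> B" "x = y + b"
proof -
  obtain y b where "y \<in> span T" "b \<in> span B" "x = y + b"
    using assms(1) by (auto simp: span_Un)
  moreover have "span B \<subseteq> B" using assms(2) by (simp add: span_minimal)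
  ultimately show ?thesis using that[of y b] by blast
qed

lemma indep_mod_disjoint:
  assumes "indep_mod B S"
  shows "S \<inter> B = {}"
proof -
  have False if x: "x \<in> S" "x \<in> B" for x
  proof -
    define c where "c s = (if s = x then 1 else 0 :: 'a)" for s
    have "(\<Sum>s\<in>S. scale (c s) s) = (\<Sum>s\<in>S. if s = x then x else 0)"
      by (rule sum.cong) (auto simp: c_def)
    also have "\<dots> = x" using assms x by (simp add: indep_mod_def)
    finally have "(\<Sum>s\<in>S. scale (c s) s) \<in> B" using x by simp
    then have "c x = 0" using assms x unfolding indep_mod_def by blast
    then show False by (simp add: c_def)
  qed
  then show ?thesis by blast
qed

text \<open>Steinitz exchange modulo \<open>B\<close>, where \<open>B\<close> may have infinite
  dimension. Each \<open>s\<close> in \<open>S\<close> differs from an element of span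
  \<open>T\<close> by some \<open>b s\<close> in \<open>B\<close>. If \<open>F\<close> is a basis of
  the span of these finitely many vectors, \<open>S\<close> and \<open>F\<close> together are
  independent and lie in the span of \<open>T\<close> and \<open>F\<close>; the size of
  \<open>F\<close> cancels.\<close>

lemma card_indep_mod_le:
  assumes B: "subspace B" and S: "indep_mod B S" and T: "finite T" "S \<subseteq> span (T \<union> B)"
  shows "card S \<le> card T"
proof -
  have "\<forall>s\<in>S. \<exists>b. b \<in> B \<and> s - b \<in> span T"
    using T(2) B by (metis add_diff_cancel_right' span_Un_subspaceE subsetD)
  then obtain b where b: "\<And>s. s \<in> S \<Longrightarrow> b s \<in> B" "\<And>s. s \<in> S \<Longrightarrow> s - b s \<in> span T"
    by metis
  obtain F where F: "F \<subseteq> b ` S" "independent F" "b ` S \<subseteq> span F"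
    using maximal_independent_subset by blast
  have finS: "finite S" using S by (simp add: indep_mod_def)
  then have finF: "finite F" using F(1) finite_surj by blast
  have FB: "F \<subseteq> B" using F b by blast
  have spanFB: "span F \<subseteq> B" using FB B span_minimal by blast
  have zero: "c s = 0" if "s \<in> S" "(\<Sum>s\<in>S. scale (c s) s) \<in> B" for c s
    using S that by (auto simp: indep_mod_def)
  have disj: "S \<inter> F = {}" using indep_mod_disjoint[OF S] FB by blast
  have ind: "independent (S \<union> F)"
  proof (rule independent_if_scalars_zero)
    show "finite (S \<union> F)" using finS finF by simp
    fix f x assume eq: "(\<Sum>x\<in>S \<union> F. scale (f x) x) = 0" and x: "x \<in> S \<union> F"
    have sum: "(\<Sum>x\<in>S. scale (f x) x) + (\<Sum>x\<in>F. scale (f x) x) = 0"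
      using eq sum.union_disjoint[OF finS finF disj, of "\<lambda>x. scale (f x) x"] by simp
    have FinB: "(\<Sum>x\<in>F. scale (f x) x) \<in> B"
      using FB B by (intro subspace_sum subspace_scale) auto
    have "(\<Sum>x\<in>S. scale (f x) x) = - (\<Sum>x\<in>F. scale (f x) x)"
      using sum by (simp add: eq_neg_iff_add_eq_0)
    then have "(\<Sum>x\<in>S. scale (f x) x) \<in> B"
      using FinB B by (simp add: subspace_neg)
    then have S0: "\<forall>s\<in>S. f s = 0" using zero by blast
    then have "(\<Sum>x\<in>F. scale (f x) x) = 0" using sum by simp
    then have "\<forall>s\<in>F. f s = 0" using F(2) finF independent_explicit_finite_subsets by blast
    then show "f x = 0" using S0 x by blast
  qed
  have "S \<union> F \<subseteq> span (T \<union> F)"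
  proof
    fix x assume x: "x \<in> S \<union> F"
    show "x \<in> span (T \<union> F)"
    proof (cases "x \<in> F")
      case True then show ?thesis by (simp add: span_base)
    next
      case False
      then have xS: "x \<in> S" using x by blast
      have "x - b x \<in> span (T \<union> F)" using b(2)[OF xS] span_mono[of T "T \<union> F"] by blast
      moreover have "b x \<in> span (T \<union> F)"
        using F(3) xS span_mono[of F "T \<union> F"] by blast
      ultimately show ?thesis using span_add by fastforce
    qed
  qed
  then have "card (S \<union> F) \<le> card (T \<union> F)"
    using independent_span_bound[OF _ ind] T(1) finF by blast
  then show ?thesis
    using card_Un_disjoint[OF finS finF disj] card_Un_le[of T F] by linarith
qed

lemma indep_mod_insert:
  assumes B: "subspace B" and S: "indep_mod B S" and x: "x \<notin> span (S \<union> B)"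
  shows "indep_mod B (insert x S)"
proof -
  have finS: "finite S" using S by (simp add: indep_mod_def)
  have xS: "x \<notin> S" using x span_base by blast
  have "\<forall>s\<in>insert x S. c s = 0" if c: "(\<Sum>s\<in>insert x S. scale (c s) s) \<in> B" for c
  proof -
    have c': "scale (c x) x + (\<Sum>s\<in>S. scale (c s) s) \<in> B" using c finS xS by simp
    have cx: "c x = 0"
    proof (rule ccontr)
      assume nz: "c x \<noteq> 0"
      have "scale (c x) x + (\<Sum>s\<in>S. scale (c s) s) \<in> span (S \<union> B)" using c' span_base by blast
      moreover have "(\<Sum>s\<in>S. scale (c s) s) \<in> span (S \<union> B)"
        by (intro span_sum span_scale span_base) auto
      ultimately have "scale (c x) x \<in> span (S \<union> B)"
        using span_diff by fastforce
      then have "scale (inverse (c x)) (scale (c x) x) \<in> span (S \<union> B)" by (rule span_scale)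
      then show False using nz x by simp
    qed
    then have "(\<Sum>s\<in>S. scale (c s) s) \<in> B" using c' by simp
    then show ?thesis using S cx by (auto simp: indep_mod_def)
  qed
  then show ?thesis using finS by (auto simp: indep_mod_def)
qed

text \<open>An independent subset of largest size works: exchange with a finite spanning set bounds
  all sizes, and a vector outside the span could still be adjoined.\<close>

lemma basis_mod_exists:
  assumes B: "subspace B" and fin: "fin_mod A B"
  shows "\<exists>S. basis_mod A B S"
proof -
  obtain T where T: "finite T" "A \<subseteq> span (T \<union> B)" using fin by (auto simp: fin_mod_def)
  let ?P = "\<lambda>S. S \<subseteq> A \<and> indep_mod B S"
  have bound: "\<forall>S. ?P S \<longrightarrow> card S < Suc (card T)"
    using card_indep_mod_le[OF B _ T(1)] T(2) by (meson less_Suc_eq_le order_trans)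
  have "?P {}" by (simp add: indep_mod_def)
  then obtain S where S: "?P S" and mx: "\<And>S'. ?P S' \<Longrightarrow> card S' \<le> card S"
    using ex_has_greatest_nat[of ?P "{}" card "Suc (card T)"] bound by (meson less_imp_le)
  have "A \<subseteq> span (S \<union> B)"
  proof
    fix x assume x: "x \<in> A"
    show "x \<in> span (S \<union> B)"
    proof (rule ccontr)
      assume n: "x \<notin> span (S \<union> B)"
      then have "?P (insert x S)" using S x indep_mod_insert[OF B] by blast
      then have "card (insert x S) \<le> card S" by (rule mx)
      moreover have "finite S" using S by (simp add: indep_mod_def)
      moreover have "x \<notin> S" using n span_base[of x "S \<union> B"] by blast
      ultimately show False by simp
    qed
  qed
  then show ?thesis using S by (auto simp: basis_mod_def)
qed

lemma card_basis_mod: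
  assumes B: "subspace B" and S: "basis_mod A B S" "basis_mod A B S'"
  shows "card S = card S'"
proof (rule order_antisym)
  have *: "card S \<le> card S'" if "basis_mod A B S" "basis_mod A B S'" for S S'
  proof (rule card_indep_mod_le[OF B])
    show "indep_mod B S" "finite S'" using that by (auto simp: basis_mod_def indep_mod_def)
    show "S \<subseteq> span (S' \<union> B)" using that by (auto simp only: basis_mod_def)
  qed
  show "card S \<le> card S'" "card S' \<le> card S" using *[OF S] *[OF S(2) S(1)] by simp_all
qed

lemma dim_mod_eq:
  assumes "subspace B" "basis_mod A B S"
  shows "dim_mod A B = card S"
proof -
  have "basis_mod A B (SOME S. basis_mod A B S)" using assms(2) by (rule someI)
  then show ?thesis unfolding dim_mod_def using card_basis_mod[OF assms(1) _ assms(2)] by blast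
qed

lemma fin_mod_mono: "fin_mod A B \<Longrightarrow> A' \<subseteq> A \<Longrightarrow> B \<subseteq> B' \<Longrightarrow> fin_mod A' B'"
proof -
  assume "fin_mod A B" and A: "A' \<subseteq> A" and B: "B \<subseteq> B'"
  then obtain T where T: "finite T" "A \<subseteq> span (T \<union> B)" by (auto simp only: fin_mod_def)
  have "span (T \<union> B) \<subseteq> span (T \<union> B')" using B by (intro span_mono) blast
  then have "A' \<subseteq> span (T \<union> B')" using T(2) A by (meson order_trans)
  then show ?thesis using T(1) unfolding fin_mod_def by blast
qed

lemma dim_mod_mono:
  assumes "subspace B" "fin_mod A B" "A' \<subseteq> A"
  shows "dim_mod A' B \<le> dim_mod A B"
proof -
  obtain S where S: "basis_mod A B S" using assms basis_mod_exists by blast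
  obtain S' where S': "basis_mod A' B S'"
    using assms basis_mod_exists fin_mod_mono by blast
  have "card S' \<le> card S"
  proof (rule card_indep_mod_le[OF assms(1)])
    show "indep_mod B S'" "finite S" using S S' by (auto simp: basis_mod_def indep_mod_def)
    show "S' \<subseteq> span (S \<union> B)" using S S' assms(3) unfolding basis_mod_def by (meson order_trans)
  qed
  then show ?thesis using dim_mod_eq[OF assms(1) S] dim_mod_eq[OF assms(1) S'] by simp
qed

text \<open>Rank-nullity for the projection from \<open>A\<close> modulo \<open>B\<close> to
  \<open>A\<close> modulo \<open>C\<close>, whose kernel is represented by
  \<open>A \<inter> C\<close>: a basis of the image and one of the kernel unite to a basis.\<close>

lemma dim_mod_add:
  assumes A: "subspace A" and B: "subspace B" and C: "subspace C" and BC: "B \<subseteq> C"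
    and fin: "fin_mod A B"
  shows "dim_mod A B = dim_mod A C + dim_mod (A \<inter> C) B"
proof -
  obtain S where S: "basis_mod A C S"
    using basis_mod_exists[OF C] fin fin_mod_mono BC by blast
  obtain T where T: "basis_mod (A \<inter> C) B T"
    using basis_mod_exists[OF B] fin fin_mod_mono by (metis inf_le1 order_refl)
  have finS: "finite S" and finT: "finite T" using S T by (auto simp: basis_mod_def indep_mod_def)
  have TC: "T \<subseteq> C" and TA: "T \<subseteq> A" and SA: "S \<subseteq> A" using S T by (auto simp: basis_mod_def)
  have zero: "c s = 0" if "s \<in> S" "(\<Sum>s\<in>S. scale (c s) s) \<in> C" for c s
    using S that by (auto simp: indep_mod_def basis_mod_def)
  have disj: "S \<inter> T = {}"
    using S TC indep_mod_disjoint[of C S] by (auto simp: basis_mod_def)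
  have "basis_mod A B (S \<union> T)"
    unfolding basis_mod_def
  proof (intro conjI)
    show "S \<union> T \<subseteq> A" using SA TA by simp
    show "indep_mod B (S \<union> T)"
      unfolding indep_mod_def
    proof (intro conjI allI impI)
      show "finite (S \<union> T)" using finS finT by simp
      fix c assume "(\<Sum>s\<in>S \<union> T. scale (c s) s) \<in> B"
      then have sum: "(\<Sum>s\<in>S. scale (c s) s) + (\<Sum>s\<in>T. scale (c s) s) \<in> B"
        by (simp add: sum.union_disjoint[OF finS finT disj])
      moreover have "(\<Sum>s\<in>T. scale (c s) s) \<in> C"
        using TC C by (intro subspace_sum subspace_scale) auto
      ultimately have "(\<Sum>s\<in>S. scale (c s) s) \<in> C"
        using BC C subspace_diff by fastforce
      then have S0: "\<forall>s\<in>S. c s = 0" using zero by blast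
      then have "(\<Sum>s\<in>T. scale (c s) s) \<in> B" using sum by simp
      then have "\<forall>s\<in>T. c s = 0" using T by (auto simp: basis_mod_def indep_mod_def)
      then show "\<forall>s\<in>S \<union> T. c s = 0" using S0 by blast
    qed
    show "A \<subseteq> span (S \<union> T \<union> B)"
    proof
      fix x assume x: "x \<in> A"
      then obtain y c where y: "y \<in> span S" "c \<in> C" "x = y + c"
        using S C span_Un_subspaceE unfolding basis_mod_def by blast
      have "y \<in> A" using y(1) SA A span_minimal by blast
      then have "c \<in> A \<inter> C" using x y A subspace_diff by fastforce
      then have "c \<in> span (T \<union> B)" using T by (auto simp: basis_mod_def)
      then have "c \<in> span (S \<union> T \<union> B)" using span_mono[of "T \<union> B" "S \<union> T \<union> B"] by blast
      moreover have "y \<in> span (S \<union> T \<union> B)" using y span_mono[of S "S \<union> T \<union> B"] by blast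
      ultimately show "x \<in> span (S \<union> T \<union> B)" using y span_add by blast
    qed
  qed
  then have "dim_mod A B = card (S \<union> T)" using dim_mod_eq B by blast
  also have "\<dots> = card S + card T" by (rule card_Un_disjoint[OF finS finT disj])
  finally show ?thesis using dim_mod_eq[OF C S] dim_mod_eq[OF B T] by simp
qed

text \<open>
  The left-hand side counts the intervals of a persistence module that are born between \<open>A\<close> and
  \<open>A'\<close> and die between \<open>B\<close> and \<open>B'\<close>; it is \<open>dim (A' \<inter> B')/B - dim (A \<inter> B')/B\<close>.
\<close>

lemma dim_mod_rectangle_nonneg:
  assumes sub: "subspace A" "subspace A'" "subspace B" "subspace B'"
    and AA: "A \<subseteq> A'" and BB: "B \<subseteq> B'" and fin: "fin_mod A' B"
  shows "int (dim_mod A' B) - int (dim_mod A B) - int (dim_mod A' B') + int (dim_mod A B') \<ge> 0"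
proof -
  have 1: "dim_mod A' B = dim_mod A' B' + dim_mod (A' \<inter> B') B"
    by (rule dim_mod_add[OF sub(2,3,4) BB fin])
  have 2: "dim_mod A B = dim_mod A B' + dim_mod (A \<inter> B') B"
    by (rule dim_mod_add[OF sub(1,3,4) BB fin_mod_mono[OF fin AA order_refl]])
  have "dim_mod (A \<inter> B') B \<le> dim_mod (A' \<inter> B') B"
    by (rule dim_mod_mono[OF sub(3) fin_mod_mono[OF fin]]) (use AA in auto)
  then show ?thesis using 1 2 by linarith
qed

text \<open>The outer rectangle consists of the inner one and four others, two of full height beside
  it and one each below and above it, all with nonnegative count. The two outer members of either
  chain will come from one filtration, the two inner ones from another.\<close>

lemma dim_mod_rectangle_mono:
  assumes A: "subspace A\<^sub>0" "subspace A\<^sub>1" "subspace A\<^sub>2" "subspace A\<^sub>3"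
      "A\<^sub>0 \<subseteq> A\<^sub>1" "A\<^sub>1 \<subseteq> A\<^sub>2" "A\<^sub>2 \<subseteq> A\<^sub>3"
    and B: "subspace B\<^sub>0" "subspace B\<^sub>1" "subspace B\<^sub>2" "subspace B\<^sub>3"
      "B\<^sub>0 \<subseteq> B\<^sub>1" "B\<^sub>1 \<subseteq> B\<^sub>2" "B\<^sub>2 \<subseteq> B\<^sub>3"
    and fin: "fin_mod A\<^sub>3 B\<^sub>0"
  defines "R \<equiv> \<lambda>A B. int (dim_mod A B)"
  shows "R A\<^sub>2 B\<^sub>1 - R A\<^sub>1 B\<^sub>1 - R A\<^sub>2 B\<^sub>2 + R A\<^sub>1 B\<^sub>2 \<le> R A\<^sub>3 B\<^sub>0 - R A\<^sub>0 B\<^sub>0 - R A\<^sub>3 B\<^sub>3 + R A\<^sub>0 B\<^sub>3"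
proof -
  have nn: "R A' B - R A B - R A' B' + R A B' \<ge> 0"
    if "subspace A" "subspace A'" "subspace B" "subspace B'" "A \<subseteq> A'" "B \<subseteq> B'" "A' \<subseteq> A\<^sub>3" "B\<^sub>0 \<subseteq> B" for A A' B B'
    unfolding R_def using that fin_mod_mono[OF fin] by (intro dim_mod_rectangle_nonneg)
  have "R A\<^sub>3 B\<^sub>0 - R A\<^sub>2 B\<^sub>0 - R A\<^sub>3 B\<^sub>3 + R A\<^sub>2 B\<^sub>3 \<ge> 0"
    by (rule nn) (use A B in auto)
  moreover have "R A\<^sub>1 B\<^sub>0 - R A\<^sub>0 B\<^sub>0 - R A\<^sub>1 B\<^sub>3 + R A\<^sub>0 B\<^sub>3 \<ge> 0"
    by (rule nn) (use A B in auto)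
  moreover have "R A\<^sub>2 B\<^sub>0 - R A\<^sub>1 B\<^sub>0 - R A\<^sub>2 B\<^sub>1 + R A\<^sub>1 B\<^sub>1 \<ge> 0"
    by (rule nn) (use A B in auto)
  moreover have "R A\<^sub>2 B\<^sub>2 - R A\<^sub>1 B\<^sub>2 - R A\<^sub>2 B\<^sub>3 + R A\<^sub>1 B\<^sub>3 \<ge> 0"
    by (rule nn) (use A B in auto)
  ultimately show ?thesis by linarith
qed

lemma dim_mod_eq_0: "subspace B \<Longrightarrow> A \<subseteq> B \<Longrightarrow> dim_mod A B = 0"
  using dim_mod_eq[of B A "{}"] span_superset[of B] by (auto simp: basis_mod_def indep_mod_def)

end

section \<open>Chains with coefficients in a field\<close>

lemma lookup_fchain_scale [simp]: "Poly_Mapping.lookup (fchain_scale a c) x = a * Poly_Mapping.lookup c x"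
  unfolding fchain_scale_def by (simp add: Poly_Mapping.map.rep_eq when_def)

interpretation fchain: quotient_dimension fchain_scale
  by unfold_locales (auto intro!: poly_mapping_eqI simp: lookup_add algebra_simps)

section \<open>Linear extension, and transport of integral chain maps to the field\<close>

definition fextend :: "('a \<Rightarrow> 'b \<Rightarrow>\<^sub>0 'k::field) \<Rightarrow> ('a \<Rightarrow>\<^sub>0 'k) \<Rightarrow> ('b \<Rightarrow>\<^sub>0 'k)" where
  "fextend \<phi> c = (\<Sum>\<sigma>\<in>Poly_Mapping.keys c. fchain_scale (Poly_Mapping.lookup c \<sigma>) (\<phi> \<sigma>))"

lemma fextend_superset:
  assumes "finite S" "Poly_Mapping.keys c \<subseteq> S"
  shows "fextend \<phi> c = (\<Sum>\<sigma>\<in>S. fchain_scale (Poly_Mapping.lookup c \<sigma>) (\<phi> \<sigma>))"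
  unfolding fextend_def using assms
  by (intro sum.mono_neutral_left) (auto simp: in_keys_iff)

lemma fextend_add: "fextend \<phi> (c + d) = fextend \<phi> c + fextend \<phi> d"
proof -
  let ?S = "Poly_Mapping.keys c \<union> Poly_Mapping.keys d"
  have "Poly_Mapping.keys (c + d) \<subseteq> ?S" by (rule keys_add)
  then show ?thesis
    using fextend_superset[of ?S c \<phi>] fextend_superset[of ?S d \<phi>] fextend_superset[of ?S "c + d" \<phi>]
    by (simp add: lookup_add fchain.scale_left_distrib sum.distrib)
qed

lemma fextend_scale: "fextend \<phi> (fchain_scale a c) = fchain_scale a (fextend \<phi> c)"
proof -
  have "Poly_Mapping.keys (fchain_scale a c) \<subseteq> Poly_Mapping.keys c" by (auto simp: in_keys_iff)
  then show ?thesis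
    using fextend_superset[of "Poly_Mapping.keys c" "fchain_scale a c" \<phi>]
    by (simp add: fextend_def fchain.scale_sum_right)
qed

lemma fextend_0 [simp]: "fextend \<phi> 0 = 0"
  by (simp add: fextend_def)

lemma fextend_uminus: "fextend \<phi> (- c) = - fextend \<phi> c"
  using fextend_add[of \<phi> "- c" c] by (simp add: eq_neg_iff_add_eq_0)

lemma fextend_diff: "fextend \<phi> (c - d) = fextend \<phi> c - fextend \<phi> d"
  using fextend_add[of \<phi> c "- d"] by (simp add: fextend_uminus)

lemma fextend_sum: "fextend \<phi> (sum g I) = (\<Sum>i\<in>I. fextend \<phi> (g i))"
  by (induction I rule: infinite_finite_induct) (auto simp: fextend_add)

lemma fextend_single [simp]: "fextend \<phi> (Poly_Mapping.single \<sigma> a) = fchain_scale a (\<phi> \<sigma>)"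
  by (simp add: fextend_def)

lemma keys_fextend: "Poly_Mapping.keys (fextend \<phi> c) \<subseteq> (\<Union>\<sigma>\<in>Poly_Mapping.keys c. Poly_Mapping.keys (\<phi> \<sigma>))"
  unfolding fextend_def
  by (rule order_trans[OF keys_sum]) (auto simp: in_keys_iff)

definition of_int_chain :: "('a \<Rightarrow>\<^sub>0 int) \<Rightarrow> ('a \<Rightarrow>\<^sub>0 'k::field)" where
  "of_int_chain c = Poly_Mapping.map of_int c"

lemma lookup_of_int_chain [simp]: "Poly_Mapping.lookup (of_int_chain c) x = of_int (Poly_Mapping.lookup c x)"
  unfolding of_int_chain_def by (simp add: Poly_Mapping.map.rep_eq when_def)

lemma of_int_chain_0 [simp]: "of_int_chain 0 = 0"
  and of_int_chain_add: "of_int_chain (c + d) = of_int_chain c + of_int_chain d"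
  and of_int_chain_diff: "of_int_chain (c - d) = of_int_chain c - of_int_chain d"
  and of_int_chain_frag_of [simp]: "of_int_chain (frag_of x) = Poly_Mapping.single x 1"
  by (auto intro!: poly_mapping_eqI simp: lookup_add lookup_minus lookup_single when_def)

lemma of_int_chain_cmul: "of_int_chain (frag_cmul a c) = fchain_scale (of_int a) (of_int_chain c)"
  by (auto intro!: poly_mapping_eqI)

lemma of_int_chain_sum: "of_int_chain (sum g I) = (\<Sum>i\<in>I. of_int_chain (g i))"
  by (induction I rule: infinite_finite_induct) (auto simp: of_int_chain_add)

lemma keys_of_int_chain: "Poly_Mapping.keys (of_int_chain c) \<subseteq> Poly_Mapping.keys c"
  by (auto simp: in_keys_iff)

text \<open>
  Transports additive maps of integral chains to the field; this makes the chain maps and chain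
  homotopies of \<open>HOL-Homology\<close> available.
\<close>

definition flift :: "(('a \<Rightarrow>\<^sub>0 int) \<Rightarrow> ('b \<Rightarrow>\<^sub>0 int)) \<Rightarrow> ('a \<Rightarrow>\<^sub>0 'k::field) \<Rightarrow> ('b \<Rightarrow>\<^sub>0 'k)" where
  "flift h = fextend (\<lambda>\<sigma>. of_int_chain (h (frag_of \<sigma>)))"

lemmas flift_linear = fextend_add[of "\<lambda>\<sigma>. of_int_chain (h (frag_of \<sigma>))" for h, folded flift_def]
  fextend_scale[of "\<lambda>\<sigma>. of_int_chain (h (frag_of \<sigma>))" for h, folded flift_def]
  fextend_diff[of "\<lambda>\<sigma>. of_int_chain (h (frag_of \<sigma>))" for h, folded flift_def]
  fextend_sum[of "\<lambda>\<sigma>. of_int_chain (h (frag_of \<sigma>))" for h, folded flift_def]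

lemma flift_0 [simp]: "flift h 0 = 0"
  by (simp add: flift_def)

text \<open>\<open>flift h\<close> only sees \<open>h\<close> on generators, so additivity is what
  recovers \<open>h\<close> on all integral chains. It is stated with differences because integral
  chains are generated from simplices by subtraction.\<close>

lemma flift_of_int_chain:
  assumes h: "\<And>a b. h (a - b) = h a - h b"
  shows "flift h (of_int_chain c) = of_int_chain (h c)"
proof -
  have h0: "h 0 = 0" using h[of 0 0] by simp
  have "Poly_Mapping.keys c \<subseteq> UNIV" by simp
  then show ?thesis
    by (induction c rule: frag_induction)
       (auto simp: h0 h flift_def of_int_chain_diff fextend_diff)
qed

text \<open>The inner map is evaluated on simplices, the outer one on the resulting integral chains;
  hence additivity of the outer map.\<close>

lemma flift_comp:
  assumes "\<And>a b. h (a - b) = h a - h b"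
  shows "flift h (flift g c) = flift (\<lambda>x. h (g x)) c"
  unfolding flift_def[of g] fextend_def[of _ c] flift_linear(4)
  by (simp add: flift_linear(2) flift_of_int_chain[OF assms] flift_def[of "\<lambda>x. h (g x)"] fextend_def)

text \<open>Identities of integral chains often hold only for chains of a given space; checking them
  on the simplices that occur in \<open>c\<close> carries them over.\<close>

lemma flift_cong:
  assumes "\<And>\<sigma>. \<sigma> \<in> Poly_Mapping.keys c \<Longrightarrow> h (frag_of \<sigma>) = g (frag_of \<sigma>)"
  shows "flift h c = flift g c"
  unfolding flift_def fextend_def using assms by (intro sum.cong) auto

lemma flift_plus: "flift (\<lambda>x. h x + g x) c = flift h c + flift g c"
  unfolding flift_def fextend_def
  by (simp add: of_int_chain_add fchain.scale_right_distrib sum.distrib)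

lemma flift_minus: "flift (\<lambda>x. h x - g x) c = flift h c - flift g c"
  unfolding flift_def fextend_def
  by (simp add: of_int_chain_diff fchain.scale_right_diff_distrib sum_subtractf)

lemma flift_id: "flift (\<lambda>x. x) c = c"
proof (rule poly_mapping_eqI)
  fix x
  have "Poly_Mapping.lookup (flift (\<lambda>x. x) c) x = (\<Sum>\<sigma>\<in>Poly_Mapping.keys c. if \<sigma> = x then Poly_Mapping.lookup c \<sigma> else 0)"
    unfolding flift_def fextend_def lookup_sum
    by (rule sum.cong) (auto simp: lookup_single)
  also have "\<dots> = Poly_Mapping.lookup c x" by (auto simp: in_keys_iff)
  finally show "Poly_Mapping.lookup (flift (\<lambda>x. x) c) x = Poly_Mapping.lookup c x" .
qed

lemma keys_flift:
  fixes c :: "'a \<Rightarrow>\<^sub>0 'k::field"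
  shows "Poly_Mapping.keys (flift h c) \<subseteq> (\<Union>\<sigma>\<in>Poly_Mapping.keys c. Poly_Mapping.keys (h (frag_of \<sigma>)))"
proof -
  have "Poly_Mapping.keys (flift h c) \<subseteq>
      (\<Union>\<sigma>\<in>Poly_Mapping.keys c. Poly_Mapping.keys (of_int_chain (h (frag_of \<sigma>)) :: _ \<Rightarrow>\<^sub>0 'k))"
    unfolding flift_def by (rule keys_fextend)
  also have "\<dots> \<subseteq> (\<Union>\<sigma>\<in>Poly_Mapping.keys c. Poly_Mapping.keys (h (frag_of \<sigma>)))"
    by (intro UN_mono keys_of_int_chain order_refl)
  finally show ?thesis .
qed

lemma flift_in_fchains:
  assumes "\<And>\<sigma>. \<sigma> \<in> Poly_Mapping.keys c \<Longrightarrow> singular_chain q Y (h (frag_of \<sigma>))"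
  shows "flift h c \<in> fchains q Y"
proof -
  have "(\<Union>\<sigma>\<in>Poly_Mapping.keys c. Poly_Mapping.keys (h (frag_of \<sigma>))) \<subseteq> singular_simplex_set q Y"
    using assms unfolding singular_chain_def by (rule UN_least)
  then show ?thesis unfolding fchains_def using keys_flift[of h c] by blast
qed

text \<open>Both sides are linear and agree on simplices, the signs being images of integers.
  Through this identity the boundary over the field inherits its properties from the integral
  one.\<close>

lemma fchain_boundary_eq_flift: "fchain_boundary p c = flift (chain_boundary p) c"
proof (cases "p = 0")
  case False
  have "Poly_Mapping.single \<tau> (a * b) = fchain_scale b (Poly_Mapping.single \<tau> a)" for \<tau> and a b :: 'b
    by (auto intro!: poly_mapping_eqI simp: lookup_single when_def)
  then have "(\<Sum>k\<le>p. Poly_Mapping.single (singular_face p k \<sigma>) ((-1) ^ k * Poly_Mapping.lookup c \<sigma>))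
        = fchain_scale (Poly_Mapping.lookup c \<sigma>) (of_int_chain (chain_boundary p (frag_of \<sigma>)))" for \<sigma>
    using False
    by (auto intro!: poly_mapping_eqI sum.cong
        simp: chain_boundary_of of_int_chain_sum of_int_chain_cmul fchain.scale_sum_right lookup_sum lookup_single when_def)
  then show ?thesis using False
    by (simp add: fchain_boundary_def flift_def fextend_def)
qed (simp add: fchain_boundary_def flift_def fextend_def chain_boundary_def)

lemmas fchain_boundary_linear = flift_linear[of "chain_boundary p" for p, folded fchain_boundary_eq_flift]

lemma fchain_boundary_0 [simp]: "fchain_boundary p 0 = 0"
  by (simp add: fchain_boundary_eq_flift)

lemma fchain_boundary_uminus: "fchain_boundary p (- c) = - fchain_boundary p c"
  using fchain_boundary_linear(3)[of p 0 c] by simp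

lemma fchain_boundary_at_0 [simp]: "fchain_boundary 0 c = 0"
  by (simp add: fchain_boundary_def)

lemma fchain_boundary_flift_comp:
  "fchain_boundary q (flift h c) = flift (\<lambda>x. chain_boundary q (h x)) c"
  unfolding fchain_boundary_eq_flift by (rule flift_comp) (rule chain_boundary_diff)

lemma singular_chain_of_key:
  "c \<in> fchains p X \<Longrightarrow> \<sigma> \<in> Poly_Mapping.keys c \<Longrightarrow> singular_chain p X (frag_of \<sigma>)"
  by (auto simp: fchains_def singular_chain_of)

lemma fchain_boundary_boundary:
  assumes "c \<in> fchains (Suc p) X"
  shows "fchain_boundary p (fchain_boundary (Suc p) c) = 0"
proof -
  have "fchain_boundary p (fchain_boundary (Suc p) c) = flift (\<lambda>x. chain_boundary p (chain_boundary (Suc p) x)) c"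
    by (simp only: fchain_boundary_eq_flift[of "Suc p"] fchain_boundary_flift_comp)
  also have "\<dots> = flift (\<lambda>x. 0) c"
    by (rule flift_cong) (use chain_boundary_boundary_alt singular_chain_of_key[OF assms] in blast)
  also have "\<dots> = 0" by (simp add: flift_def fextend_def)
  finally show ?thesis .
qed

lemma fchain_boundary_in_fchains:
  assumes "c \<in> fchains (Suc p) X"
  shows "fchain_boundary (Suc p) c \<in> fchains p X"
  unfolding fchain_boundary_eq_flift
  by (rule flift_in_fchains) (use singular_chain_boundary_alt singular_chain_of_key[OF assms] in blast)

lemma keys_fchain_scale: "Poly_Mapping.keys (fchain_scale a c) \<subseteq> Poly_Mapping.keys c"
  by (auto simp: in_keys_iff)

section \<open>Chains, cycles and boundaries as subspaces\<close>

lemma subspace_fchains: "fchain.subspace (fchains p X :: ('a, 'k::field) field_chain set)"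
proof (rule fchain.subspaceI)
  show "x + y \<in> fchains p X" if "x \<in> fchains p X" "y \<in> fchains p X"
    for x y :: "('a, 'k) field_chain"
    using that keys_add[of x y] unfolding fchains_def by blast
  show "fchain_scale a x \<in> fchains p X" if "x \<in> fchains p X"
    for a and x :: "('a, 'k) field_chain"
    using that keys_fchain_scale[of a x] unfolding fchains_def by blast
qed (simp add: fchains_def)

lemma subspace_fcycles: "fchain.subspace (fcycles p X :: ('a, 'k::field) field_chain set)"
proof (rule fchain.subspaceI)
  have sub: "fchain.subspace (fchains p X :: ('a, 'k) field_chain set)" by (rule subspace_fchains)
  show "(0 :: ('a, 'k) field_chain) \<in> fcycles p X"
    using fchain.subspace_0[OF sub] by (simp add: fcycles_def)
  show "x + y \<in> fcycles p X" if "x \<in> fcycles p X" "y \<in> fcycles p X"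
    for x y :: "('a, 'k) field_chain"
    using that fchain.subspace_add[OF sub] by (simp add: fcycles_def fchain_boundary_linear)
  show "fchain_scale a x \<in> fcycles p X" if "x \<in> fcycles p X"
    for a and x :: "('a, 'k) field_chain"
    using that fchain.subspace_scale[OF sub] by (simp add: fcycles_def fchain_boundary_linear)
qed

lemma subspace_fboundaries: "fchain.subspace (fboundaries p X :: ('a, 'k::field) field_chain set)"
proof (rule fchain.subspaceI)
  have sub: "fchain.subspace (fchains (Suc p) X :: ('a, 'k) field_chain set)" by (rule subspace_fchains)
  show "(0 :: ('a, 'k) field_chain) \<in> fboundaries p X"
    unfolding fboundaries_def by (rule image_eqI[OF _ fchain.subspace_0[OF sub]]) simp
  show "x + y \<in> fboundaries p X" if xy: "x \<in> fboundaries p X" "y \<in> fboundaries p X"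
    for x y :: "('a, 'k) field_chain"
  proof -
    obtain x' y' where "x' \<in> fchains (Suc p) X" "y' \<in> fchains (Suc p) X"
      "x = fchain_boundary (Suc p) x'" "y = fchain_boundary (Suc p) y'"
      using xy by (auto simp: fboundaries_def)
    then show ?thesis unfolding fboundaries_def
      by (intro image_eqI[OF _ fchain.subspace_add[OF sub]]) (simp add: fchain_boundary_linear)
  qed
  show "fchain_scale a x \<in> fboundaries p X" if x: "x \<in> fboundaries p X"
    for a and x :: "('a, 'k) field_chain"
  proof -
    obtain x' where "x' \<in> fchains (Suc p) X" "x = fchain_boundary (Suc p) x'"
      using x by (auto simp: fboundaries_def)
    then show ?thesis unfolding fboundaries_def
      by (intro image_eqI[OF _ fchain.subspace_scale[OF sub]]) (simp add: fchain_boundary_linear)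
  qed
qed

lemma fboundaries_subset_fcycles: "fboundaries p X \<subseteq> fcycles p X"
  unfolding fboundaries_def fcycles_def
  using fchain_boundary_in_fchains fchain_boundary_boundary by blast

lemma fchains_mono: "S \<subseteq> S' \<Longrightarrow> fchains p (subtopology X S) \<subseteq> fchains p (subtopology X S')"
  unfolding fchains_def using singular_simplex_mono by blast

lemma fcycles_mono: "S \<subseteq> S' \<Longrightarrow> fcycles p (subtopology X S) \<subseteq> fcycles p (subtopology X S')"
  unfolding fcycles_def using fchains_mono by blast

lemma fboundaries_mono: "S \<subseteq> S' \<Longrightarrow> fboundaries p (subtopology X S) \<subseteq> fboundaries p (subtopology X S')"
  unfolding fboundaries_def using fchains_mono by blast

text \<open>Evaluated on a cycle, the homotopy identity leaves only a boundary, since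
  \<open>k'\<close> is applied to the vanishing boundary of \<open>z\<close>. The components of the
  homotopy in degrees \<open>p\<close> and \<open>p - 1\<close> are separate arguments;
  \<open>k'\<close> is additive because it is composed with the boundary.\<close>

lemma flift_homologous:
  assumes z: "z \<in> fcycles p X"
    and add: "\<And>a b. k' (a - b) = k' a - k' b"
    and k: "\<And>c. singular_chain p X c \<Longrightarrow> singular_chain (Suc p) X (k c)"
    and eq: "\<And>c. singular_chain p X c \<Longrightarrow>
      chain_boundary (Suc p) (k c) + k' (chain_boundary p c) = h c - c"
  shows "flift h z - z \<in> fboundaries p X"
proof -
  have zX: "z \<in> fchains p X" and z0: "fchain_boundary p z = 0" using z by (auto simp: fcycles_def)
  have "flift h z - z = flift (\<lambda>c. h c - c) z" by (simp add: flift_minus flift_id)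
  also have "\<dots> = flift (\<lambda>c. chain_boundary (Suc p) (k c) + k' (chain_boundary p c)) z"
    by (rule flift_cong) (simp add: eq singular_chain_of_key[OF zX])
  also have "\<dots> = fchain_boundary (Suc p) (flift k z) + flift k' (fchain_boundary p z)"
    unfolding flift_plus fchain_boundary_flift_comp fchain_boundary_eq_flift[of p]
    by (simp add: flift_comp[OF add])
  finally have "flift h z - z = fchain_boundary (Suc p) (flift k z)" using z0 by simp
  moreover have "flift k z \<in> fchains (Suc p) X"
    by (rule flift_in_fchains) (use k singular_chain_of_key[OF zX] in blast)
  ultimately show ?thesis by (auto simp: fboundaries_def)
qed

section \<open>Finiteness of homology\<close>

text \<open>
  The method of acyclic models: as integral cycles of positive degree bound, a chain homotopy from
  the identity to the constant map can be chosen degree by degree.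
\<close>

lemma contractible_space_chain_homotopy:
  fixes X :: "'a topology"
  assumes hom: "homotopic_with (\<lambda>x. True) X X id (\<lambda>x. a)" and a: "a \<in> topspace X"
  shows "\<exists>k k'. (\<forall>c d. k (c - d) = k c - k d) \<and> (\<forall>c d. k' (c - d) = k' c - k' d) \<and>
     (\<forall>c. singular_chain p X c \<longrightarrow> singular_chain (Suc p) X (k c) \<and>
        chain_boundary (Suc p) (k c) + k' (chain_boundary p c) = chain_map p (\<lambda>x. a) c - c)"
proof (induction p)
  have cont: "continuous_map X X (\<lambda>x. a)" using a by simp
  \<comment> \<open>Homotopy invariance relative to the empty set: a cycle is homologous to its
    image under the constant map.\<close>
  have homologous: "singular_relboundary q X {} (chain_map q (\<lambda>x. a) c - c)"
    if "singular_relcycle q X {} c" for q c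
  proof -
    have "homotopic_with (\<lambda>h. h \<in> {} \<rightarrow> {}) X X (\<lambda>x. a) id"
      using hom by (simp add: homotopic_with_sym)
    then have "homologous_rel q X {} (chain_map q (\<lambda>x. a) c) (chain_map q id c)"
      using that by (rule homotopic_imp_homologous_rel_chain_maps)
    then show ?thesis
      using that using chain_map_id_gen[of q X c id] by (simp add: homologous_rel_def singular_cycle)
  qed
  \<comment> \<open>The inductive step: a bounding chain \<open>w\<close> is chosen for the
    obstruction of each simplex and extended additively.\<close>
  have extend: "\<exists>k. (\<forall>c d. k (c - d) = k c - k d) \<and>
     (\<forall>c. singular_chain q X c \<longrightarrow> singular_chain (Suc q) X (k c) \<and>
        chain_boundary (Suc q) (k c) + k' (chain_boundary q c) = chain_map q (\<lambda>x. a) c - c)"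
    if add: "\<And>c d. k' (c - d) = k' c - k' d"
      and bd: "\<And>\<sigma>. singular_simplex q X \<sigma> \<Longrightarrow> singular_relboundary q X {}
          (chain_map q (\<lambda>x. a) (frag_of \<sigma>) - frag_of \<sigma> - k' (chain_boundary q (frag_of \<sigma>)))"
    for q and k' :: "'a chain \<Rightarrow> 'a chain"
  proof -
    obtain w where w: "\<And>\<sigma>. singular_simplex q X \<sigma> \<Longrightarrow> singular_chain (Suc q) X (w \<sigma>)"
      "\<And>\<sigma>. singular_simplex q X \<sigma> \<Longrightarrow> chain_boundary (Suc q) (w \<sigma>)
          = chain_map q (\<lambda>x. a) (frag_of \<sigma>) - frag_of \<sigma> - k' (chain_boundary q (frag_of \<sigma>))"
      using bd unfolding singular_boundary by metis
    have k'0: "k' 0 = 0" using add[of 0 0] by simp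
    have "singular_chain (Suc q) X (frag_extend w c) \<and>
        chain_boundary (Suc q) (frag_extend w c) + k' (chain_boundary q c) = chain_map q (\<lambda>x. a) c - c"
      if "singular_chain q X c" for c
      using that[unfolded singular_chain_def]
    proof (induction c rule: frag_induction)
      case zero
      show ?case by (simp add: k'0)
    next
      case (one \<sigma>)
      then show ?case using w[of \<sigma>] by simp
    next
      case (diff c d)
      have "chain_boundary (Suc q) (frag_extend w (c - d)) + k' (chain_boundary q (c - d))
          = (chain_boundary (Suc q) (frag_extend w c) + k' (chain_boundary q c))
          - (chain_boundary (Suc q) (frag_extend w d) + k' (chain_boundary q d))"
        by (simp add: frag_extend_diff chain_boundary_diff add)
      then show ?case
        using diff by (simp add: frag_extend_diff chain_map_diff singular_chain_diff)
    qed
    then show ?thesis using frag_extend_diff by blast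
  qed
  {
    case 0
    \<comment> \<open>In degree 0 every simplex is a cycle, so the obstruction bounds already with
      \<open>k' = 0\<close>.\<close>
    have "singular_relboundary 0 X {} (chain_map 0 (\<lambda>x. a) (frag_of \<sigma>) - frag_of \<sigma> - 0)"
      if "singular_simplex 0 X \<sigma>" for \<sigma>
      using homologous[of 0 "frag_of \<sigma>"] that
      by (simp add: singular_cycle singular_chain_of chain_boundary_def)
    then obtain k where k: "\<forall>c d. k (c - d) = k c - k d"
      "\<forall>c. singular_chain 0 X c \<longrightarrow> singular_chain (Suc 0) X (k c) \<and>
        chain_boundary (Suc 0) (k c) + 0 = chain_map 0 (\<lambda>x. a) c - c"
      using extend[of "\<lambda>_. 0" 0] by auto
    show ?case by (rule exI[of _ k], rule exI[of _ "\<lambda>_. 0"]) (use k in simp)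
  next
    case (Suc p)
    then obtain k k' where k: "\<And>c d. k (c - d) = k c - k d"
      and k': "\<And>c d. k' (c - d) = k' c - k' d"
      and kX: "\<And>c. singular_chain p X c \<Longrightarrow> singular_chain (Suc p) X (k c)"
      and eq: "\<And>c. singular_chain p X c \<Longrightarrow>
        chain_boundary (Suc p) (k c) + k' (chain_boundary p c) = chain_map p (\<lambda>x. a) c - c"
      by blast
    have k'0: "k' 0 = 0" using k'[of 0 0] by simp
    have "singular_relboundary (Suc p) X {}
            (chain_map (Suc p) (\<lambda>x. a) (frag_of \<sigma>) - frag_of \<sigma> - k (chain_boundary (Suc p) (frag_of \<sigma>)))"
      (is "singular_relboundary _ _ _ ?u")
      if "singular_simplex (Suc p) X \<sigma>" for \<sigma>
    proof -
      have \<sigma>: "singular_chain (Suc p) X (frag_of \<sigma>)" using that by (simp add: singular_chain_of)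
      then have d\<sigma>: "singular_chain p X (chain_boundary (Suc p) (frag_of \<sigma>))"
        by (rule singular_chain_boundary_alt)
      have dd: "chain_boundary p (chain_boundary (Suc p) (frag_of \<sigma>)) = 0"
        using \<sigma> by (rule chain_boundary_boundary_alt)
      have "chain_boundary (Suc p) (k (chain_boundary (Suc p) (frag_of \<sigma>)))
          = chain_map p (\<lambda>x. a) (chain_boundary (Suc p) (frag_of \<sigma>)) - chain_boundary (Suc p) (frag_of \<sigma>)"
        using eq[OF d\<sigma>] by (simp add: dd k'0)
      then have "chain_boundary (Suc p) ?u = 0"
        using chain_boundary_chain_map[OF \<sigma>, of "\<lambda>x. a"] by (simp add: chain_boundary_diff)
      moreover have "singular_chain (Suc p) X ?u"
        using \<sigma> d\<sigma> by (intro singular_chain_diff singular_chain_chain_map[OF _ cont] kX)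
      ultimately have u: "singular_relcycle (Suc p) X {} ?u" by (simp add: singular_cycle)
      have ta: "topspace (subtopology X {a}) = {a}" using a by auto
      \<comment> \<open>The obstruction \<open>?u\<close> is homologous to its constant image, which
        lives in a one-point space and has positive degree.\<close>
      have "singular_relcycle (Suc p) (subtopology X {a}) {} (chain_map (Suc p) (\<lambda>x. a) ?u)"
        by (rule singular_relcycle_chain_map[OF u]) (use a in auto)
      then have "singular_relboundary (Suc p) (subtopology X {a}) {} (chain_map (Suc p) (\<lambda>x. a) ?u)"
        using singular_boundary_eq_cycle_singleton[OF ta, of "Suc p"] by simp
      then have "singular_relboundary (Suc p) X {} (chain_map (Suc p) (\<lambda>x. a) ?u)"
        using singular_boundary_mono[of "{a}" "topspace X"] a by (metis empty_subsetI insert_subset subtopology_topspace)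
      from singular_relboundary_diff[OF this homologous[OF u]] show ?thesis by simp
    qed
    with extend[OF k, of "Suc p"] obtain K where K: "\<forall>c d. K (c - d) = K c - K d"
      "\<forall>c. singular_chain (Suc p) X c \<longrightarrow> singular_chain (Suc (Suc p)) X (K c) \<and>
        chain_boundary (Suc (Suc p)) (K c) + k (chain_boundary (Suc p) c) = chain_map (Suc p) (\<lambda>x. a) c - c"
      by auto
    show ?case by (rule exI[of _ K], rule exI[of _ k]) (use k K in simp)
  }
qed

text \<open>The constant map sends all simplices to one constant simplex, so up to a boundary every
  cycle is a multiple of \<open>?s\<close>. That chain may fail to be a cycle itself, which
  \<open>fin_mod\<close> permits for a spanning set.\<close>

lemma fin_mod_fcycles_contractible:
  fixes X :: "'a topology"
  assumes "contractible_space X"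
  shows "fchain.fin_mod (fcycles p X :: ('a, 'k::field) field_chain set) (fboundaries p X)"
proof (cases "topspace X = {}")
  case True
  then have "singular_simplex_set p X = {}" using singular_simplex_empty by blast
  then have "fcycles p X \<subseteq> {0 :: ('a, 'k::field) field_chain}"
    unfolding fcycles_def fchains_def by (simp only: subset_empty keys_eq_empty) auto
  then show ?thesis
    unfolding fchain.fin_mod_def using fchain.span_zero by blast
next
  case False
  obtain a where hom: "homotopic_with (\<lambda>x. True) X X id (\<lambda>x. a)"
    using assms by (auto simp: contractible_space_def)
  then have "continuous_map X X (\<lambda>x. a)" using homotopic_with_imp_continuous_maps by blast
  then have a: "a \<in> topspace X" using False by (auto simp: continuous_map_def)
  obtain k k' where kk: "(\<forall>c d. k (c - d) = k c - k d) \<and> (\<forall>c d. k' (c - d) = k' c - k' d) \<and>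
     (\<forall>c. singular_chain p X c \<longrightarrow> singular_chain (Suc p) X (k c) \<and>
        chain_boundary (Suc p) (k c) + k' (chain_boundary p c) = chain_map p (\<lambda>x. a) c - c)"
    using contractible_space_chain_homotopy[OF hom a, of p] by (elim exE) (rule that)
  have k: "\<And>c d. k' (c - d) = k' c - k' d"
    "\<And>c. singular_chain p X c \<Longrightarrow> singular_chain (Suc p) X (k c)"
    "\<And>c. singular_chain p X c \<Longrightarrow>
       chain_boundary (Suc p) (k c) + k' (chain_boundary p c) = chain_map p (\<lambda>x. a) c - c"
    using kk by simp_all
  let ?s = "Poly_Mapping.single (restrict (\<lambda>x. a) (standard_simplex p)) 1 :: ('a, 'k) field_chain"
  have "z \<in> fchain.span ({?s} \<union> fboundaries p X)" if z: "z \<in> fcycles p X" for z :: "('a, 'k) field_chain"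
  proof -
    have "simplex_map p (\<lambda>x. a) \<sigma> = restrict (\<lambda>x. a) (standard_simplex p)" for \<sigma> :: "(nat \<Rightarrow> real) \<Rightarrow> 'a"
      by (auto simp: simplex_map_def)
    then have "flift (chain_map p (\<lambda>x. a)) z = (\<Sum>\<sigma>\<in>Poly_Mapping.keys z. fchain_scale (Poly_Mapping.lookup z \<sigma>) ?s)"
      by (simp add: flift_def fextend_def)
    then have "flift (chain_map p (\<lambda>x. a)) z \<in> fchain.span ({?s} \<union> fboundaries p X)"
      by (simp only:) (intro fchain.span_sum fchain.span_scale fchain.span_base UnI1 singletonI)
    moreover have "flift (chain_map p (\<lambda>x. a)) z - z \<in> fchain.span ({?s} \<union> fboundaries p X)"
      by (intro fchain.span_base UnI2 flift_homologous[OF z k])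
    ultimately show ?thesis using fchain.span_diff by fastforce
  qed
  then show ?thesis unfolding fchain.fin_mod_def by (intro exI[of _ "{?s}"]) auto
qed

text \<open>Iterated barycentric subdivision is chain homotopic to the identity and makes the
  simplices so small that each lies in \<open>U\<close> or in \<open>V\<close>. A cycle has finitely
  many simplices, so one number of iterations serves them all.\<close>

lemma fcycle_small_decomposition:
  fixes z :: "('a, 'k::field) field_chain"
  assumes U: "openin X U" and V: "openin X V" and z: "z \<in> fcycles p (subtopology X (U \<union> V))"
  obtains u v where "u \<in> fchains p (subtopology X U)" "v \<in> fchains p (subtopology X V)"
    "(u + v) - z \<in> fboundaries p (subtopology X (U \<union> V))"
proof -
  let ?Y = "subtopology X (U \<union> V)"
  have zY: "z \<in> fchains p ?Y" using z by (simp add: fcycles_def)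
  have "\<exists>n. \<forall>m f. n \<le> m \<longrightarrow> f \<in> Poly_Mapping.keys ((singular_subdivision p ^^ m) (frag_of \<sigma>)) \<longrightarrow>
            (\<exists>W\<in>{U, V}. f \<in> standard_simplex p \<rightarrow> W)"
    if "\<sigma> \<in> Poly_Mapping.keys z" for \<sigma>
  proof -
    have op: "\<And>W. W \<in> {U, V} \<Longrightarrow> openin ?Y W"
      using U V by (auto simp: openin_subtopology)
    have "topspace ?Y \<subseteq> \<Union>{U, V}" by auto
    from sufficient_iterated_singular_subdivision_exists[OF op this singular_chain_of_key[OF zY that]]
    show ?thesis by metis
  qed
  then obtain N where N: "\<And>\<sigma> m f. \<sigma> \<in> Poly_Mapping.keys z \<Longrightarrow> N \<sigma> \<le> m \<Longrightarrow>
      f \<in> Poly_Mapping.keys ((singular_subdivision p ^^ m) (frag_of \<sigma>)) \<Longrightarrow>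
      (\<exists>W\<in>{U, V}. f \<in> standard_simplex p \<rightarrow> W)" by metis
  \<comment> \<open>The sum dominates every \<open>N \<sigma>\<close>, and it is defined for the
    zero cycle too.\<close>
  define n where "n = (\<Sum>\<sigma>\<in>Poly_Mapping.keys z. N \<sigma>)"
  let ?S = "singular_subdivision p ^^ n"
  define w where "w = flift ?S z"
  have S: "singular_chain p Y (?S c)" if "singular_chain p Y c" for Y :: "'a topology" and c
    using that by (induction n) (auto simp: singular_chain_singular_subdivision)
  obtain h where h: "\<And>p c1 c2. h p (c1 - c2) = h p c1 - h p (c2 :: 'a chain)"
     "\<And>p X c. singular_chain p X c \<Longrightarrow> singular_chain (Suc p) X (h p c)"
     "\<And>p X c. singular_chain p X c
       \<Longrightarrow> chain_boundary (Suc p) (h p c) + h (p - Suc 0) (chain_boundary p c)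
                   = (singular_subdivision p ^^ n) c - c"
    by (rule chain_homotopic_iterated_singular_subdivision[of n]) blast
  have w: "w - z \<in> fboundaries p ?Y"
    unfolding w_def by (rule flift_homologous[OF z h(1) h(2) h(3)])
  have keys: "singular_simplex p (subtopology X U) f \<or> singular_simplex p (subtopology X V) f"
    if f: "f \<in> Poly_Mapping.keys w" for f
  proof -
    obtain \<sigma> where \<sigma>: "\<sigma> \<in> Poly_Mapping.keys z" "f \<in> Poly_Mapping.keys (?S (frag_of \<sigma>))"
      using f keys_flift[of ?S z] unfolding w_def by blast
    have "N \<sigma> \<le> n" unfolding n_def by (rule member_le_sum) (use \<sigma> in auto)
    from N[OF \<sigma>(1) this \<sigma>(2)]
    obtain W where W: "W \<in> {U, V}" "f \<in> standard_simplex p \<rightarrow> W" by (elim bexE)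
    have "singular_simplex p ?Y f"
      using S[OF singular_chain_of_key[OF zY \<sigma>(1)]] \<sigma>(2) by (auto simp: singular_chain_def)
    then show ?thesis using W
      by (auto simp: singular_simplex_subtopology image_subset_iff)
  qed
  \<comment> \<open>Simplices inside both sets go to \<open>u\<close>; a simplex of
    \<open>w - u\<close> therefore fails to lie in \<open>U\<close> and must lie in
    \<open>V\<close>.\<close>
  define u where "u = (\<Sum>f\<in>{f\<in>Poly_Mapping.keys w. singular_simplex p (subtopology X U) f}.
      Poly_Mapping.single f (Poly_Mapping.lookup w f))"
  have lu: "Poly_Mapping.lookup u f = (if singular_simplex p (subtopology X U) f then Poly_Mapping.lookup w f else 0)" for f
    unfolding u_def lookup_sum by (auto simp: lookup_single when_def in_keys_iff)
  show thesis
  proof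
    show "u \<in> fchains p (subtopology X U)"
      by (auto simp: fchains_def in_keys_iff lu split: if_splits)
    show "w - u \<in> fchains p (subtopology X V)"
      unfolding fchains_def
    proof (intro CollectI subsetI)
      fix f assume "f \<in> Poly_Mapping.keys (w - u)"
      then have "f \<in> Poly_Mapping.keys w" "\<not> singular_simplex p (subtopology X U) f"
        by (auto simp: in_keys_iff lu lookup_minus split: if_splits)
      then show "singular_simplex p (subtopology X V) f" using keys by blast
    qed
    show "u + (w - u) - z \<in> fboundaries p ?Y" using w by simp
  qed
qed


text \<open>
  The Mayer-Vietoris argument: up to a boundary, a cycle of \<open>U \<union> V\<close> is a sum \<open>u + v\<close> of chains of \<open>U\<close> and
  \<open>V\<close>, and the cycle \<open>\<partial>u = - \<partial>v\<close> of \<open>U \<inter> V\<close> determines it modulo cycles of \<open>U\<close> and \<open>V\<close>.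
\<close>

lemma fin_mod_fcycles_Un:
  fixes X :: "'a topology"
  assumes U: "openin X U" and V: "openin X V"
    and finU: "fchain.fin_mod (fcycles p (subtopology X U) :: ('a, 'k::field) field_chain set)
        (fboundaries p (subtopology X U))"
    and finV: "fchain.fin_mod (fcycles p (subtopology X V) :: ('a, 'k) field_chain set)
        (fboundaries p (subtopology X V))"
    and finUV: "\<And>q. fchain.fin_mod (fcycles q (subtopology X (U \<inter> V)) :: ('a, 'k) field_chain set)
        (fboundaries q (subtopology X (U \<inter> V)))"
  shows "fchain.fin_mod (fcycles p (subtopology X (U \<union> V)) :: ('a, 'k) field_chain set)
     (fboundaries p (subtopology X (U \<union> V)))"
proof -
  let ?U = "subtopology X U" and ?V = "subtopology X V"
    and ?I = "subtopology X (U \<inter> V)" and ?W = "subtopology X (U \<union> V)"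
  define D :: "('a, 'k) field_chain set" where
    "D = {fchain_boundary p u |u. u \<in> fchains p ?U \<and> (\<exists>v\<in>fchains p ?V. fchain_boundary p (u + v) = 0)}"
  \<comment> \<open>There is no degree -1: chains of degree 0 have boundary 0, so \<open>D\<close>
    is trivial there and \<open>{0}\<close> stands in for the boundaries.\<close>
  let ?B = "if p = 0 then {0} else fboundaries (p - 1) ?I :: ('a, 'k) field_chain set"
  have finD: "fchain.fin_mod D ?B"
  proof (cases p)
    case 0
    then have "D \<subseteq> fchain.span ({} \<union> ?B)" by (auto simp: D_def)
    then show ?thesis unfolding fchain.fin_mod_def by blast
  next
    case (Suc q)
    have "D \<subseteq> fcycles q ?I"
    proof
      fix d assume "d \<in> D"
      then obtain u v where u: "u \<in> fchains p ?U" and v: "v \<in> fchains p ?V"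
        and uv: "fchain_boundary p (u + v) = 0" and d: "d = fchain_boundary p u"
        by (auto simp: D_def)
      \<comment> \<open>The same chain is a boundary from \<open>U\<close> and, with the sign
        changed, from \<open>V\<close>, so its simplices lie in both sets.\<close>
      have d': "d = fchain_boundary p (- v)"
        using uv by (simp add: d fchain_boundary_linear(1) fchain_boundary_uminus eq_neg_iff_add_eq_0)
      have v': "- v \<in> fchains p ?V" using v fchain.subspace_neg[OF subspace_fchains] by blast
      have "Poly_Mapping.keys d \<subseteq> singular_simplex_set q ?U" "Poly_Mapping.keys d \<subseteq> singular_simplex_set q ?V"
        using fchain_boundary_in_fchains[of u q ?U] fchain_boundary_in_fchains[of "- v" q ?V] u v'
        unfolding Suc d[symmetric, unfolded Suc] d'[symmetric, unfolded Suc] by (auto simp: fchains_def)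
      then have "d \<in> fchains q ?I"
        by (fastforce simp: fchains_def singular_simplex_subtopology)
      moreover have "fchain_boundary q d = 0"
        using fchain_boundary_boundary[of u q ?U] u d Suc by simp
      ultimately show "d \<in> fcycles q ?I" by (simp add: fcycles_def)
    qed
    then show ?thesis
      using fchain.fin_mod_mono[OF finUV[of q] _ order_refl] Suc by simp
  qed
  have subB: "fchain.subspace ?B" by (simp add: subspace_fboundaries)
  obtain S where S: "fchain.basis_mod D ?B S" using fchain.basis_mod_exists[OF subB finD] by blast
  then have SD: "S \<subseteq> D" and finS: "finite S" by (auto simp: fchain.basis_mod_def fchain.indep_mod_def)
  have "\<exists>u v. u \<in> fchains p ?U \<and> v \<in> fchains p ?V \<and> fchain_boundary p (u + v) = 0 \<and>
      fchain_boundary p u = s" if "s \<in> S" for s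
  proof -
    have "s \<in> D" using that SD by blast
    then show ?thesis unfolding D_def by blast
  qed
  then obtain a b where ab: "\<And>s. s \<in> S \<Longrightarrow> a s \<in> fchains p ?U" "\<And>s. s \<in> S \<Longrightarrow> b s \<in> fchains p ?V"
    "\<And>s. s \<in> S \<Longrightarrow> fchain_boundary p (a s + b s) = 0" "\<And>s. s \<in> S \<Longrightarrow> fchain_boundary p (a s) = s"
    by metis
  obtain T1 :: "('a, 'k) field_chain set" where T1: "finite T1" "fcycles p ?U \<subseteq> fchain.span (T1 \<union> fboundaries p ?U)"
    using finU by (auto simp: fchain.fin_mod_def)
  obtain T2 :: "('a, 'k) field_chain set" where T2: "finite T2" "fcycles p ?V \<subseteq> fchain.span (T2 \<union> fboundaries p ?V)"
    using finV by (auto simp: fchain.fin_mod_def)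
  \<comment> \<open>Glued cycles \<open>a s + b s\<close>, which lift a basis of \<open>D\<close>
    along the connecting map, together with generators for the two pieces.\<close>
  define T where "T = (\<lambda>s. a s + b s) ` S \<union> T1 \<union> T2"
  let ?span = "fchain.span (T \<union> fboundaries p ?W)"
  have BW: "fboundaries p ?U \<subseteq> fboundaries p ?W" "fboundaries p ?V \<subseteq> fboundaries p ?W"
    by (auto intro!: fboundaries_mono)
  have UW: "fcycles p ?U \<subseteq> ?span"
    using T1(2) by (rule order_trans) (intro fchain.span_mono, use BW T_def in blast)
  have VW: "fcycles p ?V \<subseteq> ?span"
    using T2(2) by (rule order_trans) (intro fchain.span_mono, use BW T_def in blast)
  have "z \<in> ?span" if z: "z \<in> fcycles p ?W" for z :: "('a, 'k) field_chain"
  proof -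
    obtain u v where u: "u \<in> fchains p ?U" and v: "v \<in> fchains p ?V"
      and uvz: "(u + v) - z \<in> fboundaries p ?W"
      using fcycle_small_decomposition[OF U V z] by blast
    have "fchain_boundary p ((u + v) - z) = 0"
      using uvz fboundaries_subset_fcycles by (auto simp: fcycles_def)
    then have uv: "fchain_boundary p (u + v) = 0"
      using z by (simp add: fchain_boundary_linear(3) fcycles_def)
    then have "fchain_boundary p u \<in> D" using u v by (auto simp: D_def)
    then have "fchain_boundary p u \<in> fchain.span (S \<union> ?B)"
      using S by (auto simp: fchain.basis_mod_def)
    then obtain y w :: "('a, 'k) field_chain" where y: "y \<in> fchain.span S" "w \<in> ?B" "fchain_boundary p u = y + w"
      using fchain.span_Un_subspaceE[OF _ subB] by blast
    obtain c where c: "y = (\<Sum>s\<in>S. fchain_scale (c s) s)"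
      using y(1) fchain.span_finite[OF finS] by auto
    have "\<exists>x\<in>fchains p ?I. w = fchain_boundary p x"
    proof (cases p)
      case 0
      then show ?thesis using y(2) fchain.subspace_0[OF subspace_fchains] by auto
    next
      case (Suc q)
      then show ?thesis using y(2) by (auto simp: fboundaries_def)
    qed
    then obtain x where x: "x \<in> fchains p ?I" "w = fchain_boundary p x" by blast
    have xU: "x \<in> fchains p ?U" and xV: "x \<in> fchains p ?V"
      using x(1) fchains_mono[of "U \<inter> V" U p X] fchains_mono[of "U \<inter> V" V p X] by blast+
    \<comment> \<open>\<open>A + B\<close> removes the part of the boundary of \<open>u\<close> that
      is spanned by \<open>S\<close>; the chain \<open>x\<close>, which lies in both pieces, absorbs
      the rest \<open>w\<close>. Then \<open>u - A - x\<close> and \<open>v - B + x\<close> are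
      cycles of \<open>U\<close> and of \<open>V\<close>.\<close>
    define A where "A = (\<Sum>s\<in>S. fchain_scale (c s) (a s))"
    define B where "B = (\<Sum>s\<in>S. fchain_scale (c s) (b s))"
    have AU: "A \<in> fchains p ?U" unfolding A_def using ab(1)
      by (intro fchain.subspace_sum fchain.subspace_scale subspace_fchains) auto
    have BV: "B \<in> fchains p ?V" unfolding B_def using ab(2)
      by (intro fchain.subspace_sum fchain.subspace_scale subspace_fchains) auto
    have dA: "fchain_boundary p A = y"
      unfolding A_def c by (simp add: fchain_boundary_linear(2,4) ab(4))
    have AB: "A + B = (\<Sum>s\<in>S. fchain_scale (c s) (a s + b s))"
      unfolding A_def B_def by (simp add: fchain.scale_right_distrib sum.distrib)
    have dAB: "fchain_boundary p (A + B) = 0"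
      unfolding AB by (simp add: fchain_boundary_linear(2,4) ab(3))
    have "u - A - x \<in> fcycles p ?U"
    proof -
      have "u - A - x \<in> fchains p ?U"
        by (intro fchain.subspace_diff subspace_fchains u AU xU)
      then show ?thesis using y(3) dA x(2) by (simp add: fcycles_def fchain_boundary_linear(3))
    qed
    moreover have "v - B + x \<in> fcycles p ?V"
    proof -
      have "v - B + x \<in> fchains p ?V"
        by (intro fchain.subspace_diff fchain.subspace_add subspace_fchains v BV xV)
      moreover have "fchain_boundary p v = - fchain_boundary p u" "fchain_boundary p B = - fchain_boundary p A"
        using uv dAB by (simp_all add: fchain_boundary_linear(1) eq_neg_iff_add_eq_0 add.commute)
      ultimately show ?thesis using y(3) dA x(2)
        by (simp add: fcycles_def fchain_boundary_linear(1,3))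
    qed
    ultimately have "(u - A - x) + (v - B + x) \<in> ?span"
      using UW VW by (intro fchain.span_add[of "u - A - x"]) blast+
    moreover have "A + B \<in> ?span"
      unfolding AB by (intro fchain.span_sum fchain.span_scale fchain.span_base) (auto simp: T_def)
    ultimately have "((u - A - x) + (v - B + x)) + (A + B) \<in> ?span" by (rule fchain.span_add)
    then have "u + v \<in> ?span" by (simp add: algebra_simps)
    moreover have "(u + v) - z \<in> ?span" using uvz by (intro fchain.span_base) auto
    ultimately show ?thesis using fchain.span_diff by fastforce
  qed
  moreover have "finite T" using T1 T2 finS by (simp add: T_def)
  ultimately show ?thesis unfolding fchain.fin_mod_def by blast
qed

text \<open>Convexity, unlike being a ball, survives intersection, so \<open>C\<close> meets the
  union of the other sets in a union of fewer open convex sets. The degree varies in the induction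
  because Mayer-Vietoris uses the intersection in every degree.\<close>

lemma fin_mod_fcycles_Union_convex:
  fixes \<C> :: "'e::real_normed_vector set set"
  assumes "finite \<C>" "\<And>C. C \<in> \<C> \<Longrightarrow> open C \<and> convex C"
  shows "fchain.fin_mod (fcycles p (top_of_set (\<Union>\<C>)) :: ('e, 'k::field) field_chain set)
     (fboundaries p (top_of_set (\<Union>\<C>)))"
  using assms
proof (induction "card \<C>" arbitrary: \<C> p rule: less_induct)
  case less
  show ?case
  proof (cases "\<C> = {}")
    case True
    have "contractible ({} :: 'e set)" by simp
    then show ?thesis
      using True fin_mod_fcycles_contractible[of "top_of_set ({} :: 'e set)" p] by simp
  next
    case False
    then obtain C where C: "C \<in> \<C>" by blast
    let ?D = "\<C> - {C}"
    let ?I = "(\<lambda>D. C \<inter> D) ` ?D"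
    have card: "card ?D < card \<C>" using less.prems(1) C by (rule card_Diff1_less)
    have finD: "finite ?D" using less.prems(1) by simp
    have U: "\<Union>\<C> = C \<union> \<Union>?D" and I: "\<Union>?I = C \<inter> \<Union>?D" using C by auto
    have "fchain.fin_mod (fcycles q (top_of_set (C \<inter> \<Union>?D)) :: ('e, 'k) field_chain set)
        (fboundaries q (top_of_set (C \<inter> \<Union>?D)))" for q
      unfolding I[symmetric]
    proof (rule less.hyps)
      show "card ?I < card \<C>" using card card_image_le[OF finD] by (rule le_less_trans[rotated])
      show "open E \<and> convex E" if "E \<in> ?I" for E
        using that less.prems(2)[OF C] less.prems(2) by (auto intro: convex_Int)
    qed (use finD in simp)
    moreover have "fchain.fin_mod (fcycles q (top_of_set (\<Union>?D)) :: ('e, 'k) field_chain set)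
        (fboundaries q (top_of_set (\<Union>?D)))" for q
      by (rule less.hyps[OF card finD]) (use less.prems(2) in simp)
    moreover have "fchain.fin_mod (fcycles q (top_of_set C) :: ('e, 'k) field_chain set)
        (fboundaries q (top_of_set C))" for q
      by (rule fin_mod_fcycles_contractible)
         (use less.prems(2)[OF C] in \<open>simp add: convex_imp_contractible\<close>)
    moreover have "openin euclidean C" "openin euclidean (\<Union>?D)"
      using less.prems(2) C by (auto intro!: open_Union)
    ultimately show ?thesis unfolding U by (intro fin_mod_fcycles_Un)
  qed
qed

section \<open>Functoriality, and finiteness for compact subsets of neighbourhood retracts\<close>

lemma flift_chain_map_in_fchains:
  assumes "continuous_map X Y g" "z \<in> fchains p X"
  shows "flift (chain_map p g) z \<in> fchains p Y"
  by (rule flift_in_fchains) (use assms singular_chain_chain_map singular_chain_of_key in blast)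

lemma fchain_boundary_flift_chain_map:
  assumes z: "z \<in> fchains p X"
  shows "fchain_boundary p (flift (chain_map p g) z) = flift (chain_map (p - 1) g) (fchain_boundary p z)"
proof -
  have "fchain_boundary p (flift (chain_map p g) z) = flift (\<lambda>x. chain_boundary p (chain_map p g x)) z"
    by (rule fchain_boundary_flift_comp)
  also have "\<dots> = flift (\<lambda>x. chain_map (p - 1) g (chain_boundary p x)) z"
    by (rule flift_cong) (use chain_boundary_chain_map[OF singular_chain_of_key[OF z]] in simp)
  also have "\<dots> = flift (chain_map (p - 1) g) (fchain_boundary p z)"
    unfolding fchain_boundary_eq_flift by (rule flift_comp[symmetric]) (rule chain_map_diff)
  finally show ?thesis .
qed

lemma flift_chain_map_in_fcycles:
  assumes "continuous_map X Y g" "z \<in> fcycles p X"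
  shows "flift (chain_map p g) z \<in> fcycles p Y"
  using assms
  by (auto simp: fcycles_def flift_chain_map_in_fchains fchain_boundary_flift_chain_map)

lemma flift_chain_map_in_fboundaries:
  assumes "continuous_map X Y g" "z \<in> fboundaries p X"
  shows "flift (chain_map p g) z \<in> fboundaries p Y"
proof -
  obtain w where "w \<in> fchains (Suc p) X" "z = fchain_boundary (Suc p) w"
    using assms(2) by (auto simp: fboundaries_def)
  then show ?thesis
    using fchain_boundary_flift_chain_map[of w "Suc p" X g] flift_chain_map_in_fchains[OF assms(1)]
    unfolding fboundaries_def by (metis diff_Suc_1 imageI)
qed

text \<open>The compact image of \<open>A\<close> under \<open>e\<close> lies in the open set of
  points that \<open>\<rho>\<close> carries into \<open>U\<close>, and finitely many balls inside
  that set cover it. As \<open>\<rho>\<close> undoes \<open>e\<close>, generators for the union of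
  the balls, pushed forward by \<open>\<rho>\<close>, span the cycles of \<open>A\<close> modulo
  boundaries of \<open>U\<close>. Nothing is claimed modulo boundaries of \<open>A\<close>.\<close>

lemma fin_mod_fcycles_compactin:
  fixes Y :: "'a topology" and e :: "'a \<Rightarrow> 'e::euclidean_space"
  assumes e: "continuous_map Y euclidean e" and W: "open W" and \<rho>: "continuous_map (top_of_set W) Y \<rho>"
    and retr: "\<And>x. x \<in> topspace Y \<Longrightarrow> e x \<in> W \<and> \<rho> (e x) = x"
    and A: "compactin Y A" and U: "openin Y U" and AU: "A \<subseteq> U"
  shows "fchain.fin_mod (fcycles p (subtopology Y A) :: ('a, 'k::field) field_chain set)
     (fboundaries p (subtopology Y U))"
proof -
  define W' where "W' = {w \<in> W. \<rho> w \<in> U}"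
  have "openin (top_of_set W) W'"
    using openin_continuous_map_preimage[OF \<rho> U] by (simp add: W'_def)
  then have W': "open W'" using W openin_open_trans by blast
  have AY: "A \<subseteq> topspace Y" using A by (rule compactin_subset_topspace)
  have eA: "e ` A \<subseteq> W'"
  proof (rule image_subsetI)
    fix x assume "x \<in> A"
    then have "x \<in> topspace Y" "x \<in> U" using AY AU by blast+
    then show "e x \<in> W'" using retr[of x] by (simp add: W'_def)
  qed
  have "compact (e ` A)" using image_compactin[OF A e] by simp
  moreover have "\<exists>r>0. ball x r \<subseteq> W'" if "x \<in> e ` A" for x
    using that eA W' by (meson open_contains_ball subsetD)
  then obtain r where r: "\<And>x. x \<in> e ` A \<Longrightarrow> r x > 0 \<and> ball x (r x) \<subseteq> W'" by metis
  then have "e ` A \<subseteq> (\<Union>x\<in>e ` A. ball x (r x))" by force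
  ultimately obtain D where D: "D \<subseteq> e ` A" "finite D" "e ` A \<subseteq> (\<Union>x\<in>D. ball x (r x))"
    using compactE_image[of "e ` A" "e ` A" "\<lambda>x. ball x (r x)"] by (metis open_ball)
  let ?C = "(\<lambda>x. ball x (r x)) ` D"
  let ?P = "top_of_set (\<Union>?C)"
  have PW: "\<Union>?C \<subseteq> W'" using r D(1) by blast
  have e': "continuous_map (subtopology Y A) ?P e"
    using e D(3) by (auto simp: continuous_map_in_subtopology continuous_map_from_subtopology)
  have \<rho>': "continuous_map ?P (subtopology Y U) \<rho>"
  proof -
    have "continuous_map (subtopology (top_of_set W) (\<Union>?C)) Y \<rho>"
      using \<rho> by (rule continuous_map_from_subtopology)
    moreover have "subtopology (top_of_set W) (\<Union>?C) = ?P"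
      using PW by (auto simp: subtopology_subtopology W'_def Int_absorb1 intro!: arg_cong[of _ _ top_of_set])
    ultimately show ?thesis
      using PW by (auto simp: continuous_map_in_subtopology W'_def)
  qed
  have "fchain.fin_mod (fcycles p ?P :: ('e, 'k) field_chain set) (fboundaries p ?P)"
    by (rule fin_mod_fcycles_Union_convex) (use D(2) in auto)
  then obtain T :: "('e, 'k) field_chain set"
    where T: "finite T" "fcycles p ?P \<subseteq> fchain.span (T \<union> fboundaries p ?P)"
    by (auto simp: fchain.fin_mod_def)
  let ?h = "flift (chain_map p \<rho>) :: ('e, 'k) field_chain \<Rightarrow> ('a, 'k) field_chain"
  let ?span = "fchain.span (?h ` T \<union> fboundaries p (subtopology Y U))"
  \<comment> \<open>The preimage of a span under a linear map is a subspace, so only generators and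
    boundaries have to be checked.\<close>
  have sub: "fchain.subspace {x. ?h x \<in> ?span}"
    by (rule fchain.subspaceI)
       (auto simp: flift_linear fchain.span_zero intro: fchain.span_add fchain.span_scale)
  have "T \<union> fboundaries p ?P \<subseteq> {x. ?h x \<in> ?span}"
    using flift_chain_map_in_fboundaries[OF \<rho>'] by (auto intro!: fchain.span_base)
  then have span: "fchain.span (T \<union> fboundaries p ?P) \<subseteq> {x. ?h x \<in> ?span}"
    by (rule fchain.span_minimal[OF _ sub])
  have "z \<in> ?span" if z: "z \<in> fcycles p (subtopology Y A)" for z :: "('a, 'k) field_chain"
  proof -
    have zA: "z \<in> fchains p (subtopology Y A)" using z by (simp add: fcycles_def)
    have "flift (chain_map p e) z \<in> fcycles p ?P" by (rule flift_chain_map_in_fcycles[OF e' z])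
    then have "?h (flift (chain_map p e) z) \<in> ?span" using T(2) span by blast
    moreover have "?h (flift (chain_map p e) z) = z"
    proof -
      have "?h (flift (chain_map p e) z) = flift (\<lambda>x. chain_map p \<rho> (chain_map p e x)) z"
        by (rule flift_comp) (rule chain_map_diff)
      also have "\<dots> = flift (\<lambda>x. x) z"
      proof (rule flift_cong)
        fix \<sigma> assume "\<sigma> \<in> Poly_Mapping.keys z"
        then have "singular_chain p (subtopology Y A) (frag_of \<sigma>)" by (rule singular_chain_of_key[OF zA])
        then have "chain_map p (\<rho> \<circ> e) (frag_of \<sigma>) = frag_of \<sigma>"
          by (rule chain_map_id_gen) (use retr in auto)
        then show "chain_map p \<rho> (chain_map p e (frag_of \<sigma>)) = frag_of \<sigma>"
          by (simp add: chain_map_compose)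
      qed
      finally show ?thesis by (simp add: flift_id)
    qed
    ultimately show ?thesis by simp
  qed
  then show ?thesis using T(1) unfolding fchain.fin_mod_def by blast
qed

section \<open>The Moebius band as a Euclidean neighbourhood retract\<close>

text \<open>The values of product and sum on pairs of unit complex numbers: conjugation inverts such
  numbers, whence \<open>s = cnj s * p\<close>. For \<open>p = q * q\<close> on the circle this is
  the equation of the real line through \<open>q\<close>, cut to a segment by the norm bound; as
  \<open>p\<close> runs once around, the line makes a half turn.\<close>

definition moebius :: "(complex \<times> complex) set" where
  "moebius = {w. norm (fst w) = 1 \<and> snd w = cnj (snd w) * fst w \<and> norm (snd w) \<le> 2}"

text \<open>
  The coefficients of the monic quadratic polynomial whose roots are the points of \<open>A\<close>, counted
  twice if there is only one.
\<close>

definition vieta :: "complex set \<Rightarrow> complex \<times> complex" where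
  "vieta A = (if card A = 1 then ((the_elem A)\<^sup>2, 2 * the_elem A) else (\<Prod>A, \<Sum>A))"

lemma vieta_pair: "vieta {z1, z2} = (z1 * z2, z1 + z2)"
  by (cases "z1 = z2") (auto simp: vieta_def power2_eq_square)

lemma F2_carrierE:
  assumes "A \<in> F2_carrier"
  obtains z1 z2 where "norm z1 = 1" "norm z2 = 1" "A = {z1, z2}"
  using assms unfolding F2_carrier_image[symmetric] by auto

lemma F2_carrierI: "norm z1 = 1 \<Longrightarrow> norm z2 = 1 \<Longrightarrow> {z1, z2} \<in> F2_carrier"
  unfolding F2_carrier_image[symmetric] by (rule image_eqI[of _ _ "(z1, z2)"]) auto

lemma continuous_map_F2_circle:
  assumes "continuous_map (prod_topology circle circle) Y (\<lambda>w. f {fst w, snd w})"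
  shows "continuous_map F2_circle Y f"
  using continuous_compose_quotient_map[OF quotient_map_F2_circle, of Y f] assms by (simp add: o_def)

lemma compact_space_F2_circle: "compact_space F2_circle"
proof -
  have "compact_space (prod_topology circle circle)"
    by (subst compact_space_prod_topology) (simp add: compact_space_subtopology)
  then have "compactin F2_circle ((\<lambda>w. {fst w, snd w}) ` topspace (prod_topology circle circle))"
    unfolding compact_space_def
    by (rule image_compactin[OF _ quotient_imp_continuous_map[OF quotient_map_F2_circle]])
  then show ?thesis
    unfolding compact_space_def quotient_imp_surjective_map[OF quotient_map_F2_circle] .
qed

lemma continuous_map_vieta: "continuous_map F2_circle euclidean vieta"
proof (rule continuous_map_F2_circle)
  show "continuous_map (prod_topology circle circle) euclidean (\<lambda>w. vieta {fst w, snd w})"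
    unfolding vieta_pair prod_topology_subtopology_eu continuous_map_iff_continuous
    by (intro continuous_intros)
qed

lemma vieta_in_moebius:
  assumes "A \<in> F2_carrier"
  shows "vieta A \<in> moebius"
proof -
  obtain z1 z2 where z: "norm z1 = 1" "norm z2 = 1" and A: "A = {z1, z2}"
    using assms by (rule F2_carrierE)
  have u: "cnj z1 * z1 = 1" "cnj z2 * z2 = 1"
    using z by (simp_all add: complex_norm_square[symmetric] mult.commute)
  have "cnj (z1 + z2) * (z1 * z2) = (cnj z1 * z1) * z2 + (cnj z2 * z2) * z1"
    by (simp add: algebra_simps)
  then have "z1 + z2 = cnj (z1 + z2) * (z1 * z2)" using u by simp
  moreover have "norm (z1 + z2) \<le> 2" using norm_triangle_ineq[of z1 z2] z by simp
  moreover have "norm (z1 * z2) = 1" using z by (simp add: norm_mult)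
  ultimately show ?thesis unfolding A vieta_pair moebius_def mem_Collect_eq fst_conv snd_conv by blast
qed

text \<open>A monic quadratic polynomial determines its roots: \<open>w1\<close> is a root of the
  one with roots \<open>z1\<close> and \<open>z2\<close>, and the equal sums settle the other
  root.\<close>

lemma inj_on_vieta: "inj_on vieta F2_carrier"
proof (rule inj_onI)
  fix A B assume "A \<in> F2_carrier" "B \<in> F2_carrier" and eq: "vieta A = vieta B"
  then obtain z1 z2 w1 w2 where A: "A = {z1, z2}" and B: "B = {w1, w2}"
    using F2_carrierE by metis
  have p: "z1 * z2 = w1 * w2" and s: "z1 + z2 = w1 + w2" using eq by (auto simp: A B vieta_pair)
  have "(w1 - z1) * (w1 - z2) = w1 * w1 - (z1 + z2) * w1 + z1 * z2" by (simp add: algebra_simps)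
  also have "\<dots> = 0" unfolding p s by (simp add: algebra_simps)
  finally have "w1 = z1 \<or> w1 = z2" by simp
  then show "A = B" using s by (auto simp: A B)
qed

text \<open>Multiplication by \<open>cnj q\<close>, for a square root \<open>q\<close> of
  \<open>p\<close>, turns \<open>s\<close> into a real \<tau> between -2 and 2. The polynomial X^2 -
  \<tau> X + 1 then has two conjugate unit roots with real part \<tau>/2, and multiplication by
  \<open>q\<close> brings them back.\<close>

lemma moebius_subset_vieta: "moebius \<subseteq> vieta ` F2_carrier"
proof
  fix w assume w: "w \<in> moebius"
  obtain p s where ws: "w = (p, s)" by (cases w)
  have p: "norm p = 1" and s: "s = cnj s * p" and n: "norm s \<le> 2" using w by (auto simp: ws moebius_def)
  define q where "q = csqrt p"
  have qq: "q * q = p" by (simp add: q_def power2_eq_square[symmetric])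
  have "norm q * norm q = 1" using p qq norm_mult by metis
  then have "(norm q)\<^sup>2 = 1" by (simp add: power2_eq_square)
  then have nq: "norm q = 1" using norm_ge_zero[of q] by (auto simp: power2_eq_1_iff)
  have u: "q * cnj q = 1" using nq by (simp add: complex_norm_square[symmetric])
  define t where "t = s * cnj q"
  have "t = cnj s * q * (q * cnj q)" using s unfolding t_def qq[symmetric] by (simp add: mult_ac)
  then have "cnj t = t" using u by (simp add: t_def)
  then have "t \<in> \<real>" by (simp add: Reals_cnj_iff)
  then obtain \<tau> where \<tau>: "t = of_real \<tau>" by (auto elim: Reals_cases)
  have "\<bar>\<tau>\<bar> = norm t" by (simp add: \<tau>)
  also have "\<dots> \<le> 2" using n nq by (simp add: t_def norm_mult)
  finally have \<tau>2: "\<bar>\<tau>\<bar> \<le> 2" .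
  define \<delta> where "\<delta> = sqrt (1 - \<tau>\<^sup>2 / 4)"
  have "\<tau>\<^sup>2 \<le> 4" using \<tau>2 abs_le_square_iff[of \<tau> 2] by simp
  then have \<delta>: "\<delta> * \<delta> = 1 - \<tau>\<^sup>2 / 4" by (simp add: \<delta>_def)
  define z1 where "z1 = q * Complex (\<tau> / 2) \<delta>"
  define z2 where "z2 = q * Complex (\<tau> / 2) (- \<delta>)"
  have n1: "norm (Complex (\<tau> / 2) \<delta>) = 1" "norm (Complex (\<tau> / 2) (- \<delta>)) = 1"
    using \<delta> by (auto simp: complex_norm power2_eq_square)
  have "z1 * z2 = (q * q) * (Complex (\<tau> / 2) \<delta> * Complex (\<tau> / 2) (- \<delta>))"
    by (simp add: z1_def z2_def mult_ac)
  also have "Complex (\<tau> / 2) \<delta> * Complex (\<tau> / 2) (- \<delta>) = 1"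
    using \<delta> by (simp add: complex_eq_iff power2_eq_square)
  finally have "z1 * z2 = p" by (simp add: qq)
  moreover have "z1 + z2 = s"
  proof -
    have "z1 + z2 = q * (Complex (\<tau> / 2) \<delta> + Complex (\<tau> / 2) (- \<delta>))"
      by (simp add: z1_def z2_def distrib_left)
    also have "Complex (\<tau> / 2) \<delta> + Complex (\<tau> / 2) (- \<delta>) = t"
      by (simp add: \<tau> complex_eq_iff)
    also have "q * t = s * (q * cnj q)" by (simp add: t_def mult_ac)
    finally show ?thesis using u by simp
  qed
  ultimately have "w = vieta {z1, z2}" by (simp add: ws vieta_pair)
  moreover have "{z1, z2} \<in> F2_carrier"
    using nq n1 by (intro F2_carrierI) (simp_all add: z1_def z2_def norm_mult)
  ultimately show "w \<in> vieta ` F2_carrier" by blast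
qed

text \<open>
  Normalise the first coordinate to \<open>p\<close>, project the second one orthogonally to the line of all
  \<open>s\<close> with \<open>s = cnj s * p\<close>, and clamp its norm.
\<close>

definition moebius_retraction :: "complex \<times> complex \<Rightarrow> complex \<times> complex" where
  "moebius_retraction w = (let p = sgn (fst w); s = (snd w + cnj (snd w) * p) / 2
     in (p, s / of_real (max 1 (norm s / 2))))"

lemma moebius_retraction_in_moebius:
  assumes "fst w \<noteq> 0"
  shows "moebius_retraction w \<in> moebius"
proof -
  define p where "p = sgn (fst w)"
  define s where "s = (snd w + cnj (snd w) * p) / 2"
  define m where "m = max 1 (norm s / 2)"
  have m: "m > 0" "norm s \<le> 2 * m" by (auto simp: m_def)
  have p: "norm p = 1" using assms by (simp add: p_def norm_sgn)
  then have u: "cnj p * p = 1" by (simp add: complex_norm_square[symmetric] mult.commute)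
  have "cnj s * p = (cnj (snd w) * p + snd w * (cnj p * p)) / 2"
    by (simp add: s_def algebra_simps add_divide_distrib)
  then have s: "cnj s * p = s" using u by (simp add: s_def add.commute)
  have "cnj (s / of_real m) * p = s / of_real m" using s by simp
  moreover have "norm (s / of_real m) \<le> 2" using m by (simp add: norm_divide divide_le_eq)
  moreover have "moebius_retraction w = (p, s / of_real m)"
    by (simp add: moebius_retraction_def Let_def p_def s_def m_def)
  ultimately show ?thesis using p unfolding moebius_def mem_Collect_eq by (metis fst_conv snd_conv)
qed

lemma moebius_retraction_id:
  assumes "w \<in> moebius"
  shows "moebius_retraction w = w"
proof -
  have "sgn (fst w) = fst w" using assms by (simp add: moebius_def sgn_eq)
  moreover have "(snd w + cnj (snd w) * fst w) / 2 = snd w" using assms by (simp add: moebius_def)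
  moreover have "max 1 (norm (snd w) / 2) = 1" using assms by (simp add: moebius_def)
  ultimately show ?thesis by (simp add: moebius_retraction_def prod_eq_iff)
qed

lemma continuous_on_moebius_retraction: "continuous_on {w. fst w \<noteq> 0} moebius_retraction"
  unfolding moebius_retraction_def Let_def
  by (intro continuous_intros) (auto simp: max_def)

text \<open>A continuous injection of a compact space into a Hausdorff space is a homeomorphism onto
  its image, so \<open>vieta\<close> can be inverted on \<open>moebius\<close>. Preceded by
  \<open>moebius_retraction\<close>, on the open set where the product coordinate is nonzero, the
  inverse is the required retraction.\<close>

lemma fin_mod_fcycles_F2_circle:
  assumes "compactin F2_circle A" "openin F2_circle U" "A \<subseteq> U"
  shows "fchain.fin_mod (fcycles p (subtopology F2_circle A) :: (complex set, 'k::field) field_chain set)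
     (fboundaries p (subtopology F2_circle U))"
proof -
  have img: "vieta ` F2_carrier = moebius"
    using vieta_in_moebius moebius_subset_vieta by blast
  have "homeomorphic_map F2_circle (top_of_set moebius) vieta"
  proof (rule continuous_imp_homeomorphic_map)
    show "continuous_map F2_circle (top_of_set moebius) vieta"
      using continuous_map_vieta vieta_in_moebius by (auto simp: continuous_map_in_subtopology)
  qed (use compact_space_F2_circle img inj_on_vieta in \<open>auto simp: Hausdorff_space_subtopology\<close>)
  then obtain g where g: "homeomorphic_maps F2_circle (top_of_set moebius) vieta g"
    using homeomorphic_map_maps by blast
  then have gc: "continuous_map (top_of_set moebius) F2_circle g"
    and gv: "\<And>A. A \<in> F2_carrier \<Longrightarrow> g (vieta A) = A"
    by (auto simp: homeomorphic_maps_def)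
  show ?thesis
  proof (rule fin_mod_fcycles_compactin[OF continuous_map_vieta, where \<rho> = "g \<circ> moebius_retraction"])
    show "open {w :: complex \<times> complex. fst w \<noteq> 0}"
      by (intro open_Collect_neq continuous_intros)
    have "continuous_map (top_of_set {w. fst w \<noteq> 0}) (top_of_set moebius) moebius_retraction"
      using continuous_on_moebius_retraction moebius_retraction_in_moebius
      by (auto simp: continuous_map_in_subtopology)
    then show "continuous_map (top_of_set {w. fst w \<noteq> 0}) F2_circle (g \<circ> moebius_retraction)"
      using gc by (rule continuous_map_compose)
    show "vieta A \<in> {w. fst w \<noteq> 0} \<and> (g \<circ> moebius_retraction) (vieta A) = A"
      if "A \<in> topspace F2_circle" for A
    proof -
      have A: "A \<in> F2_carrier" using that by simp
      then have "vieta A \<in> moebius" by (rule vieta_in_moebius)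
      then show ?thesis using gv[OF A] moebius_retraction_id[of "vieta A"] by (auto simp: moebius_def)
    qed
  qed (use assms in auto)
qed

section \<open>Persistent ranks\<close>

text \<open>Inclusion-exclusion: the number of intervals alive at \<open>b\<close> and
  \<open>c\<close> but at neither \<open>a\<close> nor \<open>d\<close>. It is additive when a side
  is cut, like a measure on rectangles.\<close>

definition rect_mass :: "(ereal \<Rightarrow> ereal \<Rightarrow> int) \<Rightarrow> ereal \<Rightarrow> ereal \<Rightarrow> ereal \<Rightarrow> ereal \<Rightarrow> int" where
  "rect_mass r a b c d = r b c - r a c - r b d + r a d"

text \<open>The diagram as a function of the ranks alone, which separates the combinatorics of
  diagrams from homology.\<close>

definition rank_diagram :: "(ereal \<Rightarrow> ereal \<Rightarrow> int) \<Rightarrow> diagram" where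
  "rank_diagram r = (\<lambda>(b, d). if b < d then
      Inf {nat (rect_mass r a b' c d') |a b' c d'.
             a < b' \<and> b' < c \<and> c < d' \<and> (b, d) \<in> interior ({a..b'} \<times> {c..d'})}
     else 0)"

definition rect_nonneg :: "(ereal \<Rightarrow> ereal \<Rightarrow> int) \<Rightarrow> bool" where
  "rect_nonneg r \<longleftrightarrow> (\<forall>a b c d. a \<le> b \<and> b < c \<and> c \<le> d \<longrightarrow> rect_mass r a b c d \<ge> 0)"

section \<open>The rank of an induced map as a dimension of cycles modulo boundaries\<close>

lemma mem_fclass: "w \<in> fclass p X z \<longleftrightarrow> w - z \<in> fboundaries p X"
  by (simp add: fclass_def)

lemma self_mem_fclass: "z \<in> fclass p X z"
  by (simp add: mem_fclass fchain.subspace_0[OF subspace_fboundaries])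

lemma fhomology_incl_fclass:
  assumes "fboundaries p X \<subseteq> (fboundaries p Y :: ('a, 'k::field) field_chain set)"
  shows "fhomology_incl p Y (fclass p X z) = (fclass p Y z :: ('a, 'k) field_chain set)"
proof (intro equalityI subsetI)
  fix w assume "w \<in> fhomology_incl p Y (fclass p X z)"
  then obtain u where u: "u - z \<in> fboundaries p X" and "w - u \<in> fboundaries p Y"
    by (auto simp: fhomology_incl_def mem_fclass)
  then have "(w - u) + (u - z) \<in> fboundaries p Y"
    using assms fchain.subspace_add[OF subspace_fboundaries] by blast
  then show "w \<in> fclass p Y z" by (simp add: mem_fclass)
next
  fix w assume "w \<in> fclass p Y z"
  then show "w \<in> fhomology_incl p Y (fclass p X z)"
    using self_mem_fclass[of z p X] by (auto simp: fhomology_incl_def)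
qed

text \<open>A basis of the cycles of \<open>X\<close> modulo the boundaries of \<open>Y\<close>
  gives independent classes. Conversely, independent classes in the image lift to cycles that are
  independent modulo these boundaries, hence no more numerous than the basis. So the supremum is
  attained and finite.\<close>

lemma fhomology_incl_rank_eq_dim_mod:
  fixes X Y :: "'a topology" and p :: nat and K :: "'k::field itself"
  defines "Z \<equiv> fcycles p X :: ('a, 'k) field_chain set"
    and "B \<equiv> fboundaries p Y :: ('a, 'k) field_chain set"
  assumes Z: "Z \<subseteq> fcycles p Y" and BX: "fboundaries p X \<subseteq> B" and fin: "fchain.fin_mod Z B"
  shows "fhomology_incl_rank K p X Y = enat (fchain.dim_mod Z B)"
proof -
  have subB: "fchain.subspace B" unfolding B_def by (rule subspace_fboundaries)
  obtain S where S: "fchain.basis_mod Z B S" using fchain.basis_mod_exists[OF subB fin] by blast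
  have SZ: "S \<subseteq> Z" and ind: "fchain.indep_mod B S" and span: "Z \<subseteq> fchain.span (S \<union> B)"
    using S by (auto simp: fchain.basis_mod_def)
  have finS: "finite S" using ind by (simp add: fchain.indep_mod_def)
  have dim: "fchain.dim_mod Z B = card S" using fchain.dim_mod_eq[OF subB S] .
  define cl where "cl = (fclass p Y :: ('a, 'k) field_chain \<Rightarrow> _)"
  have mem_cl: "w \<in> cl z \<longleftrightarrow> w - z \<in> B" for w z
    by (simp add: cl_def B_def mem_fclass)
  define W where "W = fhomology_incl p Y ` (fhomology p X :: ('a, 'k) field_chain set set)"
  have W: "W = cl ` Z"
    unfolding W_def fhomology_def Z_def cl_def image_image
    using fhomology_incl_fclass[OF BX[unfolded B_def]] by simp
  have inj: "inj_on cl S"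
  proof (rule inj_onI, rule ccontr)
    fix s t assume s: "s \<in> S" and t: "t \<in> S" and "cl s = cl t" and st: "s \<noteq> t"
    then have "s \<in> cl t" using mem_cl[of s s] fchain.subspace_0[OF subB] by simp
    then have stB: "s - t \<in> B" by (simp add: mem_cl)
    define c where "c x = (if x = s then 1 else if x = t then - 1 else (0 :: 'k))" for x
    have "(\<Sum>x\<in>S. fchain_scale (c x) x) = (\<Sum>x\<in>S. (if x = s then s else 0) - (if x = t then t else 0))"
      using st by (intro sum.cong) (auto simp: c_def)
    also have "\<dots> = s - t" using s t finS by (simp add: sum_subtractf)
    finally have "(\<Sum>x\<in>S. fchain_scale (c x) x) \<in> B" using stB by simp
    then have "\<forall>x\<in>S. c x = 0" using ind unfolding fchain.indep_mod_def by blast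
    then have "c s = 0" using s by blast
    then show False by (simp add: c_def)
  qed
  have indep: "fhomology_independent p Y (cl ` S)"
    unfolding fhomology_independent_def
  proof (intro conjI allI impI)
    show "finite (cl ` S)" using finS by simp
    show "cl ` S \<subseteq> fhomology p Y" using SZ Z by (auto simp: fhomology_def cl_def)
    fix c z assume z: "\<forall>h\<in>cl ` S. z h \<in> h"
      and sum: "(\<Sum>h\<in>cl ` S. fchain_scale (c h) (z h)) \<in> fboundaries p Y"
    \<comment> \<open>The representatives \<open>z\<close> are arbitrary; they differ from the basis
      elements by boundaries, so the combination can be moved to the basis.\<close>
    have "(\<Sum>s\<in>S. fchain_scale (c (cl s)) (z (cl s) - s)) \<in> B"
      using z by (intro fchain.subspace_sum[OF subB] fchain.subspace_scale[OF subB]) (auto simp: mem_cl)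
    moreover have "(\<Sum>s\<in>S. fchain_scale (c (cl s)) (z (cl s))) \<in> B"
      using sum by (simp add: sum.reindex[OF inj] B_def)
    ultimately have "(\<Sum>s\<in>S. fchain_scale (c (cl s)) (z (cl s)))
        - (\<Sum>s\<in>S. fchain_scale (c (cl s)) (z (cl s) - s)) \<in> B"
      by (intro fchain.subspace_diff[OF subB])
    then have inB: "(\<Sum>s\<in>S. fchain_scale (c (cl s)) s) \<in> B"
      by (simp add: sum_subtractf[symmetric] fchain.scale_right_diff_distrib)
    have "(\<Sum>s\<in>S. fchain_scale (c' s) s) \<in> B \<Longrightarrow> \<forall>s\<in>S. c' s = 0" for c'
      using ind unfolding fchain.indep_mod_def by blast
    from this[OF inB] have "\<forall>s\<in>S. c (cl s) = 0" .
    then show "\<forall>h\<in>cl ` S. c h = 0" by simp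
  qed
  have le: "card H \<le> card S" if H: "H \<subseteq> W" "fhomology_independent p Y H" for H
  proof -
    have "\<forall>h\<in>H. \<exists>z. z \<in> Z \<and> h = cl z" using H(1) unfolding W by blast
    from bchoice[OF this] obtain rep where rep: "\<forall>h\<in>H. rep h \<in> Z \<and> h = cl (rep h)" ..
    have finH: "finite H" using H(2) by (simp add: fhomology_independent_def)
    have injr: "inj_on rep H" by (rule inj_on_inverseI[of _ cl]) (use rep in simp)
    have "z \<in> cl z" for z using mem_cl[of z z] fchain.subspace_0[OF subB] by simp
    then have mem: "\<forall>h\<in>H. rep h \<in> h" using rep by metis
    have "fchain.indep_mod B (rep ` H)"
      unfolding fchain.indep_mod_def
    proof (intro conjI allI impI)
      show "finite (rep ` H)" using finH by simp
      fix c assume "(\<Sum>s\<in>rep ` H. fchain_scale (c s) s) \<in> B"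
      then have "(\<Sum>h\<in>H. fchain_scale (c (rep h)) (rep h)) \<in> fboundaries p Y"
        by (simp add: sum.reindex[OF injr] B_def)
      moreover have "(\<Sum>h\<in>H. fchain_scale (c' h) (rep h)) \<in> fboundaries p Y \<Longrightarrow> \<forall>h\<in>H. c' h = 0" for c'
        using H(2) mem unfolding fhomology_independent_def by blast
      note this[of "\<lambda>h. c (rep h)"]
      ultimately have "\<forall>h\<in>H. c (rep h) = 0" by blast
      then show "\<forall>s\<in>rep ` H. c s = 0" by simp
    qed
    moreover have "rep ` H \<subseteq> fchain.span (S \<union> B)" using rep span by blast
    ultimately have "card (rep ` H) \<le> card S"
      using fchain.card_indep_mod_le[OF subB _ finS] by blast
    then show ?thesis by (simp add: card_image[OF injr])
  qed
  have "fhomology_incl_rank K p X Y = Sup {enat (card H) |H. H \<subseteq> W \<and> fhomology_independent p Y H}"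
    by (simp add: fhomology_incl_rank_def fhomology_dim_def W_def)
  also have "\<dots> = enat (card S)"
  proof (rule Sup_eqI)
    show "y \<le> enat (card S)" if "y \<in> {enat (card H) |H. H \<subseteq> W \<and> fhomology_independent p Y H}" for y
      using that le by auto
    fix y assume y: "\<And>z. z \<in> {enat (card H) |H. H \<subseteq> W \<and> fhomology_independent p Y H} \<Longrightarrow> z \<le> y"
    have "enat (card (cl ` S)) \<le> y" by (rule y) (use indep SZ W in blast)
    then show "enat (card S) \<le> y" by (simp add: card_image[OF inj])
  qed
  finally show ?thesis using dim by simp
qed

section \<open>Sublevel filtrations over the extended line\<close>

definition ext_level :: "'a topology \<Rightarrow> ('a \<Rightarrow> real) \<Rightarrow> ereal \<Rightarrow> 'a set" where
  "ext_level Y f t = {y \<in> topspace Y. ereal (f y) \<le> t}"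

definition level_cycles :: "nat \<Rightarrow> 'a topology \<Rightarrow> ('a \<Rightarrow> real) \<Rightarrow> ereal \<Rightarrow> ('a, 'k::field) field_chain set" where
  "level_cycles p Y f s = fcycles p (subtopology Y (ext_level Y f s))"

text \<open>Everything bounds at level \<open>\<infinity>\<close>, in accordance with the convention \<open>V\<^sup>\<infinity> = 0\<close>.\<close>

definition level_boundaries :: "nat \<Rightarrow> 'a topology \<Rightarrow> ('a \<Rightarrow> real) \<Rightarrow> ereal \<Rightarrow> ('a, 'k::field) field_chain set" where
  "level_boundaries p Y f t = (if t = \<infinity> then UNIV else fboundaries p (subtopology Y (ext_level Y f t)))"

definition q_tame :: "'k::field itself \<Rightarrow> nat \<Rightarrow> 'a topology \<Rightarrow> ('a \<Rightarrow> real) \<Rightarrow> bool" where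
  "q_tame K p Y f \<longleftrightarrow> (\<forall>(s::real) (t::real). ereal s < ereal t \<longrightarrow>
     fchain.fin_mod (level_cycles p Y f s :: ('a, 'k) field_chain set) (level_boundaries p Y f t))"

lemma subspace_level_cycles: "fchain.subspace (level_cycles p Y f s :: ('a, 'k::field) field_chain set)"
  unfolding level_cycles_def by (rule subspace_fcycles)

lemma subspace_level_boundaries: "fchain.subspace (level_boundaries p Y f s :: ('a, 'k::field) field_chain set)"
  by (cases "s = \<infinity>") (simp_all add: level_boundaries_def subspace_fboundaries)

lemma level_cycles_mono:
  "ext_level Y f s \<subseteq> ext_level Y g t \<Longrightarrow> level_cycles p Y f s \<subseteq> level_cycles p Y g t"
  unfolding level_cycles_def by (rule fcycles_mono)

lemma level_boundaries_mono:
  "ext_level Y f s \<subseteq> ext_level Y g t \<Longrightarrow> (s = \<infinity> \<Longrightarrow> t = \<infinity>) \<Longrightarrow>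
    level_boundaries p Y f s \<subseteq> level_boundaries p Y g t"
  unfolding level_boundaries_def by (auto dest: fboundaries_mono[of _ _ p Y])

lemma ext_level_mono: "s \<le> t \<Longrightarrow> ext_level Y f s \<subseteq> ext_level Y f t"
  unfolding ext_level_def by auto

lemma level_boundaries_mono_le: "s \<le> t \<Longrightarrow> level_boundaries p Y f s \<subseteq> level_boundaries p Y f t"
  by (intro level_boundaries_mono ext_level_mono) auto

lemma level_cycles_empty:
  assumes "ext_level Y f s = {}"
  shows "level_cycles p Y f s \<subseteq> {0}"
proof -
  have "singular_simplex_set p (subtopology Y {}) = {}" using singular_simplex_empty[of "subtopology Y {}"] by auto
  then show ?thesis
    unfolding level_cycles_def assms fcycles_def fchains_def by (simp only: subset_empty keys_eq_empty) auto
qed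

lemma level_cycles_subset_boundaries:
  assumes "ext_level Y f s = {}"
  shows "(level_cycles p Y f s :: ('a, 'k::field) field_chain set) \<subseteq> level_boundaries p Y g t"
proof -
  have "(0 :: ('a, 'k) field_chain) \<in> level_boundaries p Y g t"
    by (rule fchain.subspace_0[OF subspace_level_boundaries])
  then show ?thesis using level_cycles_empty[OF assms, of p] by auto
qed

text \<open>At level -\<infinity> the only cycle is 0, and at \<infinity> every chain counts as a
  boundary; finite levels are the content of \<open>q_tame\<close>.\<close>

lemma fin_mod_level:
  fixes Y :: "'a topology" and K :: "'k::field itself"
  assumes tame: "q_tame K p Y f" and st: "s < t"
  shows "fchain.fin_mod (level_cycles p Y f s :: ('a, 'k) field_chain set) (level_boundaries p Y f t)"
proof -
  consider "s = -\<infinity>" | "t = \<infinity>" | x y where "s = ereal x" "t = ereal y" "x < y"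
    using st by (cases s; cases t) auto
  then show ?thesis
  proof cases
    case 1
    then have "level_cycles p Y f s \<subseteq> {0 :: ('a, 'k) field_chain}"
      by (intro level_cycles_empty) (auto simp: ext_level_def)
    then show ?thesis
      unfolding fchain.fin_mod_def using fchain.span_zero by blast
  next
    case 2
    then show ?thesis
      unfolding fchain.fin_mod_def level_boundaries_def using fchain.span_superset by (intro exI[of _ "{}"]) auto
  next
    case 3
    then show ?thesis using tame by (simp add: q_tame_def)
  qed
qed

text \<open>At infinite levels the dimension is 0 for the same two reasons, in agreement with the
  convention in \<open>persistence_rank\<close>.\<close>

lemma persistence_rank_eq_dim_mod:
  fixes Y :: "'a topology" and K :: "'k::field itself"
  assumes tame: "q_tame K p Y f" and st: "s < t"
  shows "persistence_rank K p Y f s t =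
    int (fchain.dim_mod (level_cycles p Y f s :: ('a, 'k) field_chain set) (level_boundaries p Y f t))"
proof -
  let ?Z = "\<lambda>s. level_cycles p Y f s :: ('a, 'k) field_chain set"
  let ?B = "\<lambda>t. level_boundaries p Y f t :: ('a, 'k) field_chain set"
  consider "s = -\<infinity>" | "t = \<infinity>" | x y where "s = ereal x" "t = ereal y" "x < y"
    using st by (cases s; cases t) auto
  then show ?thesis
  proof cases
    case 1
    then have "?Z s \<subseteq> ?B t"
      by (intro level_cycles_subset_boundaries) (auto simp: ext_level_def)
    then show ?thesis
      using 1 fchain.dim_mod_eq_0[OF subspace_level_boundaries] by (simp add: persistence_rank_def)
  next
    case 2
    then have "?Z s \<subseteq> ?B t" by (simp add: level_boundaries_def)
    then show ?thesis
      using 2 fchain.dim_mod_eq_0[OF subspace_level_boundaries] by (simp add: persistence_rank_def)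
  next
    case 3
    have sub: "sublevel Y f x = subtopology Y (ext_level Y f x)" for x
      by (simp add: sublevel_def ext_level_def)
    have mono: "ext_level Y f x \<subseteq> ext_level Y f y" using 3 by (intro ext_level_mono) simp
    have fin: "fchain.fin_mod (?Z (ereal x)) (if ereal y = \<infinity> then UNIV else fboundaries p (subtopology Y (ext_level Y f (ereal y))))"
      using fin_mod_level[OF tame st] by (simp add: 3 level_boundaries_def)
    have "fhomology_incl_rank K p (sublevel Y f x) (sublevel Y f y)
        = enat (fchain.dim_mod (?Z (ereal x)) (?B (ereal y)))"
      unfolding sub level_cycles_def level_boundaries_def
      using fhomology_incl_rank_eq_dim_mod[OF fcycles_mono[OF mono] fboundaries_mono[OF mono]
          fin[simplified, unfolded level_cycles_def], of K]
      by simp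
    then show ?thesis by (simp add: persistence_rank_def 3)
  qed
qed

lemma rect_mass_persistence_nonneg:
  assumes tame: "q_tame K p Y f" and "a \<le> b" "b < c" "c \<le> d"
  shows "rect_mass (persistence_rank K p Y f) a b c d \<ge> 0"
proof -
  have lt: "a < c" "b < d" "a < d" using assms by auto
  show ?thesis
    unfolding rect_mass_def persistence_rank_eq_dim_mod[OF tame lt(1)] persistence_rank_eq_dim_mod[OF tame lt(2)]
      persistence_rank_eq_dim_mod[OF tame lt(3)] persistence_rank_eq_dim_mod[OF tame \<open>b < c\<close>]
    by (rule fchain.dim_mod_rectangle_nonneg)
       (intro subspace_level_cycles subspace_level_boundaries level_boundaries_mono_le[OF assms(4)]
          level_cycles_mono[OF ext_level_mono[OF assms(2)]] fin_mod_level[OF tame assms(3)])+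
qed

text \<open>Level \<open>x - \<eta>\<close> of \<open>g\<close> lies in level \<open>x\<close> of
  \<open>f\<close>, and this one in level \<open>x + \<eta>\<close> of \<open>g\<close>. Hence the
  cycle spaces at the four birth levels form a chain with those of \<open>f\<close> innermost, and
  so do the boundary spaces at the four death levels. The gap \<open>b + \<eta> < c - \<eta>\<close>
  keeps the larger rectangle off the diagonal, where the ranks of \<open>g\<close> are
  finite.\<close>

lemma rect_mass_persistence_le:
  fixes \<eta> :: real
  assumes f: "q_tame K p Y f" and g: "q_tame K p Y g" and \<eta>: "\<eta> \<ge> 0"
    and close: "\<And>y. y \<in> topspace Y \<Longrightarrow> \<bar>f y - g y\<bar> \<le> \<eta>"
    and ab: "a \<le> b" and bc: "b + ereal \<eta> < c - ereal \<eta>" and cd: "c \<le> d"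
  shows "rect_mass (persistence_rank K p Y f) a b c d
    \<le> rect_mass (persistence_rank K p Y g) (a - \<eta>) (b + \<eta>) (c - \<eta>) (d + \<eta>)"
proof -
  have le: "x - \<eta> \<le> x" "x \<le> x + \<eta>" for x :: ereal using \<eta> by (cases x; simp)+
  have lt: "b < c" using bc le[of b] le[of c] by order
  have lts: "a < c" "b < d" "a < d" using ab cd lt by auto
  have lts': "b + \<eta> < d + \<eta>" "a - \<eta> < c - \<eta>" "a - \<eta> < d + \<eta>"
    using lts ab cd bc le[of a] le[of b] le[of c] le[of d] by order+
  have down: "ext_level Y g (x - \<eta>) \<subseteq> ext_level Y f x" for x :: ereal
  proof
    fix y assume "y \<in> ext_level Y g (x - \<eta>)"
    then have y: "y \<in> topspace Y" and le: "ereal (g y) \<le> x - \<eta>" by (auto simp: ext_level_def)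
    have "f y \<le> g y + \<eta>" using close[OF y] by linarith
    with le have "ereal (f y) \<le> x" by (cases x) simp_all
    then show "y \<in> ext_level Y f x" using y by (simp add: ext_level_def)
  qed
  have up: "ext_level Y f x \<subseteq> ext_level Y g (x + \<eta>)" for x :: ereal
  proof
    fix y assume "y \<in> ext_level Y f x"
    then have y: "y \<in> topspace Y" and le: "ereal (f y) \<le> x" by (auto simp: ext_level_def)
    have "g y \<le> f y + \<eta>" using close[OF y] by linarith
    with le have "ereal (g y) \<le> x + \<eta>" by (cases x) simp_all
    then show "y \<in> ext_level Y g (x + \<eta>)" using y by (simp add: ext_level_def)
  qed
  \<comment> \<open>A real shift preserves the level \<infinity>, at which
    \<open>level_boundaries\<close> jumps to all chains.\<close>
  have inf: "x - \<eta> = \<infinity> \<Longrightarrow> x = \<infinity>" "x = \<infinity> \<Longrightarrow> x + \<eta> = \<infinity>" for x :: ereal by (cases x; simp)+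
  show ?thesis
    unfolding rect_mass_def persistence_rank_eq_dim_mod[OF f lt] persistence_rank_eq_dim_mod[OF f lts(1)]
      persistence_rank_eq_dim_mod[OF f lts(2)] persistence_rank_eq_dim_mod[OF f lts(3)]
      persistence_rank_eq_dim_mod[OF g bc] persistence_rank_eq_dim_mod[OF g lts'(1)]
      persistence_rank_eq_dim_mod[OF g lts'(2)] persistence_rank_eq_dim_mod[OF g lts'(3)]
  proof (rule fchain.dim_mod_rectangle_mono)
    show "level_boundaries p Y g (c - \<eta>) \<subseteq> level_boundaries p Y f c"
      using down inf(1) by (rule level_boundaries_mono)
    show "level_boundaries p Y f c \<subseteq> level_boundaries p Y f d"
      using cd by (rule level_boundaries_mono_le)
    show "level_boundaries p Y f d \<subseteq> level_boundaries p Y g (d + \<eta>)"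
      using up inf(2) by (rule level_boundaries_mono)
  qed (intro subspace_level_cycles subspace_level_boundaries level_cycles_mono[OF down]
      level_cycles_mono[OF up] level_cycles_mono[OF ext_level_mono[OF ab]] fin_mod_level[OF g bc])+
qed

text \<open>The trace in the ranks of a bound \<open>M\<close> for the function: nothing is alive
  below \<open>-M\<close> and nothing changes above \<open>M\<close>. Death levels must be finite in
  the last clause, since classes that live forever die at \<infinity> by convention and the ranks
  jump there.\<close>

definition rank_bounded :: "real \<Rightarrow> (ereal \<Rightarrow> ereal \<Rightarrow> int) \<Rightarrow> bool" where
  "rank_bounded M r \<longleftrightarrow>
     (\<forall>s t. s < ereal (- M) \<longrightarrow> s < t \<longrightarrow> r s t = 0) \<and>
     (\<forall>s s' t. M < s \<longrightarrow> s < t \<longrightarrow> M < s' \<longrightarrow> s' < t \<longrightarrow> r s t = r s' t) \<and>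
     (\<forall>s t t'. M < t \<longrightarrow> M < t' \<longrightarrow> s < t \<longrightarrow> s < t' \<longrightarrow> t < \<infinity> \<longrightarrow> t' < \<infinity> \<longrightarrow> r s t = r s t')"

lemma rank_bounded_persistence_rank:
  assumes tame: "q_tame K p Y f" and M: "\<And>y. y \<in> topspace Y \<Longrightarrow> \<bar>f y\<bar> \<le> M"
  shows "rank_bounded M (persistence_rank K p Y f)"
proof -
  have low: "ext_level Y f s = {}" if "s < ereal (- M)" for s
  proof -
    have False if "y \<in> topspace Y" "ereal (f y) \<le> s" for y
    proof -
      have "ereal (f y) < ereal (- M)" using that \<open>s < ereal (- M)\<close> by order
      then show False using M[OF that(1)] by simp
    qed
    then show ?thesis by (auto simp: ext_level_def)
  qed
  have high: "ext_level Y f s = topspace Y" if "ereal M < s" for s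
  proof -
    have "ereal (f y) \<le> s" if "y \<in> topspace Y" for y
    proof -
      have "ereal (f y) \<le> ereal M" using M[OF that] by simp
      then show ?thesis using \<open>ereal M < s\<close> by order
    qed
    then show ?thesis by (auto simp: ext_level_def)
  qed
  have "persistence_rank K p Y f s t = 0" if "s < ereal (- M)" "s < t" for s t
    unfolding persistence_rank_eq_dim_mod[OF tame that(2)]
    by (simp add: fchain.dim_mod_eq_0[OF subspace_level_boundaries level_cycles_subset_boundaries[OF low[OF that(1)]]])
  then show ?thesis
    unfolding rank_bounded_def using high
    by (auto simp: persistence_rank_eq_dim_mod[OF tame] level_cycles_def level_boundaries_def)
qed

text \<open>The sublevel set at \<open>s\<close> is closed, hence compact, and lies in the open set
  where \<open>f < t\<close>; this is the room that the factorisation through balls needs.\<close>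

lemma q_tame_F2_circle:
  fixes K :: "'k::field itself"
  assumes f: "continuous_map F2_circle euclideanreal f"
  shows "q_tame K p F2_circle f"
  unfolding q_tame_def
proof (intro allI impI)
  fix s t :: real assume st: "ereal s < ereal t"
  let ?A = "ext_level F2_circle f s" and ?U = "{y \<in> topspace F2_circle. f y \<in> {..<t}}"
  have "closedin F2_circle {y \<in> topspace F2_circle. f y \<in> {..s}}"
    by (rule closedin_continuous_map_preimage[OF f]) simp
  then have A: "compactin F2_circle ?A"
    using compact_space_F2_circle closedin_compact_space by (simp add: ext_level_def atMost_def)
  have U: "openin F2_circle ?U"
    by (rule openin_continuous_map_preimage[OF f]) simp
  have AU: "?A \<subseteq> ?U" using st by (auto simp: ext_level_def)
  have UB: "?U \<subseteq> ext_level F2_circle f t" by (auto simp: ext_level_def)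
  show "fchain.fin_mod (level_cycles p F2_circle f s :: (complex set, 'k) field_chain set)
      (level_boundaries p F2_circle f t)"
    unfolding level_cycles_def level_boundaries_def
    by (simp add: fchain.fin_mod_mono[OF fin_mod_fcycles_F2_circle[OF A U AU] order_refl fboundaries_mono[OF UB]])
qed

section \<open>Diagrams of rank functions\<close>

lemma PH_eq_rank_diagram: "PH K i Y f = rank_diagram (persistence_rank K i Y f)"
  unfolding PH_def rank_diagram_def rect_mass_def Let_def ..

lemma rect_mass_split_birth: "rect_mass r a b c d = rect_mass r a v c d + rect_mass r v b c d"
  and rect_mass_split_death: "rect_mass r a b c d = rect_mass r a b c v + rect_mass r a b v d"
  by (simp_all add: rect_mass_def)

lemma rect_mass_degenerate [simp]: "rect_mass r a a c d = 0" "rect_mass r a b c c = 0"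
  by (simp_all add: rect_mass_def)

lemma interior_atLeastAtMost_left:
  fixes x :: ereal
  assumes "x \<in> interior {a..b}" "x < v"
  shows "x \<in> interior {a..v}"
proof -
  have "interior {a..b} \<inter> {..<v} \<subseteq> interior {a..v}"
    using interior_subset[of "{a..b}"] by (intro interior_maximal) auto
  then show ?thesis using assms by blast
qed

lemma interior_atLeastAtMost_right:
  fixes x :: ereal
  assumes "x \<in> interior {a..b}" "v < x"
  shows "x \<in> interior {v..b}"
proof -
  have "interior {a..b} \<inter> {v<..} \<subseteq> interior {v..b}"
    using interior_subset[of "{a..b}"] by (intro interior_maximal) auto
  then show ?thesis using assms by blast
qed

abbreviation clamp_to :: "ereal \<Rightarrow> ereal \<Rightarrow> ereal \<Rightarrow> ereal" where
  "clamp_to a b x \<equiv> max a (min b x)"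

text \<open>Clamping the ends of a side to an interval intersects the rectangle with a strip, an
  empty intersection becoming a degenerate rectangle of mass 0. The identity is additivity of these
  intersections when \<open>{a..b}\<close> is cut at \<open>v\<close>.\<close>

lemma rect_mass_clamp_birth:
  assumes "a \<le> v" "v \<le> b"
  shows "rect_mass r (clamp_to a b x) (clamp_to a b y) c d
    = rect_mass r (clamp_to a v x) (clamp_to a v y) c d + rect_mass r (clamp_to v b x) (clamp_to v b y) c d"
proof -
  have *: "r (clamp_to a b z) w = r (clamp_to a v z) w + r (clamp_to v b z) w - r v w" for z w
    using assms by (cases "z \<le> v") (auto simp: max_def min_def)
  show ?thesis unfolding rect_mass_def by (simp add: *[of x] *[of y])
qed

lemma rect_mass_clamp_death:
  assumes "c \<le> v" "v \<le> d"
  shows "rect_mass r a b (clamp_to c d x) (clamp_to c d y)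
    = rect_mass r a b (clamp_to c v x) (clamp_to c v y) + rect_mass r a b (clamp_to v d x) (clamp_to v d y)"
proof -
  have *: "r w (clamp_to c d z) = r w (clamp_to c v z) + r w (clamp_to v d z) - r w v" for z w
    using assms by (cases "z \<le> v") (auto simp: max_def min_def)
  show ?thesis unfolding rect_mass_def by (simp add: *[of _ x] *[of _ y])
qed

lemma clamp_to_bounds: "a \<le> b \<Longrightarrow> a \<le> clamp_to a b x" "a \<le> b \<Longrightarrow> clamp_to a b x \<le> b"
  "x \<le> y \<Longrightarrow> clamp_to a b x \<le> clamp_to a b y"
  by (auto simp: max_def min_def)

context
  fixes r :: "ereal \<Rightarrow> ereal \<Rightarrow> int"
  assumes nonneg: "rect_nonneg r"
begin

lemma rect_mass_nonneg: "a \<le> b \<Longrightarrow> b < c \<Longrightarrow> c \<le> d \<Longrightarrow> rect_mass r a b c d \<ge> 0"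
  using nonneg by (simp add: rect_nonneg_def)

lemma rect_mass_mono:
  assumes "a' \<le> a" "a \<le> b" "b \<le> b'" "b' < c'" "c' \<le> c" "c \<le> d" "d \<le> d'"
  shows "rect_mass r a b c d \<le> rect_mass r a' b' c' d'"
proof -
  have "rect_mass r a b c d \<le> rect_mass r a b c' d'"
    using rect_mass_split_death[of r a b c' d' c] rect_mass_split_death[of r a b c d' d]
      rect_mass_nonneg[of a b c' c] rect_mass_nonneg[of a b d d'] assms by auto
  also have "\<dots> \<le> rect_mass r a' b' c' d'"
    using rect_mass_split_birth[of r a' b' c' d' a] rect_mass_split_birth[of r a b' c' d' b]
      rect_mass_nonneg[of a' a c' d'] rect_mass_nonneg[of b b' c' d'] assms by auto
  finally show ?thesis .
qed

lemma rank_diagram_le: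
  assumes "a < b" "b < c" "c < d" and p: "p \<in> interior ({a..b} \<times> {c..d})"
  shows "int (rank_diagram r p) \<le> rect_mass r a b c d"
proof -
  obtain x y where xy: "p = (x, y)" by (cases p)
  have "(x, y) \<in> {a..b} \<times> {c..d}" using p interior_subset unfolding xy by blast
  then have "x < y" using assms(2) by auto
  then have "rank_diagram r p \<le> nat (rect_mass r a b c d)"
    unfolding xy rank_diagram_def using assms(1-3) p[unfolded xy]
    by (auto intro!: cInf_lower bdd_below_bot)
  then show ?thesis
    using rect_mass_nonneg[OF less_imp_le[OF assms(1)] assms(2) less_imp_le[OF assms(3)]] by linarith
qed

lemma rank_diagram_attained:
  assumes "x < y"
  obtains a b c d where "a < b" "b < c" "c < d" "(x, y) \<in> interior ({a..b} \<times> {c..d})"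
    "rect_mass r a b c d = int (rank_diagram r (x, y))"
proof -
  let ?S = "{nat (rect_mass r a b' c d') |a b' c d'.
     a < b' \<and> b' < c \<and> c < d' \<and> (x, y) \<in> interior ({a..b'} \<times> {c..d'})}"
  \<comment> \<open>The quadrant with corner (v, w) shows that some rectangle competes in the
    infimum. Reaching -\<infinity> and \<infinity>, it has the point in its interior even if a
    coordinate is infinite.\<close>
  obtain v where v: "x < v" "v < y" using dense assms by blast
  obtain w where w: "v < w" "w < y" using dense v by blast
  have "{..<v} \<times> {w<..} \<subseteq> interior ({-\<infinity>..v} \<times> {w..\<infinity>})"
    by (intro interior_maximal open_Times) auto
  then have "(x, y) \<in> interior ({-\<infinity>..v} \<times> {w..\<infinity>})" using v w by auto
  moreover have "-\<infinity> < v" "w < \<infinity>" using v w by auto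
  ultimately have "?S \<noteq> {}" using v w by blast
  then have "Inf ?S \<in> ?S" by (rule Inf_nat_def1)
  moreover have "rank_diagram r (x, y) = Inf ?S" using assms by (simp add: rank_diagram_def)
  ultimately obtain a b c d where "a < b" "b < c" "c < d" "(x, y) \<in> interior ({a..b} \<times> {c..d})"
    "rank_diagram r (x, y) = nat (rect_mass r a b c d)" by auto
  then show ?thesis using that[of a b c d] rect_mass_nonneg[of a b c d] by simp
qed

text \<open>Finitely many values leave a free cut \<open>v\<close> between two of them; no point
  lies on the cut, and each side loses one of \<open>p\<close> and \<open>q\<close>.\<close>

lemma finite_cut:
  fixes \<phi> :: "'p \<Rightarrow> ereal" and g :: "'p \<Rightarrow> int"
  assumes F: "finite F" "p \<in> F" "q \<in> F" and lt: "\<phi> p < \<phi> q"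
  obtains v where "\<phi> p < v" "v < \<phi> q" "card {z \<in> F. \<phi> z < v} < card F" "card {z \<in> F. v < \<phi> z} < card F"
    "sum g F = sum g {z \<in> F. \<phi> z < v} + sum g {z \<in> F. v < \<phi> z}"
proof -
  have "\<not> {\<phi> p<..<\<phi> q} \<subseteq> \<phi> ` F"
    using infinite_Ioo[OF lt] F(1) finite_subset by blast
  then obtain v where "v \<in> {\<phi> p<..<\<phi> q}" and v3: "v \<notin> \<phi> ` F" by blast
  then have v: "\<phi> p < v" "v < \<phi> q" by simp_all
  let ?L = "{z \<in> F. \<phi> z < v}" and ?R = "{z \<in> F. v < \<phi> z}"
  have Un: "F = ?L \<union> ?R" using v3 by force
  have "q \<in> F - ?L" "p \<in> F - ?R" using F(2,3) v by auto
  then have "?L \<subset> F" "?R \<subset> F" by blast+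
  then have card: "card ?L < card F" "card ?R < card F"
    using psubset_card_mono[OF F(1)] by blast+
  have "finite ?L" by (rule finite_subset[OF _ F(1)]) blast
  moreover have "finite ?R" by (rule finite_subset[OF _ F(1)]) blast
  moreover have "?L \<inter> ?R = {}" by (blast dest: less_asym)
  ultimately have "sum g (?L \<union> ?R) = sum g ?L + sum g ?R" by (rule sum.union_disjoint)
  then have "sum g F = sum g ?L + sum g ?R" unfolding Un[symmetric] .
  then show thesis using that v card by blast
qed

text \<open>Cutting reduces the claim to rectangles with at most one point. Cuts that avoid all
  points keep them in the interior of a piece, where the mass bounds the multiplicity by
  definition.\<close>

lemma sum_rank_diagram_le:
  assumes "finite F" "a < b" "b < c" "c < d" "F \<subseteq> interior ({a..b} \<times> {c..d})"
  shows "(\<Sum>p\<in>F. int (rank_diagram r p)) \<le> rect_mass r a b c d"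
  using assms
proof (induction "card F" arbitrary: F a b c d rule: less_induct)
  case less
  note int = interior_Times[where 'a=ereal and 'b=ereal]
  show ?case
  proof (cases "\<exists>p q. p \<in> F \<and> q \<in> F \<and> p \<noteq> q")
    case False
    then have "F = {} \<or> (\<exists>p. F = {p})" by blast
    then show ?thesis
      using rank_diagram_le[OF less.prems(2-4)] rect_mass_nonneg[of a b c d] less.prems by auto
  next
    case True
    then obtain p q where pq: "p \<in> F" "q \<in> F" "fst p < fst q \<or> snd p < snd q"
      by (metis linorder_neqE prod_eq_iff)
    have box: "fst z \<in> interior {a..b}" "snd z \<in> interior {c..d}" if "z \<in> F" for z
      using that less.prems(5) by (auto simp: int)
    then have box': "fst z \<in> {a..b}" "snd z \<in> {c..d}" if "z \<in> F" for z
      using that interior_subset by blast+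
    from pq(3) show ?thesis
    proof
      assume lt: "fst p < fst q"
      obtain v where v: "fst p < v" "v < fst q"
        and card: "card {z \<in> F. fst z < v} < card F" "card {z \<in> F. v < fst z} < card F"
        and cut: "(\<Sum>p\<in>F. int (rank_diagram r p)) = (\<Sum>p\<in>{z \<in> F. fst z < v}. int (rank_diagram r p))
          + (\<Sum>p\<in>{z \<in> F. v < fst z}. int (rank_diagram r p))"
        by (rule finite_cut[where \<phi>=fst, OF less.prems(1) pq(1,2) lt])
      let ?L = "{z \<in> F. fst z < v}" and ?R = "{z \<in> F. v < fst z}"
      have "a < v" "v < b" using v box'[OF pq(1)] box'[OF pq(2)] by auto
      have "(\<Sum>p\<in>?L. int (rank_diagram r p)) \<le> rect_mass r a v c d"
      proof (rule less.hyps)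
        show "?L \<subseteq> interior ({a..v} \<times> {c..d})"
        proof
          fix z assume "z \<in> ?L"
          then show "z \<in> interior ({a..v} \<times> {c..d})"
            using box[of z] interior_atLeastAtMost_left[of "fst z" a b v] by (simp add: int mem_Times_iff)
        qed
      qed (use card(1) \<open>a < v\<close> \<open>v < b\<close> less.prems in auto)
      moreover have "(\<Sum>p\<in>?R. int (rank_diagram r p)) \<le> rect_mass r v b c d"
      proof (rule less.hyps)
        show "?R \<subseteq> interior ({v..b} \<times> {c..d})"
        proof
          fix z assume "z \<in> ?R"
          then show "z \<in> interior ({v..b} \<times> {c..d})"
            using box[of z] interior_atLeastAtMost_right[of "fst z" a b v] by (simp add: int mem_Times_iff)
        qed
      qed (use card(2) \<open>a < v\<close> \<open>v < b\<close> less.prems in auto)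
      ultimately show ?thesis using cut rect_mass_split_birth[of r a b c d v] by linarith
    next
      assume lt: "snd p < snd q"
      obtain v where v: "snd p < v" "v < snd q"
        and card: "card {z \<in> F. snd z < v} < card F" "card {z \<in> F. v < snd z} < card F"
        and cut: "(\<Sum>p\<in>F. int (rank_diagram r p)) = (\<Sum>p\<in>{z \<in> F. snd z < v}. int (rank_diagram r p))
          + (\<Sum>p\<in>{z \<in> F. v < snd z}. int (rank_diagram r p))"
        by (rule finite_cut[where \<phi>=snd, OF less.prems(1) pq(1,2) lt])
      let ?L = "{z \<in> F. snd z < v}" and ?R = "{z \<in> F. v < snd z}"
      have "c < v" "v < d" using v box'[OF pq(1)] box'[OF pq(2)] by auto
      have "(\<Sum>p\<in>?L. int (rank_diagram r p)) \<le> rect_mass r a b c v"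
      proof (rule less.hyps)
        show "?L \<subseteq> interior ({a..b} \<times> {c..v})"
        proof
          fix z assume "z \<in> ?L"
          then show "z \<in> interior ({a..b} \<times> {c..v})"
            using box[of z] interior_atLeastAtMost_left[of "snd z" c d v] by (simp add: int mem_Times_iff)
        qed
      qed (use card(1) \<open>c < v\<close> \<open>v < d\<close> less.prems in auto)
      moreover have "(\<Sum>p\<in>?R. int (rank_diagram r p)) \<le> rect_mass r a b v d"
      proof (rule less.hyps)
        show "?R \<subseteq> interior ({a..b} \<times> {v..d})"
        proof
          fix z assume "z \<in> ?R"
          then show "z \<in> interior ({a..b} \<times> {v..d})"
            using box[of z] interior_atLeastAtMost_right[of "snd z" c d v] by (simp add: int mem_Times_iff)
        qed
      qed (use card(2) \<open>c < v\<close> \<open>v < d\<close> less.prems in auto)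
      ultimately show ?thesis using cut rect_mass_split_death[of r a b c d v] by linarith
    qed
  qed
qed

abbreviation clipped_mass :: "ereal \<Rightarrow> ereal \<Rightarrow> ereal \<Rightarrow> ereal \<Rightarrow> ereal \<Rightarrow> ereal \<Rightarrow> ereal \<Rightarrow> ereal \<Rightarrow> int" where
  "clipped_mass a b c d \<alpha> \<beta> \<gamma> \<delta> \<equiv>
     rect_mass r (clamp_to a b \<alpha>) (clamp_to a b \<beta>) (clamp_to c d \<gamma>) (clamp_to c d \<delta>)"

text \<open>
  Subadditivity: if no edge of a covering rectangle crosses the interior of the covered one, then a
  single covering rectangle contains it; otherwise cut along such an edge.
\<close>

lemma rect_mass_cover:
  fixes \<alpha> \<beta> \<gamma> \<delta> :: "'i \<Rightarrow> ereal"
  assumes J: "finite J" and edges: "\<And>j. j \<in> J \<Longrightarrow> \<alpha> j \<le> \<beta> j \<and> \<gamma> j \<le> \<delta> j"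
    and "a \<le> b" "b < c" "c \<le> d"
    and "{a..b} \<times> {c..d} \<subseteq> (\<Union>j\<in>J. {\<alpha> j..\<beta> j} \<times> {\<gamma> j..\<delta> j})"
  shows "rect_mass r a b c d \<le> (\<Sum>j\<in>J. clipped_mass a b c d (\<alpha> j) (\<beta> j) (\<gamma> j) (\<delta> j))"
proof -
  let ?X = "\<alpha> ` J \<union> \<beta> ` J" and ?Y = "\<gamma> ` J \<union> \<delta> ` J"
  have fin: "finite ?X" "finite ?Y" using J by auto
  show ?thesis
    using assms(3-6)
  \<comment> \<open>The measure counts edge coordinates strictly inside the rectangle; a cut along
    one of them removes it from both halves.\<close>
  proof (induction "card (?X \<inter> {a<..<b}) + card (?Y \<inter> {c<..<d})" arbitrary: a b c d rule: less_induct)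
    case less
    have clip: "clipped_mass a b c d (\<alpha> j) (\<beta> j) (\<gamma> j) (\<delta> j) \<ge> 0"
      if "j \<in> J" for j
    proof (rule rect_mass_nonneg)
      have "clamp_to a b (\<beta> j) \<le> b" using less.prems(1) by (rule clamp_to_bounds(2))
      also have "b < c" by (rule less.prems(2))
      also have "c \<le> clamp_to c d (\<gamma> j)" using less.prems(3) by (rule clamp_to_bounds(1))
      finally show "clamp_to a b (\<beta> j) < clamp_to c d (\<gamma> j)" .
    qed (use edges[OF that] clamp_to_bounds(3) in blast)+
    then have sum_nn: "(\<Sum>j\<in>J. clipped_mass a b c d (\<alpha> j) (\<beta> j) (\<gamma> j) (\<delta> j)) \<ge> 0"
      by (rule sum_nonneg)
    consider "a = b \<or> c = d" | v where "v \<in> ?X" "a < v" "v < b" | v where "v \<in> ?Y" "c < v" "v < d"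
      | "a < b" "c < d" "?X \<inter> {a<..<b} = {}" "?Y \<inter> {c<..<d} = {}"
      using less.prems(1,3) by fastforce
    then show ?case
    proof cases
      case 1
      then show ?thesis using sum_nn by auto
    next
      case (2 v)
      have card: "card (?X \<inter> {a<..<v}) < card (?X \<inter> {a<..<b})" "card (?X \<inter> {v<..<b}) < card (?X \<inter> {a<..<b})"
        by (rule psubset_card_mono; use fin 2 in fastforce)+
      have "rect_mass r a v c d \<le> (\<Sum>j\<in>J. clipped_mass a v c d (\<alpha> j) (\<beta> j) (\<gamma> j) (\<delta> j))"
      proof (rule less.hyps)
        have "{a..v} \<times> {c..d} \<subseteq> {a..b} \<times> {c..d}"
          using 2 by (intro Sigma_mono) auto
        then show "{a..v} \<times> {c..d} \<subseteq> (\<Union>j\<in>J. {\<alpha> j..\<beta> j} \<times> {\<gamma> j..\<delta> j})"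
          using less.prems(4) by (rule order_trans)
      qed (use card(1) less.prems(1-3) 2 in simp_all)
      moreover have "rect_mass r v b c d \<le> (\<Sum>j\<in>J. clipped_mass v b c d (\<alpha> j) (\<beta> j) (\<gamma> j) (\<delta> j))"
      proof (rule less.hyps)
        have "{v..b} \<times> {c..d} \<subseteq> {a..b} \<times> {c..d}"
          using 2 by (intro Sigma_mono) auto
        then show "{v..b} \<times> {c..d} \<subseteq> (\<Union>j\<in>J. {\<alpha> j..\<beta> j} \<times> {\<gamma> j..\<delta> j})"
          using less.prems(4) by (rule order_trans)
      qed (use card(2) less.prems(1-3) 2 in simp_all)
      ultimately show ?thesis
        using rect_mass_split_birth[of r a b c d v] rect_mass_clamp_birth[of a v b r] 2
        by (simp add: sum.distrib)
    next
      case (3 v)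
      have card: "card (?Y \<inter> {c<..<v}) < card (?Y \<inter> {c<..<d})" "card (?Y \<inter> {v<..<d}) < card (?Y \<inter> {c<..<d})"
        by (rule psubset_card_mono; use fin 3 in fastforce)+
      have "rect_mass r a b c v \<le> (\<Sum>j\<in>J. clipped_mass a b c v (\<alpha> j) (\<beta> j) (\<gamma> j) (\<delta> j))"
      proof (rule less.hyps)
        have "{a..b} \<times> {c..v} \<subseteq> {a..b} \<times> {c..d}"
          using 3 by (intro Sigma_mono) auto
        then show "{a..b} \<times> {c..v} \<subseteq> (\<Union>j\<in>J. {\<alpha> j..\<beta> j} \<times> {\<gamma> j..\<delta> j})"
          using less.prems(4) by (rule order_trans)
      qed (use card(1) less.prems(1-3) 3 in simp_all)
      moreover have "rect_mass r a b v d \<le> (\<Sum>j\<in>J. clipped_mass a b v d (\<alpha> j) (\<beta> j) (\<gamma> j) (\<delta> j))"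
      proof (rule less.hyps)
        have "{a..b} \<times> {v..d} \<subseteq> {a..b} \<times> {c..d}"
          using 3 by (intro Sigma_mono) auto
        then show "{a..b} \<times> {v..d} \<subseteq> (\<Union>j\<in>J. {\<alpha> j..\<beta> j} \<times> {\<gamma> j..\<delta> j})"
          using less.prems(4) by (rule order_trans)
      qed (use card(2) less.prems(1-3) 3 in simp_all)
      ultimately show ?thesis
        using rect_mass_split_death[of r a b c d v] rect_mass_clamp_death[of c v d r] 3
        by (simp add: sum.distrib)
    next
      case 4
      obtain x y where xy: "a < x" "x < b" "c < y" "y < d" using 4 dense by metis
      then have "(x, y) \<in> {a..b} \<times> {c..d}" by auto
      then obtain j where j: "j \<in> J" "\<alpha> j \<le> x" "x \<le> \<beta> j" "\<gamma> j \<le> y" "y \<le> \<delta> j"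
        using less.prems(4) by fastforce
      have "\<alpha> j \<notin> {a<..<b}" "\<beta> j \<notin> {a<..<b}" "\<gamma> j \<notin> {c<..<d}" "\<delta> j \<notin> {c<..<d}"
        using 4 j(1) by auto
      then have "clamp_to a b (\<alpha> j) = a" "clamp_to a b (\<beta> j) = b" "clamp_to c d (\<gamma> j) = c" "clamp_to c d (\<delta> j) = d"
        using xy j 4 by (auto simp: max_def min_def)
      then show ?thesis
        using member_le_sum[OF j(1), of "\<lambda>j. clipped_mass a b c d (\<alpha> j) (\<beta> j) (\<gamma> j) (\<delta> j)"] clip J
        by simp
    qed
  qed
qed

text \<open>A rectangle that realises the minimum in the multiplicity of \<open>p\<close>; by
  \<open>sum_rank_diagram_le\<close> its interior contains no other point of the diagram.\<close>

definition isolating :: "ereal \<times> ereal \<Rightarrow> ereal \<Rightarrow> ereal \<Rightarrow> ereal \<Rightarrow> ereal \<Rightarrow> bool" where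
  "isolating p a b c d \<longleftrightarrow> a < b \<and> b < c \<and> c < d \<and> p \<in> interior ({a..b} \<times> {c..d}) \<and>
     rect_mass r a b c d = int (rank_diagram r p)"

text \<open>Closed rectangles of the extended plane are compact even with infinite sides, and
  \<open>b < c\<close> keeps them off the diagonal, so each of their points has an isolating
  rectangle.\<close>

lemma finite_subcover_attained:
  assumes "b < c"
  obtains P \<alpha> \<beta> \<gamma> \<delta> where "finite P" "P \<subseteq> {a..b} \<times> {c..d}"
    "\<And>p. p \<in> P \<Longrightarrow> isolating p (\<alpha> p) (\<beta> p) (\<gamma> p) (\<delta> p)"
    "{a..b} \<times> {c..d} \<subseteq> (\<Union>p\<in>P. interior ({\<alpha> p..\<beta> p} \<times> {\<gamma> p..\<delta> p}))"
proof -
  let ?R = "{a..b} \<times> {c..d}"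
  have "\<exists>\<alpha> \<beta> \<gamma> \<delta>. isolating p \<alpha> \<beta> \<gamma> \<delta>" if "p \<in> ?R" for p
  proof -
    have "fst p < snd p" using that assms by (auto simp: mem_Times_iff)
    then show ?thesis using rank_diagram_attained[of "fst p" "snd p"] unfolding isolating_def by (metis prod.collapse)
  qed
  then obtain \<alpha> \<beta> \<gamma> \<delta> where R: "\<And>p. p \<in> ?R \<Longrightarrow> isolating p (\<alpha> p) (\<beta> p) (\<gamma> p) (\<delta> p)"
    by metis
  have cpt: "compact ?R" by (intro compact_Times) (simp_all add: compact_eq_closed)
  have cov: "?R \<subseteq> (\<Union>p\<in>?R. interior ({\<alpha> p..\<beta> p} \<times> {\<gamma> p..\<delta> p}))"
    using R unfolding isolating_def by blast
  obtain P where P: "P \<subseteq> ?R" "finite P" "?R \<subseteq> (\<Union>p\<in>P. interior ({\<alpha> p..\<beta> p} \<times> {\<gamma> p..\<delta> p}))"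
    by (rule compactE_image[OF cpt _ cov]) (rule open_interior)
  show ?thesis
  proof (rule that[OF P(2,1) _ P(3)])
    fix p assume "p \<in> P"
    then have "p \<in> ?R" using P(1) by blast
    then show "isolating p (\<alpha> p) (\<beta> p) (\<gamma> p) (\<delta> p)" by (rule R)
  qed
qed

text \<open>The mass of an isolating rectangle is used up by its centre, so every point of the
  diagram is one of the finitely many centres.\<close>

lemma finite_rank_diagram:
  assumes "b < c"
  shows "finite {p \<in> {a..b} \<times> {c..d}. rank_diagram r p \<noteq> 0}"
proof -
  obtain P \<alpha> \<beta> \<gamma> \<delta> where P: "finite P" "P \<subseteq> {a..b} \<times> {c..d}"
    "\<And>p. p \<in> P \<Longrightarrow> isolating p (\<alpha> p) (\<beta> p) (\<gamma> p) (\<delta> p)"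
    "{a..b} \<times> {c..d} \<subseteq> (\<Union>p\<in>P. interior ({\<alpha> p..\<beta> p} \<times> {\<gamma> p..\<delta> p}))"
    by (rule finite_subcover_attained[OF assms, of a d]) (rule that)
  have "{p \<in> {a..b} \<times> {c..d}. rank_diagram r p \<noteq> 0} \<subseteq> P"
  proof
    fix q assume q: "q \<in> {p \<in> {a..b} \<times> {c..d}. rank_diagram r p \<noteq> 0}"
    then obtain p where p: "p \<in> P" "q \<in> interior ({\<alpha> p..\<beta> p} \<times> {\<gamma> p..\<delta> p})" using P(4) by blast
    have "(\<Sum>z\<in>{p, q}. int (rank_diagram r z)) \<le> rect_mass r (\<alpha> p) (\<beta> p) (\<gamma> p) (\<delta> p)"
      using P(3)[OF p(1), unfolded isolating_def] p(2) by (intro sum_rank_diagram_le) auto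
    then have "p = q" using P(3)[OF p(1), unfolded isolating_def] q by (cases "p = q") auto
    then show "q \<in> P" using p(1) by simp
  qed
  then show ?thesis using P(1) finite_subset by blast
qed

lemma rank_diagram_in_Dgm: "rank_diagram r \<in> Dgm"
  unfolding Dgm_def using finite_rank_diagram by (auto simp: rank_diagram_def split: if_splits)

text \<open>The converse of \<open>sum_rank_diagram_le\<close>, with the closed rectangle in place
  of its interior. By subadditivity the mass is at most the sum of the parts cut out by finitely
  many isolating rectangles, and each part is at most the multiplicity of the centre.\<close>

lemma rect_mass_le_sum_rank_diagram:
  assumes "a \<le> b" "b < c" "c \<le> d"
  shows "rect_mass r a b c d \<le> (\<Sum>p | p \<in> {a..b} \<times> {c..d} \<and> rank_diagram r p \<noteq> 0. int (rank_diagram r p))"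
proof -
  obtain P \<alpha> \<beta> \<gamma> \<delta> where P: "finite P" "P \<subseteq> {a..b} \<times> {c..d}"
    "\<And>p. p \<in> P \<Longrightarrow> isolating p (\<alpha> p) (\<beta> p) (\<gamma> p) (\<delta> p)"
    "{a..b} \<times> {c..d} \<subseteq> (\<Union>p\<in>P. interior ({\<alpha> p..\<beta> p} \<times> {\<gamma> p..\<delta> p}))"
    by (rule finite_subcover_attained[OF assms(2), of a d]) (rule that)
  have "rect_mass r a b c d \<le> (\<Sum>p\<in>P. clipped_mass a b c d (\<alpha> p) (\<beta> p) (\<gamma> p) (\<delta> p))"
  proof (rule rect_mass_cover[OF P(1)])
    show "{a..b} \<times> {c..d} \<subseteq> (\<Union>p\<in>P. {\<alpha> p..\<beta> p} \<times> {\<gamma> p..\<delta> p})"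
      using P(4) interior_subset by (rule order_trans[OF _ UN_mono[OF order_refl]])
  qed (use P(3) assms in \<open>auto simp: isolating_def less_imp_le\<close>)
  also have "\<dots> \<le> (\<Sum>p\<in>P. int (rank_diagram r p))"
  proof (rule sum_mono)
    fix p assume p: "p \<in> P"
    \<comment> \<open>The centre lies in both rectangles, so clamping yields a genuine subrectangle
      of the isolating one.\<close>
    have "p \<in> {\<alpha> p..\<beta> p} \<times> {\<gamma> p..\<delta> p}" using P(3)[OF p, unfolded isolating_def] interior_subset by blast
    then have "clipped_mass a b c d (\<alpha> p) (\<beta> p) (\<gamma> p) (\<delta> p)
        \<le> rect_mass r (\<alpha> p) (\<beta> p) (\<gamma> p) (\<delta> p)"
      using P(2) P(3)[OF p, unfolded isolating_def] p by (intro rect_mass_mono) (fastforce simp: max_def min_def)+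
    then show "clipped_mass a b c d (\<alpha> p) (\<beta> p) (\<gamma> p) (\<delta> p)
        \<le> int (rank_diagram r p)"
      using P(3)[OF p, unfolded isolating_def] by simp
  qed
  also have "\<dots> = (\<Sum>p\<in>P \<inter> {p. rank_diagram r p \<noteq> 0}. int (rank_diagram r p))"
    using P(1) by (intro sum.mono_neutral_right) auto
  also have "\<dots> \<le> (\<Sum>p | p \<in> {a..b} \<times> {c..d} \<and> rank_diagram r p \<noteq> 0. int (rank_diagram r p))"
    using finite_rank_diagram[OF assms(2)] P(2) by (intro sum_mono2) auto
  finally show ?thesis .
qed

end

section \<open>Diagrams of interleaved rank functions\<close>

lemma ext_dist_simps [simp]:
  "ext_dist x x = 0"
  "ext_dist (ereal a) (ereal b) = ennreal \<bar>a - b\<bar>"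
  "ext_dist (ereal a) \<infinity> = \<infinity>" "ext_dist \<infinity> (ereal a) = \<infinity>"
  "ext_dist (ereal a) (-\<infinity>) = \<infinity>" "ext_dist (-\<infinity>) (ereal a) = \<infinity>"
  "ext_dist \<infinity> (-\<infinity>) = \<infinity>" "ext_dist (-\<infinity>) \<infinity> = \<infinity>"
  by (auto simp: ext_dist_def e2ennreal_ereal)

lemma ext_dist_commute: "ext_dist x y = ext_dist y x"
  by (cases x; cases y) (simp_all add: abs_minus_commute)

lemma ext_dist_triangle: "ext_dist x z \<le> ext_dist x y + ext_dist y z"
  by (cases x; cases y; cases z) (simp_all add: ennreal_plus[symmetric] del: ennreal_plus)

lemma linf_dist_commute: "linf_dist p q = linf_dist q p"
  by (simp add: linf_dist_def ext_dist_commute)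

lemma linf_dist_triangle: "linf_dist p s \<le> linf_dist p q + linf_dist q s"
  unfolding linf_dist_def
proof (intro max.boundedI)
  show "ext_dist (fst p) (fst s) \<le> max (ext_dist (fst p) (fst q)) (ext_dist (snd p) (snd q))
      + max (ext_dist (fst q) (fst s)) (ext_dist (snd q) (snd s))"
    by (rule order_trans[OF ext_dist_triangle[of _ _ "fst q"]]) (intro add_mono max.cobounded1)
  show "ext_dist (snd p) (snd s) \<le> max (ext_dist (fst p) (fst q)) (ext_dist (snd p) (snd q))
      + max (ext_dist (fst q) (fst s)) (ext_dist (snd q) (snd s))"
    by (rule order_trans[OF ext_dist_triangle[of _ _ "snd q"]]) (intro add_mono max.cobounded2)
qed

lemma diag_dist_triangle: "diag_dist p \<le> linf_dist p q + diag_dist q"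
proof (rule ennreal_le_epsilon)
  fix e :: real assume e: "0 < e" and "linf_dist p q + diag_dist q < top_class.top"
  then have "diag_dist q < top_class.top" by (simp add: less_top[symmetric])
  then have "diag_dist q < diag_dist q + ennreal e"
    using e by (simp add: ennreal_add_left_cancel_less less_top[symmetric])
  then obtain x where x: "linf_dist q (x, x) < diag_dist q + ennreal e"
    unfolding diag_dist_def INF_less_iff by blast
  have "diag_dist p \<le> linf_dist p (x, x)" unfolding diag_dist_def by (rule INF_lower) simp
  also have "\<dots> \<le> linf_dist p q + linf_dist q (x, x)" by (rule linf_dist_triangle)
  also have "\<dots> \<le> linf_dist p q + (diag_dist q + ennreal e)" using x by (intro add_left_mono) simp
  finally show "diag_dist p \<le> linf_dist p q + diag_dist q + ennreal e" by (simp add: add.assoc)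
qed

lemma linf_dist_eq_0_iff: "linf_dist p q = 0 \<longleftrightarrow> p = q"
proof -
  have "ext_dist x y = 0 \<longleftrightarrow> x = y" for x y
    by (cases x; cases y) auto
  then have "ext_dist (fst p) (fst q) \<le> 0 \<and> ext_dist (snd p) (snd q) \<le> 0 \<longleftrightarrow> p = q"
    by (simp add: prod_eq_iff)
  then show ?thesis unfolding linf_dist_def by (metis le_zero_eq max.bounded_iff)
qed

text \<open>Finitely many values leave a gap above \<eta>. Applied to the distances from a point, it
  lets a closed ball grow slightly without gaining points.\<close>

lemma ennreal_gap:
  assumes "finite S" "\<eta> \<ge> 0"
  shows "\<exists>\<theta>>0. \<forall>s\<in>S. ennreal \<eta> < s \<longrightarrow> ennreal (\<eta> + \<theta>) < s"
  using assms(1)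
proof induction
  case empty
  show ?case by (rule exI[of _ 1]) simp
next
  case (insert s S)
  then obtain \<theta> where \<theta>: "\<theta> > 0" "\<forall>s\<in>S. ennreal \<eta> < s \<longrightarrow> ennreal (\<eta> + \<theta>) < s" by blast
  show ?case
  proof (cases "ennreal \<eta> < s")
    case False
    then show ?thesis using \<theta> by (intro exI[of _ \<theta>]) auto
  next
    case True
    then obtain t where t: "ennreal \<eta> < t" "t < s" using dense by blast
    define \<tau> where "\<tau> = enn2real t - \<eta>"
    have "t < top_class.top" using t(2) by (rule less_le_trans) simp
    then have t': "t = ennreal (\<eta> + \<tau>)" by (simp add: \<tau>_def)
    have "\<tau> > 0" using t(1) assms(2) unfolding t' by (simp add: ennreal_less_iff)
    have mono: "ennreal (\<eta> + min \<theta> \<tau>) \<le> ennreal (\<eta> + \<theta>)" "ennreal (\<eta> + min \<theta> \<tau>) \<le> ennreal (\<eta> + \<tau>)"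
      by (auto intro: ennreal_leI)
    show ?thesis
    proof (intro exI[of _ "min \<theta> \<tau>"] conjI ballI impI)
      show "min \<theta> \<tau> > 0" using \<theta> \<open>\<tau> > 0\<close> by simp
      fix u assume "u \<in> insert s S" "ennreal \<eta> < u"
      then show "ennreal (\<eta> + min \<theta> \<tau>) < u"
        using \<theta>(2) mono t(2) t' by (auto intro: le_less_trans)
    qed
  qed
qed

lemma mem_interior_rect:
  fixes x y :: ereal
  assumes "a = -\<infinity> \<or> a < x" "x < b" "c < y" "d = \<infinity> \<or> y < d"
  shows "(x, y) \<in> interior ({a..b} \<times> {c..d})"
proof -
  let ?A = "if a = -\<infinity> then {..<b} else {a<..<b}" and ?C = "if d = \<infinity> then {c<..} else {c<..<d}"
  have "?A \<times> ?C \<subseteq> interior ({a..b} \<times> {c..d})"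
    by (intro interior_maximal open_Times) auto
  moreover have "(x, y) \<in> ?A \<times> ?C" using assms by auto
  ultimately show ?thesis by blast
qed

section \<open>Location of diagram points for bounded functions, and counts in squares\<close>

definition in_strip :: "real \<Rightarrow> ereal \<times> ereal \<Rightarrow> bool" where
  "in_strip M p \<longleftrightarrow> (\<exists>x. fst p = ereal x \<and> - M \<le> x \<and> x \<le> M \<and>
     (snd p = \<infinity> \<or> (\<exists>y. snd p = ereal y \<and> x < y \<and> y \<le> M)))"

lemma in_strip_cases:
  assumes "in_strip M p"
  obtains (inf) x where "p = (ereal x, \<infinity>)" "- M \<le> x" "x \<le> M"
    | (fin) x y where "p = (ereal x, ereal y)" "- M \<le> x" "x < y" "y \<le> M"
  using assms unfolding in_strip_def by (metis prod.collapse)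

text \<open>Any other point above the diagonal has a rectangle of mass 0 around it: below
  \<open>-M\<close> all ranks vanish, for births above \<open>M\<close> they do not depend on the
  birth level, and for deaths between \<open>M\<close> and \<infinity> not on the death level, so
  the terms cancel.\<close>

lemma rank_diagram_in_strip:
  assumes r: "rect_nonneg r" and M: "rank_bounded M r" and p: "rank_diagram r p \<noteq> 0"
  shows "in_strip M p"
proof -
  obtain b d where bd: "p = (b, d)" by (cases p)
  have lt: "b < d" using p by (auto simp: bd rank_diagram_def split: if_splits)
  have vanish: False if "a < b'" "b' < c" "c < d'" "a = -\<infinity> \<or> a < b" "b < b'" "c < d" "d' = \<infinity> \<or> d < d'"
    "rect_mass r a b' c d' = 0" for a b' c d'
    using rank_diagram_le[OF r that(1-3) mem_interior_rect[OF that(4-7)]] that(8) p by (simp add: bd)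
  have low: "r s t = 0" if "s < ereal (- M)" "s < t" for s t
    using M that by (simp add: rank_bounded_def)
  have high: "r s t = r s' t" if "ereal M < s" "s < t" "ereal M < s'" "s' < t" for s s' t
    using M that unfolding rank_bounded_def by blast
  have top: "r s t = r s t'" if "ereal M < t" "ereal M < t'" "s < t" "s < t'" "t < \<infinity>" "t' < \<infinity>" for s t t'
    using M that unfolding rank_bounded_def by blast
  have "ereal (- M) \<le> b"
  proof (rule ccontr)
    assume "\<not> ereal (- M) \<le> b"
    then have "b < min (ereal (- M)) d" using lt by simp
    then obtain v where v: "b < v" "v < min (ereal (- M)) d" using dense by blast
    have "v < d" using v by simp
    then obtain w where w: "v < w" "w < d" using dense by blast
    have ord: "-\<infinity> < v" "w < \<infinity>" "v < ereal (- M)" "v < \<infinity>" "-\<infinity> < w" using v w by auto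
    have "rect_mass r (-\<infinity>) v w \<infinity> = 0"
      unfolding rect_mass_def using low[of "-\<infinity>" w] low[of v w] low[of v \<infinity>] low[of "-\<infinity>" \<infinity>] ord w by simp
    then show False using vanish[of "-\<infinity>" v w \<infinity>] v w ord by simp
  qed
  moreover have "b \<le> ereal M"
  proof (rule ccontr)
    assume "\<not> b \<le> ereal M"
    then have "ereal M < b" by simp
    then obtain u where u: "ereal M < u" "u < b" using dense by blast
    obtain v where v: "b < v" "v < d" using dense lt by blast
    obtain w where w: "v < w" "w < d" using dense v by blast
    have uw: "u < v" "u < w" "ereal M < v" "w < \<infinity>" "v < \<infinity>" "u < \<infinity>" using u v w by auto
    have "rect_mass r u v w \<infinity> = 0"
      unfolding rect_mass_def using high[of v w u] high[of v \<infinity> u] u w uw by simp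
    then show False using vanish[of u v w \<infinity>] u v w uw by simp
  qed
  moreover have "d = \<infinity> \<or> d \<le> ereal M"
  proof (rule ccontr)
    assume "\<not> (d = \<infinity> \<or> d \<le> ereal M)"
    then have d: "ereal M < d" "d < \<infinity>" by auto
    then have "max (ereal M) b < d" using lt by simp
    then obtain w where w: "max (ereal M) b < w" "w < d" using dense by blast
    then have "b < w" by simp
    then obtain v where v: "b < v" "v < w" using dense by blast
    obtain z where z: "d < z" "z < \<infinity>" using dense d by blast
    have wz: "w < z" "ereal M < w" "ereal M < z" "w < \<infinity>" "-\<infinity> < v" "v < z" "-\<infinity> < w" "-\<infinity> < z"
      using w z v by auto
    have "rect_mass r (-\<infinity>) v w z = 0"
      unfolding rect_mass_def using top[of w z v] top[of w z "-\<infinity>"] z v wz by simp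
    then show False using vanish[of "-\<infinity>" v w z] z v w wz by simp
  qed
  ultimately show ?thesis
    using lt unfolding bd in_strip_def by (cases b; cases d) auto
qed

text \<open>Finite and infinite deaths are at distance \<infinity>, so a ball of finite radius never
  mixes the two kinds of points.\<close>

lemma linf_dist_le_iff:
  assumes "\<theta> \<ge> 0"
  shows "linf_dist (ereal x, \<infinity>) (ereal x', d) \<le> ennreal \<theta> \<longleftrightarrow> \<bar>x - x'\<bar> \<le> \<theta> \<and> d = \<infinity>"
    and "linf_dist (ereal x, ereal y) (ereal x', d) \<le> ennreal \<theta> \<longleftrightarrow>
      \<bar>x - x'\<bar> \<le> \<theta> \<and> (\<exists>y'. d = ereal y' \<and> \<bar>y - y'\<bar> \<le> \<theta>)"
  using assms by (cases d; auto simp: linf_dist_def top_unique)+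

text \<open>Persistence at least \<kappa>, written as a sum so that an infinite death is never
  subtracted from.\<close>

definition gapped :: "real \<Rightarrow> ereal \<times> ereal \<Rightarrow> bool" where
  "gapped \<kappa> p \<longleftrightarrow> fst p + ereal \<kappa> \<le> snd p"

lemma gapped_near:
  assumes "in_strip M p" "in_strip M q" "gapped \<kappa> p" "linf_dist p q \<le> ennreal \<theta>" "\<theta> \<ge> 0"
  shows "gapped (\<kappa> - 2 * \<theta>) q"
  using assms(1)
proof (cases rule: in_strip_cases)
  case (inf x)
  obtain x' d where "q = (ereal x', d)" using assms(2) unfolding in_strip_def by (metis prod.collapse)
  then show ?thesis using assms inf by (simp add: linf_dist_le_iff gapped_def)
next
  case (fin x y)
  obtain x' d where q: "q = (ereal x', d)" using assms(2) unfolding in_strip_def by (metis prod.collapse)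
  then obtain y' where "d = ereal y'" "\<bar>x - x'\<bar> \<le> \<theta>" "\<bar>y - y'\<bar> \<le> \<theta>"
    using assms fin by (auto simp: linf_dist_le_iff)
  then show ?thesis using assms fin q by (simp add: gapped_def abs_le_iff)
qed

lemma gapped_mono: "gapped \<kappa> p \<Longrightarrow> \<kappa>' \<le> \<kappa> \<Longrightarrow> gapped \<kappa>' p"
  unfolding gapped_def by (metis add_left_mono ereal_less_eq(3) order_trans)

text \<open>Vertical projection to the diagonal. Half the bound would hold as well, but \<kappa> is
  an arbitrary slack.\<close>

lemma diag_dist_not_gapped:
  assumes "in_strip M p" "\<not> gapped \<kappa> p"
  shows "diag_dist p \<le> ennreal \<kappa>"
  using assms(1)
proof (cases rule: in_strip_cases)
  case (inf x)
  then show ?thesis using assms(2) by (simp add: gapped_def)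
next
  case (fin x y)
  have "diag_dist p \<le> linf_dist p (ereal x, ereal x)"
    unfolding diag_dist_def by (rule INF_lower) simp
  also have "\<dots> \<le> ennreal \<kappa>"
    using assms(2) fin by (simp add: linf_dist_def gapped_def ennreal_leI)
  finally show ?thesis .
qed

text \<open>The square of half side \<theta> around \<open>p\<close>. For infinite death the range
  \<open>{M + 1..\<infinity>}\<close> replaces its vertical side; finite deaths are at most
  \<open>M\<close>, so only \<infinity> is counted there. The extra 1 leaves room to shift the lower
  edge without crossing \<open>M\<close>.\<close>

definition square_mass :: "real \<Rightarrow> (ereal \<Rightarrow> ereal \<Rightarrow> int) \<Rightarrow> ereal \<times> ereal \<Rightarrow> real \<Rightarrow> int" where
  "square_mass M r p \<theta> = rect_mass r (fst p - \<theta>) (fst p + \<theta>)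
     (if snd p = \<infinity> then ereal (M + 1) else snd p - \<theta>) (snd p + \<theta>)"

definition near_points :: "(ereal \<Rightarrow> ereal \<Rightarrow> int) \<Rightarrow> ereal \<times> ereal \<Rightarrow> real \<Rightarrow> (ereal \<times> ereal) set" where
  "near_points r p \<theta> = {q. rank_diagram r q \<noteq> 0 \<and> linf_dist p q \<le> ennreal \<theta>}"

lemma near_points_mono: "\<eta> \<le> \<theta> \<Longrightarrow> near_points r p \<eta> \<subseteq> near_points r p \<theta>"
  unfolding near_points_def using ennreal_leI[of \<eta> \<theta>] by (blast intro: order_trans)

context
  fixes M :: real and r :: "ereal \<Rightarrow> ereal \<Rightarrow> int" and p :: "ereal \<times> ereal" and \<kappa> \<theta> :: real
  assumes r: "rect_nonneg r" and M: "rank_bounded M r" and p: "in_strip M p" and gap: "gapped \<kappa> p"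
    and \<theta>: "0 < \<theta>" "2 * \<theta> < \<kappa>" "2 * \<theta> < 1"
begin

text \<open>\<open>p\<close> is interior to its square. The square stays off the diagonal because
  \<open>2 * \<theta> < \<kappa>\<close>, and for infinite death because
  \<open>2 * \<theta> < 1\<close>.\<close>

lemma rank_diagram_le_square_mass: "int (rank_diagram r p) \<le> square_mass M r p \<theta>"
  using p
proof (cases rule: in_strip_cases)
  case (inf x)
  show ?thesis
    unfolding inf square_mass_def
    using rank_diagram_le[OF r, of "ereal (x - \<theta>)" "ereal (x + \<theta>)" "ereal (M + 1)" \<infinity> "(ereal x, \<infinity>)"]
      mem_interior_rect[of "ereal (x - \<theta>)" "ereal x" "ereal (x + \<theta>)" "ereal (M + 1)" \<infinity> \<infinity>] inf \<theta>
    by simp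
next
  case (fin x y)
  show ?thesis
    unfolding fin square_mass_def
    using rank_diagram_le[OF r, of "ereal (x - \<theta>)" "ereal (x + \<theta>)" "ereal (y - \<theta>)" "ereal (y + \<theta>)" "(ereal x, ereal y)"]
      mem_interior_rect[of "ereal (x - \<theta>)" "ereal x" "ereal (x + \<theta>)" "ereal (y - \<theta>)" "ereal y" "ereal (y + \<theta>)"]
      fin \<theta> gap
    by (simp add: gapped_def)
qed

text \<open>Within the strip, the closed \<theta>-ball of the sup distance is the closed square, so
  the count for closed rectangles applies.\<close>

lemma square_mass_le_sum:
  "finite (near_points r p \<theta>)" "square_mass M r p \<theta> \<le> (\<Sum>q\<in>near_points r p \<theta>. int (rank_diagram r q))"
proof -
  have "finite (near_points r p \<theta>) \<and> square_mass M r p \<theta> \<le> (\<Sum>q\<in>near_points r p \<theta>. int (rank_diagram r q))"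
    using p
  proof (cases rule: in_strip_cases)
    case (inf x)
    let ?R = "{ereal (x - \<theta>)..ereal (x + \<theta>)} \<times> {ereal (M + 1)..\<infinity>}"
    have "near_points r p \<theta> = {q. q \<in> ?R \<and> rank_diagram r q \<noteq> 0}"
    proof -
      have "linf_dist p q \<le> ennreal \<theta> \<longleftrightarrow> q \<in> ?R"
        if "rank_diagram r q \<noteq> 0" for q
        using rank_diagram_in_strip[OF r M that]
        by (cases rule: in_strip_cases) (use \<theta> inf in \<open>auto simp: linf_dist_le_iff\<close>)
      then show ?thesis by (auto simp: near_points_def)
    qed
    then show ?thesis
      using finite_rank_diagram[OF r, of "ereal (x + \<theta>)" "ereal (M + 1)" "ereal (x - \<theta>)" \<infinity>]
        rect_mass_le_sum_rank_diagram[OF r, of "ereal (x - \<theta>)" "ereal (x + \<theta>)" "ereal (M + 1)" \<infinity>] inf \<theta>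
      by (simp add: square_mass_def)
  next
    case (fin x y)
    let ?R = "{ereal (x - \<theta>)..ereal (x + \<theta>)} \<times> {ereal (y - \<theta>)..ereal (y + \<theta>)}"
    have "near_points r p \<theta> = {q. q \<in> ?R \<and> rank_diagram r q \<noteq> 0}"
    proof -
      have "linf_dist p q \<le> ennreal \<theta> \<longleftrightarrow> q \<in> ?R"
        if "rank_diagram r q \<noteq> 0" for q
        using rank_diagram_in_strip[OF r M that]
        by (cases rule: in_strip_cases) (use \<theta> fin in \<open>auto simp: linf_dist_le_iff\<close>)
      then show ?thesis by (auto simp: near_points_def)
    qed
    then show ?thesis
      using finite_rank_diagram[OF r, of "ereal (x + \<theta>)" "ereal (y - \<theta>)" "ereal (x - \<theta>)" "ereal (y + \<theta>)"]
        rect_mass_le_sum_rank_diagram[OF r, of "ereal (x - \<theta>)" "ereal (x + \<theta>)" "ereal (y - \<theta>)" "ereal (y + \<theta>)"]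
        fin \<theta> gap
      by (simp add: square_mass_def gapped_def)
  qed
  then show "finite (near_points r p \<theta>)" "square_mass M r p \<theta> \<le> (\<Sum>q\<in>near_points r p \<theta>. int (rank_diagram r q))"
    by simp_all
qed

text \<open>The strict inequality \<eta> < \<theta> puts the closed \<eta>-ball into the interior of
  the square, as the interior count requires.\<close>

lemma sum_near_points_le_square_mass:
  assumes \<eta>: "0 \<le> \<eta>" "\<eta> < \<theta>"
  shows "(\<Sum>q\<in>near_points r p \<eta>. int (rank_diagram r q)) \<le> square_mass M r p \<theta>"
proof -
  have "near_points r p \<eta> \<subseteq> near_points r p \<theta>" using \<eta> by (intro near_points_mono) simp
  then have fin': "finite (near_points r p \<eta>)" using square_mass_le_sum(1) finite_subset by blast
  show ?thesis
    using p
  proof (cases rule: in_strip_cases)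
    case (inf x)
    let ?R = "{ereal (x - \<theta>)..ereal (x + \<theta>)} \<times> {ereal (M + 1)..\<infinity>}"
    have "near_points r p \<eta> \<subseteq> interior ?R"
    proof
      fix q assume q: "q \<in> near_points r p \<eta>"
      then have "in_strip M q" using rank_diagram_in_strip[OF r M] by (simp add: near_points_def)
      then obtain x' d where "q = (ereal x', d)" unfolding in_strip_def by (metis prod.collapse)
      then show "q \<in> interior ?R"
        using q \<eta> inf by (auto simp: near_points_def linf_dist_le_iff intro!: mem_interior_rect)
    qed
    then show ?thesis
      using sum_rank_diagram_le[OF r fin', of "ereal (x - \<theta>)" "ereal (x + \<theta>)" "ereal (M + 1)" \<infinity>] inf \<theta>
      by (simp add: square_mass_def)
  next
    case (fin x y)
    let ?R = "{ereal (x - \<theta>)..ereal (x + \<theta>)} \<times> {ereal (y - \<theta>)..ereal (y + \<theta>)}"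
    have "near_points r p \<eta> \<subseteq> interior ?R"
    proof
      fix q assume q: "q \<in> near_points r p \<eta>"
      then have "in_strip M q" using rank_diagram_in_strip[OF r M] by (simp add: near_points_def)
      then obtain x' d where "q = (ereal x', d)" unfolding in_strip_def by (metis prod.collapse)
      then show "q \<in> interior ?R"
        using q \<eta> fin by (auto simp: near_points_def linf_dist_le_iff intro!: mem_interior_rect)
    qed
    then show ?thesis
      using sum_rank_diagram_le[OF r fin', of "ereal (x - \<theta>)" "ereal (x + \<theta>)" "ereal (y - \<theta>)" "ereal (y + \<theta>)"]
        fin \<theta> gap
      by (simp add: square_mass_def gapped_def)
  qed
qed

end

definition interleaved :: "real \<Rightarrow> (ereal \<Rightarrow> ereal \<Rightarrow> int) \<Rightarrow> (ereal \<Rightarrow> ereal \<Rightarrow> int) \<Rightarrow> bool" where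
  "interleaved \<eta> r r' \<longleftrightarrow> (\<forall>a b c d. a \<le> b \<and> b + ereal \<eta> < c - ereal \<eta> \<and> c \<le> d \<longrightarrow>
     rect_mass r a b c d \<le> rect_mass r' (a - ereal \<eta>) (b + ereal \<eta>) (c - ereal \<eta>) (d + ereal \<eta>))"

text \<open>Interleaving moves all sides outwards by \<eta>. For infinite death the lower edge drops
  to \<open>M + 1 - \<eta>\<close>, still above \<open>M\<close>; the ranks are constant there, so
  it can be put back to \<open>M + 1\<close>.\<close>

lemma square_mass_interleaved:
  assumes M: "rank_bounded M r'" and p: "in_strip M p" and gap: "gapped \<kappa> p"
    and il: "interleaved \<eta> r r'" and \<theta>: "0 < \<theta>" "0 \<le> \<eta>" "2 * (\<theta> + \<eta>) < \<kappa>" "2 * (\<theta> + \<eta>) < 1"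
  shows "square_mass M r p \<theta> \<le> square_mass M r' p (\<theta> + \<eta>)"
  using p
proof (cases rule: in_strip_cases)
  case (inf x)
  have top: "r' s (ereal (M + 1 - \<eta>)) = r' s (ereal (M + 1))" if "s \<le> ereal (x + \<theta> + \<eta>)" for s
  proof -
    have "s < ereal (M + 1 - \<eta>)" "s < ereal (M + 1)"
      using inf \<theta> by (auto intro: le_less_trans[OF that])
    then show ?thesis using M \<theta> unfolding rank_bounded_def by simp
  qed
  have "rect_mass r (ereal (x - \<theta>)) (ereal (x + \<theta>)) (ereal (M + 1)) \<infinity>
      \<le> rect_mass r' (ereal (x - \<theta>) - \<eta>) (ereal (x + \<theta>) + \<eta>) (ereal (M + 1) - \<eta>) (\<infinity> + ereal \<eta>)"
    by (rule il[unfolded interleaved_def, rule_format]) (use \<theta> inf in simp)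
  also have "\<dots> = rect_mass r' (ereal (x - (\<theta> + \<eta>))) (ereal (x + (\<theta> + \<eta>))) (ereal (M + 1)) \<infinity>"
    using top \<theta> by (simp add: rect_mass_def algebra_simps)
  finally show ?thesis by (simp add: square_mass_def inf)
next
  case (fin x y)
  have "rect_mass r (ereal (x - \<theta>)) (ereal (x + \<theta>)) (ereal (y - \<theta>)) (ereal (y + \<theta>))
      \<le> rect_mass r' (ereal (x - \<theta>) - \<eta>) (ereal (x + \<theta>) + \<eta>) (ereal (y - \<theta>) - \<eta>) (ereal (y + \<theta>) + \<eta>)"
    by (rule il[unfolded interleaved_def, rule_format]) (use \<theta> fin gap in \<open>simp add: gapped_def\<close>)
  also have "\<dots> = rect_mass r' (ereal (x - (\<theta> + \<eta>))) (ereal (x + (\<theta> + \<eta>))) (ereal (y - (\<theta> + \<eta>))) (ereal (y + (\<theta> + \<eta>)))"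
    by (simp add: algebra_simps)
  finally show ?thesis by (simp add: square_mass_def fin)
qed

text \<open>The part of the strip with persistence at least \<kappa> is covered by a finite
  staircase of rectangles off the diagonal, each with finitely many points.\<close>

lemma finite_gapped_points:
  assumes r: "rect_nonneg r" and M: "rank_bounded M r" and \<kappa>: "\<kappa> > 0"
  shows "finite {p. rank_diagram r p \<noteq> 0 \<and> gapped \<kappa> p}"
proof -
  \<comment> \<open>A birth in the \<open>j\<close>-th step is followed by a death at least four
    steps later, so the rectangle may start its deaths one full step above its births.\<close>
  define h where "h = \<kappa> / 4"
  have h: "h > 0" using \<kappa> by (simp add: h_def)
  let ?R = "\<lambda>j::nat. {ereal (- M + j * h)..ereal (- M + (j + 1) * h)} \<times> {ereal (- M + (j + 2) * h)..\<infinity>}"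
  have "{p. rank_diagram r p \<noteq> 0 \<and> gapped \<kappa> p} \<subseteq> (\<Union>j\<le>nat \<lfloor>2 * M / h\<rfloor>. {p \<in> ?R j. rank_diagram r p \<noteq> 0})"
  proof
    fix p assume p: "p \<in> {p. rank_diagram r p \<noteq> 0 \<and> gapped \<kappa> p}"
    then have "in_strip M p" using rank_diagram_in_strip[OF r M] by blast
    then obtain x d where x: "p = (ereal x, d)" "- M \<le> x" "x \<le> M" unfolding in_strip_def by (metis prod.collapse)
    define j where "j = nat \<lfloor>(x + M) / h\<rfloor>"
    have nn: "0 \<le> (x + M) / h" using x h by simp
    then have j: "real j \<le> (x + M) / h" "(x + M) / h < real j + 1"
      unfolding j_def by linarith+
    have j1: "- M + j * h \<le> x" "x \<le> - M + (j + 1) * h"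
      using j h by (auto simp: field_simps)
    have "(x + M) / h \<le> 2 * M / h" using x h by (intro divide_right_mono) auto
    then have "j \<le> nat \<lfloor>2 * M / h\<rfloor>" unfolding j_def by (intro nat_mono floor_mono)
    moreover have "p \<in> ?R j"
    proof -
      have "ereal (x + 4 * h) \<le> d" using p x by (simp add: gapped_def h_def)
      moreover have "- M + (j + 2) * h \<le> x + 4 * h" using j1(1) h by (simp add: algebra_simps)
      ultimately have "ereal (- M + (j + 2) * h) \<le> d" by (meson ereal_less_eq(3) order_trans)
      then show ?thesis using x(1) j1 by (simp add: algebra_simps)
    qed
    ultimately show "p \<in> (\<Union>j\<le>nat \<lfloor>2 * M / h\<rfloor>. {p \<in> ?R j. rank_diagram r p \<noteq> 0})" using p by blast
  qed
  moreover have "finite {p \<in> ?R j. rank_diagram r p \<noteq> 0}" for j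
    using h by (intro finite_rank_diagram[OF r]) (simp add: algebra_simps)
  ultimately show ?thesis using finite_subset by blast
qed

section \<open>Matchings and stability\<close>

text \<open>Two tolerances: matched points move by at most \<eta>, while thin points are dropped at
  cost \<kappa>. The two behave differently under composition.\<close>

definition matched :: "real \<Rightarrow> real \<Rightarrow> diagram \<Rightarrow> diagram \<Rightarrow> bool" where
  "matched \<eta> \<kappa> D E \<longleftrightarrow> (\<exists>m. partial_matching (dgm_points D) (dgm_points E) m \<and>
     (\<forall>x y. (x, y) \<in> m \<longrightarrow> linf_dist (fst x) (fst y) \<le> ennreal \<eta>) \<and>
     (\<forall>x \<in> dgm_points D - fst ` m. diag_dist (fst x) \<le> ennreal \<kappa>) \<and>
     (\<forall>y \<in> dgm_points E - snd ` m. diag_dist (fst y) \<le> ennreal \<kappa>))"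

lemma bottleneck_le_matched:
  assumes "matched \<eta> \<kappa> D E" "\<eta> \<le> \<kappa>"
  shows "bottleneck D E \<le> ennreal \<kappa>"
proof -
  obtain m where m: "partial_matching (dgm_points D) (dgm_points E) m"
     "\<And>x y. (x, y) \<in> m \<Longrightarrow> linf_dist (fst x) (fst y) \<le> ennreal \<eta>"
     "\<And>x. x \<in> dgm_points D - fst ` m \<Longrightarrow> diag_dist (fst x) \<le> ennreal \<kappa>"
     "\<And>y. y \<in> dgm_points E - snd ` m \<Longrightarrow> diag_dist (fst y) \<le> ennreal \<kappa>"
    using assms(1) unfolding matched_def by blast
  have \<eta>: "ennreal \<eta> \<le> ennreal \<kappa>" using assms(2) by (rule ennreal_leI)
  have "matching_cost D E m \<le> ennreal \<kappa>"
    unfolding matching_cost_def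
  proof (rule Sup_least)
    fix c assume "c \<in> {linf_dist (fst x) (fst y) |x y. (x, y) \<in> m} \<union>
          {diag_dist (fst x) |x. x \<in> dgm_points D - fst ` m} \<union>
          {diag_dist (fst y) |y. y \<in> dgm_points E - snd ` m}"
    then consider x y where "(x, y) \<in> m" "c = linf_dist (fst x) (fst y)"
      | x where "x \<in> dgm_points D - fst ` m" "c = diag_dist (fst x)"
      | y where "y \<in> dgm_points E - snd ` m" "c = diag_dist (fst y)" by blast
    then show "c \<le> ennreal \<kappa>"
    proof cases
      case 1
      then show ?thesis using order_trans[OF m(2) \<eta>] by simp
    qed (use m(3,4) in simp_all)
  qed
  moreover have "bottleneck D E \<le> matching_cost D E m"
    unfolding bottleneck_def by (rule Inf_lower) (use m(1) in blast)
  ultimately show ?thesis by (rule order_trans[rotated])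
qed

lemma matched_mono: "matched \<eta> \<kappa> D E \<Longrightarrow> \<kappa> \<le> \<kappa>' \<Longrightarrow> matched \<eta> \<kappa>' D E"
  unfolding matched_def by (meson ennreal_leI order_trans)

lemma matched_sym:
  assumes "matched \<eta> \<kappa> D E"
  shows "matched \<eta> \<kappa> E D"
proof -
  obtain m where m: "partial_matching (dgm_points D) (dgm_points E) m"
     "\<And>x y. (x, y) \<in> m \<Longrightarrow> linf_dist (fst x) (fst y) \<le> ennreal \<eta>"
     "\<And>x. x \<in> dgm_points D - fst ` m \<Longrightarrow> diag_dist (fst x) \<le> ennreal \<kappa>"
     "\<And>y. y \<in> dgm_points E - snd ` m \<Longrightarrow> diag_dist (fst y) \<le> ennreal \<kappa>"
    using assms unfolding matched_def by blast
  have img: "fst ` (m\<inverse>) = snd ` m" "snd ` (m\<inverse>) = fst ` m" by force+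
  have "partial_matching (dgm_points E) (dgm_points D) (m\<inverse>)"
    unfolding partial_matching_def
  proof (intro conjI)
    show "m\<inverse> \<subseteq> dgm_points E \<times> dgm_points D" using m(1) unfolding partial_matching_def by blast
    have "inj_on fst m" "inj_on snd m" using m(1) by (simp_all add: partial_matching_def)
    then show "inj_on fst (m\<inverse>)" "inj_on snd (m\<inverse>)"
      unfolding inj_on_def by (metis converseE fst_conv snd_conv)+
  qed
  then show ?thesis
    unfolding matched_def
  proof (intro exI[of _ "m\<inverse>"] conjI allI impI ballI)
    fix x y assume "(x, y) \<in> m\<inverse>"
    then show "linf_dist (fst x) (fst y) \<le> ennreal \<eta>"
      using m(2)[of y x] by (simp add: linf_dist_commute)
  qed (use m(3,4) img in simp_all)
qed

text \<open>Once a point has lost its partner it is out of the game, so the slack \<open>\<kappa>\<close> is paid only once.\<close>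

lemma matched_trans:
  assumes "matched \<eta> (\<eta> + \<kappa>) D E" "matched \<eta>' (\<eta>' + \<kappa>) E F" and nn: "\<eta> \<ge> 0" "\<eta>' \<ge> 0" "\<kappa> \<ge> 0"
  shows "matched (\<eta> + \<eta>') (\<eta> + \<eta>' + \<kappa>) D F"
proof -
  obtain m where m: "partial_matching (dgm_points D) (dgm_points E) m"
     "\<And>x y. (x, y) \<in> m \<Longrightarrow> linf_dist (fst x) (fst y) \<le> ennreal \<eta>"
     "\<And>x. x \<in> dgm_points D - fst ` m \<Longrightarrow> diag_dist (fst x) \<le> ennreal (\<eta> + \<kappa>)"
     "\<And>y. y \<in> dgm_points E - snd ` m \<Longrightarrow> diag_dist (fst y) \<le> ennreal (\<eta> + \<kappa>)"
    using assms(1) unfolding matched_def by blast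
  obtain n where n: "partial_matching (dgm_points E) (dgm_points F) n"
     "\<And>x y. (x, y) \<in> n \<Longrightarrow> linf_dist (fst x) (fst y) \<le> ennreal \<eta>'"
     "\<And>x. x \<in> dgm_points E - fst ` n \<Longrightarrow> diag_dist (fst x) \<le> ennreal (\<eta>' + \<kappa>)"
     "\<And>y. y \<in> dgm_points F - snd ` n \<Longrightarrow> diag_dist (fst y) \<le> ennreal (\<eta>' + \<kappa>)"
    using assms(2) unfolding matched_def by blast
  have sub: "m \<subseteq> dgm_points D \<times> dgm_points E" "n \<subseteq> dgm_points E \<times> dgm_points F"
    using m(1) n(1) by (auto simp: partial_matching_def)
  have uniq: "x = x' \<longleftrightarrow> y = y'" if "(x, y) \<in> m" "(x', y') \<in> m" for x y x' y'
    using m(1) that unfolding partial_matching_def inj_on_def by (metis fst_conv snd_conv)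
  have uniq': "x = x' \<longleftrightarrow> y = y'" if "(x, y) \<in> n" "(x', y') \<in> n" for x y x' y'
    using n(1) that unfolding partial_matching_def inj_on_def by (metis fst_conv snd_conv)
  have le: "ennreal (\<eta> + \<kappa>) \<le> ennreal (\<eta> + \<eta>' + \<kappa>)" "ennreal (\<eta>' + \<kappa>) \<le> ennreal (\<eta> + \<eta>' + \<kappa>)"
    using nn by (auto intro!: ennreal_leI)
  have "partial_matching (dgm_points D) (dgm_points F) (m O n)"
    unfolding partial_matching_def
  proof (intro conjI)
    show "m O n \<subseteq> dgm_points D \<times> dgm_points F" using sub by blast
    have "x = x' \<longleftrightarrow> z = z'" if xz: "(x, z) \<in> m O n" "(x', z') \<in> m O n" for x z x' z'
    proof -
      obtain y y' where "(x, y) \<in> m" "(y, z) \<in> n" "(x', y') \<in> m" "(y', z') \<in> n"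
        using xz by blast
      then show ?thesis using uniq[of x y x' y'] uniq'[of y z y' z'] by blast
    qed
    then show "inj_on fst (m O n)" "inj_on snd (m O n)"
      unfolding inj_on_def by (metis prod.collapse)+
  qed
  moreover have "linf_dist (fst x) (fst z) \<le> ennreal (\<eta> + \<eta>')" if xz: "(x, z) \<in> m O n" for x z
  proof -
    obtain y where y: "(x, y) \<in> m" "(y, z) \<in> n" using xz by blast
    have "linf_dist (fst x) (fst z) \<le> linf_dist (fst x) (fst y) + linf_dist (fst y) (fst z)"
      by (rule linf_dist_triangle)
    also have "\<dots> \<le> ennreal \<eta> + ennreal \<eta>'" by (intro add_mono m(2) n(2) y)
    finally show ?thesis using nn by simp
  qed
  moreover have "diag_dist (fst x) \<le> ennreal (\<eta> + \<eta>' + \<kappa>)" if x: "x \<in> dgm_points D - fst ` (m O n)" for x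
  proof (cases "x \<in> fst ` m")
    case False
    then show ?thesis using x m(3)[of x] le(1) by (meson Diff_iff order_trans)
  next
    case True
    then obtain y where y: "(x, y) \<in> m" by auto
    have "y \<notin> fst ` n"
    proof
      assume "y \<in> fst ` n"
      then obtain z where "(y, z) \<in> n" by auto
      then have "(x, z) \<in> m O n" using y by blast
      then show False using x by force
    qed
    then have "y \<in> dgm_points E - fst ` n" using y sub by blast
    then have "diag_dist (fst y) \<le> ennreal (\<eta>' + \<kappa>)" by (rule n(3))
    then have "linf_dist (fst x) (fst y) + diag_dist (fst y) \<le> ennreal \<eta> + ennreal (\<eta>' + \<kappa>)"
      by (intro add_mono m(2) y)
    also have "\<dots> = ennreal (\<eta> + \<eta>' + \<kappa>)" using nn by (simp add: ennreal_plus[symmetric] add.assoc del: ennreal_plus)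
    finally show ?thesis using diag_dist_triangle order_trans by blast
  qed
  moreover have "diag_dist (fst z) \<le> ennreal (\<eta> + \<eta>' + \<kappa>)" if z: "z \<in> dgm_points F - snd ` (m O n)" for z
  proof (cases "z \<in> snd ` n")
    case False
    then show ?thesis using z n(4)[of z] le(2) by (meson Diff_iff order_trans)
  next
    case True
    then obtain y where y: "(y, z) \<in> n" by auto
    have "y \<notin> snd ` m"
    proof
      assume "y \<in> snd ` m"
      then obtain x where "(x, y) \<in> m" by auto
      then have "(x, z) \<in> m O n" using y by blast
      then show False using z by force
    qed
    then have "y \<in> dgm_points E - snd ` m" using y sub by blast
    then have "diag_dist (fst y) \<le> ennreal (\<eta> + \<kappa>)" by (rule m(4))
    then have "linf_dist (fst z) (fst y) + diag_dist (fst y) \<le> ennreal \<eta>' + ennreal (\<eta> + \<kappa>)"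
      using n(2)[OF y] by (intro add_mono) (simp_all add: linf_dist_commute)
    also have "\<dots> = ennreal (\<eta> + \<eta>' + \<kappa>)" using nn by (simp add: ennreal_plus[symmetric] ac_simps del: ennreal_plus)
    finally show ?thesis using diag_dist_triangle order_trans by blast
  qed
  ultimately show ?thesis unfolding matched_def by blast
qed

text \<open>The copies of \<open>p\<close> are matched with those of the points in its cluster
  \<open>N p\<close>, which are equally many; disjointness of the clusters makes the union of these
  bijections injective.\<close>

lemma matched_bij_betw:
  fixes N :: "ereal \<times> ereal \<Rightarrow> (ereal \<times> ereal) set"
  assumes card: "\<And>p. p \<in> P \<Longrightarrow> finite (N p) \<and> (\<Sum>q\<in>N p. E q) = D p"
    and near: "\<And>p q. p \<in> P \<Longrightarrow> q \<in> N p \<Longrightarrow> linf_dist p q \<le> ennreal \<eta>"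
    and disj: "\<And>p p' q. p \<in> P \<Longrightarrow> p' \<in> P \<Longrightarrow> q \<in> N p \<Longrightarrow> q \<in> N p' \<Longrightarrow> p = p'"
    and left: "\<And>p. D p \<noteq> 0 \<Longrightarrow> p \<notin> P \<Longrightarrow> diag_dist p \<le> ennreal \<kappa>"
    and right: "\<And>q. E q \<noteq> 0 \<Longrightarrow> q \<notin> (\<Union>p\<in>P. N p) \<Longrightarrow> diag_dist q \<le> ennreal \<kappa>"
  shows "matched \<eta> \<kappa> D E"
proof -
  have "\<exists>f. bij_betw f ({p} \<times> {..<D p}) (SIGMA q:N p. {..<E q})" if "p \<in> P" for p
    by (rule finite_same_card_bij) (use card[OF that] in auto)
  then obtain f where f: "\<And>p. p \<in> P \<Longrightarrow> bij_betw (f p) ({p} \<times> {..<D p}) (SIGMA q:N p. {..<E q})"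
    by metis
  define m where "m = (\<lambda>x. (x, f (fst x) x)) ` (SIGMA p:P. {..<D p})"
  have img: "fst (f p (p, k)) \<in> N p" "snd (f p (p, k)) < E (fst (f p (p, k)))" if "p \<in> P" "k < D p" for p k
  proof -
    have "f p (p, k) \<in> (SIGMA q:N p. {..<E q})" using f[OF that(1)] that(2) bij_betwE by fastforce
    then show "fst (f p (p, k)) \<in> N p" "snd (f p (p, k)) < E (fst (f p (p, k)))" by auto
  qed
  have "partial_matching (dgm_points D) (dgm_points E) m"
    unfolding partial_matching_def
  proof (intro conjI)
    show "m \<subseteq> dgm_points D \<times> dgm_points E"
    proof
      fix z assume "z \<in> m"
      then obtain p k where z: "z = ((p, k), f p (p, k))" "p \<in> P" "k < D p" by (auto simp: m_def)
      then have "f p (p, k) \<in> dgm_points E" using img(2) by (simp add: dgm_points_def case_prod_beta)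
      then show "z \<in> dgm_points D \<times> dgm_points E" using z by (simp add: dgm_points_def)
    qed
    show "inj_on fst m" by (auto simp: m_def inj_on_def)
    show "inj_on snd m"
    proof (rule inj_onI)
      fix a b assume "a \<in> m" "b \<in> m" and eq: "snd a = snd b"
      then obtain p k p' k' where a: "a = ((p, k), f p (p, k))" "p \<in> P" "k < D p"
        and b: "b = ((p', k'), f p' (p', k'))" "p' \<in> P" "k' < D p'"
        by (auto simp: m_def)
      have "p = p'" using disj img(1) a b eq by (metis snd_conv)
      then show "a = b"
        using a b eq f[OF a(2)] unfolding bij_betw_def inj_on_def by auto
    qed
  qed
  moreover have "linf_dist (fst x) (fst y) \<le> ennreal \<eta>" if xy: "(x, y) \<in> m" for x y
  proof -
    obtain p k where "x = (p, k)" "y = f p (p, k)" "p \<in> P" "k < D p" using xy by (auto simp: m_def)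
    then show ?thesis using near[OF _ img(1)] by simp
  qed
  moreover have "diag_dist (fst x) \<le> ennreal \<kappa>" if x0: "x \<in> dgm_points D - fst ` m" for x
  proof -
    obtain p k where x: "x = (p, k)" "k < D p" using x0 by (auto simp: dgm_points_def)
    have "p \<notin> P"
    proof
      assume "p \<in> P"
      then have "((p, k), f p (p, k)) \<in> m" using x by (auto simp: m_def)
      then show False using x0 x by force
    qed
    then show ?thesis using left[of p] x by simp
  qed
  moreover have "diag_dist (fst y) \<le> ennreal \<kappa>" if y: "y \<in> dgm_points E - snd ` m" for y
  proof -
    obtain q l where ql: "y = (q, l)" "l < E q" using y by (auto simp: dgm_points_def)
    have "q \<notin> (\<Union>p\<in>P. N p)"
    proof
      assume "q \<in> (\<Union>p\<in>P. N p)"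
      then obtain p where p: "p \<in> P" "q \<in> N p" by blast
      then have "y \<in> f p ` ({p} \<times> {..<D p})" using f[OF p(1)] ql by (auto simp: bij_betw_def)
      then obtain k where "k < D p" "y = f p (p, k)" by auto
      then have "((p, k), y) \<in> m" using p by (auto simp: m_def)
      then show False using y by force
    qed
    then show ?thesis using right[of q] ql by simp
  qed
  ultimately show ?thesis unfolding matched_def by blast
qed

text \<open>There are finitely many mutual distances, and \<open>ennreal_gap\<close> at 0 provides a
  \<rho> below the nonzero ones.\<close>

lemma finite_gapped_separation:
  assumes "rect_nonneg r" "rank_bounded M r" "\<kappa> > 0"
  obtains \<rho> where "\<rho> > 0" "\<And>p q. rank_diagram r p \<noteq> 0 \<Longrightarrow> rank_diagram r q \<noteq> 0 \<Longrightarrow> gapped \<kappa> p \<Longrightarrow>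
     gapped \<kappa> q \<Longrightarrow> linf_dist p q \<le> ennreal \<rho> \<Longrightarrow> p = q"
proof -
  let ?P = "{p. rank_diagram r p \<noteq> 0 \<and> gapped \<kappa> p}"
  have "finite ((\<lambda>(p, q). linf_dist p q) ` (?P \<times> ?P))"
    using finite_gapped_points[OF assms] by blast
  from ennreal_gap[OF this order_refl] obtain \<rho> where "\<rho> > 0"
    and \<rho>: "\<forall>s\<in>(\<lambda>(p, q). linf_dist p q) ` (?P \<times> ?P). ennreal 0 < s \<longrightarrow> ennreal (0 + \<rho>) < s" by blast
  show thesis
  proof (rule that[OF \<open>\<rho> > 0\<close>])
    fix p q assume pq: "rank_diagram r p \<noteq> 0" "rank_diagram r q \<noteq> 0" "gapped \<kappa> p" "gapped \<kappa> q"
      and le: "linf_dist p q \<le> ennreal \<rho>"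
    have "linf_dist p q \<in> (\<lambda>(p, q). linf_dist p q) ` (?P \<times> ?P)"
      by (rule image_eqI[of _ _ "(p, q)"]) (use pq in auto)
    then have "\<not> ennreal 0 < linf_dist p q" using \<rho> le by force
    then show "p = q" by (simp add: linf_dist_eq_0_iff)
  qed
qed

text \<open>A squeeze: for \<open>p\<close> of persistence at least \<kappa>/2, the multiplicity is
  at most the count for \<open>r'\<close> in the closed \<eta>-ball around \<open>p\<close>; by
  interleaving back, this is at most the mass for \<open>r\<close> of a square that isolates
  \<open>p\<close>, hence equality. The radius \<delta> depends on \<open>r\<close> and \<kappa>,
  but not on \<open>r'\<close>.\<close>

lemma matched_near:
  assumes r: "rect_nonneg r" and M: "rank_bounded M r" and \<kappa>: "\<kappa> > 0"
  shows "\<exists>\<delta>>0. \<forall>r' \<eta>. rect_nonneg r' \<longrightarrow> rank_bounded M r' \<longrightarrow> 0 \<le> \<eta> \<longrightarrow> \<eta> < \<delta> \<longrightarrow>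
     interleaved \<eta> r r' \<longrightarrow> interleaved \<eta> r' r \<longrightarrow> matched \<eta> \<kappa> (rank_diagram r) (rank_diagram r')"
proof -
  let ?D = "rank_diagram r"
  obtain \<rho>\<^sub>0 where \<rho>0: "\<rho>\<^sub>0 > 0" and sep: "\<And>p q. ?D p \<noteq> 0 \<Longrightarrow> ?D q \<noteq> 0 \<Longrightarrow> gapped (\<kappa> / 4) p \<Longrightarrow>
     gapped (\<kappa> / 4) q \<Longrightarrow> linf_dist p q \<le> ennreal \<rho>\<^sub>0 \<Longrightarrow> p = q"
    using finite_gapped_separation[OF r M, of "\<kappa> / 4"] \<kappa> by auto
  \<comment> \<open>The squares below have half side at most \<open>4 * \<rho>\<close>, so their
    points lose at most \<open>8 * \<rho> \<le> \<kappa> / 4\<close> of persistence and stay above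
    the separation threshold \<open>\<kappa> / 4\<close>.\<close>
  define \<rho> where "\<rho> = min \<rho>\<^sub>0 (min \<kappa> 1) / 32"
  have \<rho>: "\<rho> > 0" "32 * \<rho> \<le> \<rho>\<^sub>0" "32 * \<rho> \<le> \<kappa>" "32 * \<rho> \<le> 1"
    using \<rho>0 \<kappa> by (auto simp: \<rho>_def)
  define P where "P = {p. ?D p \<noteq> 0 \<and> gapped (\<kappa> / 2) p}"
  have Pstrip: "in_strip M p" if "p \<in> P" for p
    using that rank_diagram_in_strip[OF r M] by (simp add: P_def)
  \<comment> \<open>Another point in the square would still have persistence at least \<kappa>/4 and
    would be too close to \<open>p\<close>.\<close>
  have iso: "square_mass M r p \<theta> \<le> int (?D p)" if p: "p \<in> P" and \<theta>: "0 < \<theta>" "\<theta> \<le> 4 * \<rho>" for p \<theta>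
  proof -
    have gap: "gapped (\<kappa> / 2) p" and Dp: "?D p \<noteq> 0" using p by (auto simp: P_def)
    have \<theta>': "2 * \<theta> < \<kappa> / 2" "2 * \<theta> < 1" using \<theta> \<rho> by auto
    have "near_points r p \<theta> \<subseteq> {p}"
    proof
      fix q assume q: "q \<in> near_points r p \<theta>"
      then have Dq: "?D q \<noteq> 0" and d: "linf_dist p q \<le> ennreal \<theta>" by (auto simp: near_points_def)
      have "gapped (\<kappa> / 2 - 2 * \<theta>) q"
        by (rule gapped_near[OF Pstrip[OF p] rank_diagram_in_strip[OF r M Dq] gap d]) (use \<theta> in simp)
      then have "gapped (\<kappa> / 4) q" by (rule gapped_mono) (use \<theta> \<rho> in simp)
      moreover have "gapped (\<kappa> / 4) p" using gap by (rule gapped_mono) (use \<kappa> in simp)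
      moreover have "linf_dist p q \<le> ennreal \<rho>\<^sub>0"
        using d by (rule order_trans) (use \<theta> \<rho> in \<open>auto intro!: ennreal_leI\<close>)
      ultimately show "q \<in> {p}" using sep Dp Dq by blast
    qed
    then have "(\<Sum>q\<in>near_points r p \<theta>. int (?D q)) \<le> (\<Sum>q\<in>{p}. int (?D q))"
      by (intro sum_mono2) auto
    then show ?thesis
      using square_mass_le_sum(2)[OF r M Pstrip[OF p] gap \<theta>(1) \<theta>'] by simp
  qed
  show ?thesis
  proof (intro exI[of _ \<rho>] conjI allI impI)
    fix r' \<eta> assume r': "rect_nonneg r'" and M': "rank_bounded M r'" and \<eta>: "0 \<le> \<eta>" "\<eta> < \<rho>"
      and il: "interleaved \<eta> r r'" and il': "interleaved \<eta> r' r"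
    let ?E = "rank_diagram r'"
    \<comment> \<open>Unlike \<rho>, this \<theta> may depend on the diagram and on the point. It
      brings the count from radius \<open>\<theta> + \<eta>\<close> down to \<eta>, so that matched
      points are at distance at most \<eta>.\<close>
    have tight: "\<exists>\<theta>. 0 < \<theta> \<and> \<theta> \<le> \<rho> \<and> near_points s p (\<theta> + \<eta>) \<subseteq> near_points s p \<eta>"
      if "rect_nonneg s" "rank_bounded M s" "in_strip M p" "gapped (\<kappa> / 2) p" for s p
    proof -
      have "finite (near_points s p (2 * \<rho>))"
        by (rule square_mass_le_sum(1)[OF that]) (use \<rho> in auto)
      then have "finite (linf_dist p ` near_points s p (2 * \<rho>))" by simp
      from ennreal_gap[OF this \<eta>(1)] obtain \<theta> where \<theta>: "\<theta> > 0"
        "\<forall>u\<in>linf_dist p ` near_points s p (2 * \<rho>). ennreal \<eta> < u \<longrightarrow> ennreal (\<eta> + \<theta>) < u" by blast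
      have "near_points s p (min \<theta> \<rho> + \<eta>) \<subseteq> near_points s p \<eta>"
      proof
        fix q assume q: "q \<in> near_points s p (min \<theta> \<rho> + \<eta>)"
        then have d: "linf_dist p q \<le> ennreal (min \<theta> \<rho> + \<eta>)" by (simp add: near_points_def)
        have "linf_dist p q \<le> ennreal (2 * \<rho>)" "linf_dist p q \<le> ennreal (\<eta> + \<theta>)"
          using \<eta> by (auto intro!: order_trans[OF d] ennreal_leI)
        moreover from this have "q \<in> near_points s p (2 * \<rho>)" using q by (simp add: near_points_def)
        ultimately have "linf_dist p q \<le> ennreal \<eta>"
          using \<theta>(2) by (meson imageI not_le)
        then show "q \<in> near_points s p \<eta>" using q by (simp add: near_points_def)
      qed
      then show ?thesis using \<theta>(1) \<rho>(1) by (intro exI[of _ "min \<theta> \<rho>"]) auto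
    qed
    show "matched \<eta> \<kappa> ?D ?E"
    proof (rule matched_bij_betw[where P=P and N="\<lambda>p. near_points r' p \<eta>"])
      show "finite (near_points r' p \<eta>) \<and> sum ?E (near_points r' p \<eta>) = ?D p" if p: "p \<in> P" for p
      proof -
        have gap: "gapped (\<kappa> / 2) p" using p by (simp add: P_def)
        have strip: "in_strip M p" using p by (rule Pstrip)
        obtain \<theta> where \<theta>: "0 < \<theta>" "\<theta> \<le> \<rho>" "near_points r' p (\<theta> + \<eta>) \<subseteq> near_points r' p \<eta>"
          using tight[OF r' M' strip gap] by blast
        have "near_points r' p \<eta> \<subseteq> near_points r' p (2 * \<rho>)"
          using \<eta> by (intro near_points_mono) simp
        then have fin: "finite (near_points r' p \<eta>)"
          by (rule finite_subset) (rule square_mass_le_sum(1)[OF r' M' strip gap]; use \<rho> in simp)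
        have "int (?D p) \<le> square_mass M r p \<theta>"
          by (rule rank_diagram_le_square_mass[OF r M strip gap]) (use \<theta> \<rho> in auto)
        also have "\<dots> \<le> square_mass M r' p (\<theta> + \<eta>)"
          by (rule square_mass_interleaved[OF M' strip gap il]) (use \<theta> \<rho> \<eta> in auto)
        also have "\<dots> \<le> (\<Sum>q\<in>near_points r' p (\<theta> + \<eta>). int (?E q))"
          by (rule square_mass_le_sum(2)[OF r' M' strip gap]) (use \<theta> \<rho> \<eta> in auto)
        also have "\<dots> \<le> (\<Sum>q\<in>near_points r' p \<eta>. int (?E q))"
          using fin \<theta>(3) by (intro sum_mono2) auto
        finally have 1: "int (?D p) \<le> (\<Sum>q\<in>near_points r' p \<eta>. int (?E q))" .
        have "(\<Sum>q\<in>near_points r' p \<eta>. int (?E q)) \<le> square_mass M r' p (2 * \<rho>)"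
          by (rule sum_near_points_le_square_mass[OF r' M' strip gap]) (use \<rho> \<eta> in auto)
        also have "\<dots> \<le> square_mass M r p (2 * \<rho> + \<eta>)"
          by (rule square_mass_interleaved[OF M strip gap il']) (use \<rho> \<eta> in auto)
        also have "\<dots> \<le> int (?D p)"
          by (rule iso[OF p]) (use \<rho> \<eta> in auto)
        finally have "(\<Sum>q\<in>near_points r' p \<eta>. int (?E q)) = int (?D p)" using 1 by simp
        then show ?thesis using fin by (simp flip: of_nat_sum)
      qed
      show "linf_dist p q \<le> ennreal \<eta>" if "q \<in> near_points r' p \<eta>" for p q
        using that by (simp add: near_points_def)
      show "p = p'" if "p \<in> P" "p' \<in> P" "q \<in> near_points r' p \<eta>" "q \<in> near_points r' p' \<eta>" for p p' q
      proof -
        have "linf_dist p p' \<le> linf_dist p q + linf_dist q p'" by (rule linf_dist_triangle)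
        also have "\<dots> \<le> ennreal \<eta> + ennreal \<eta>"
          using that by (intro add_mono) (simp_all add: near_points_def linf_dist_commute)
        also have "\<dots> = ennreal (\<eta> + \<eta>)" by (rule ennreal_plus[OF \<eta>(1) \<eta>(1), symmetric])
        also have "\<dots> \<le> ennreal \<rho>\<^sub>0" using \<eta> \<rho> by (intro ennreal_leI) simp
        finally have "linf_dist p p' \<le> ennreal \<rho>\<^sub>0" .
        then show ?thesis
          using sep that gapped_mono[of "\<kappa> / 2" _ "\<kappa> / 4"] \<kappa> by (auto simp: P_def)
      qed
      show "diag_dist p \<le> ennreal \<kappa>" if "?D p \<noteq> 0" "p \<notin> P" for p
      proof -
        have "diag_dist p \<le> ennreal (\<kappa> / 2)"
          by (rule diag_dist_not_gapped[OF rank_diagram_in_strip[OF r M that(1)]]) (use that in \<open>simp add: P_def\<close>)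
        also have "\<dots> \<le> ennreal \<kappa>" using \<kappa> by (intro ennreal_leI) simp
        finally show ?thesis .
      qed
      \<comment> \<open>The threshold is \<kappa> here but \<kappa>/2 in \<open>P\<close>: a point
        of persistence \<kappa> has a neighbour in the first diagram, which loses at most
        \<open>2 * \<eta>\<close> of persistence and so still belongs to \<open>P\<close>.\<close>
      show "diag_dist q \<le> ennreal \<kappa>" if q: "?E q \<noteq> 0" "q \<notin> (\<Union>p\<in>P. near_points r' p \<eta>)" for q
      proof (rule diag_dist_not_gapped)
        show strip: "in_strip M q" by (rule rank_diagram_in_strip[OF r' M' q(1)])
        show "\<not> gapped \<kappa> q"
        proof
          assume gap\<kappa>: "gapped \<kappa> q"
          then have gap: "gapped (\<kappa> / 2) q" by (rule gapped_mono) (use \<kappa> in simp)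
          obtain \<theta> where \<theta>: "0 < \<theta>" "\<theta> \<le> \<rho>" "near_points r q (\<theta> + \<eta>) \<subseteq> near_points r q \<eta>"
            using tight[OF r M strip gap] by blast
          have "0 < int (?E q)" using q(1) by simp
          also have "\<dots> \<le> square_mass M r' q \<theta>"
            by (rule rank_diagram_le_square_mass[OF r' M' strip gap]) (use \<theta> \<rho> in auto)
          also have "\<dots> \<le> square_mass M r q (\<theta> + \<eta>)"
            by (rule square_mass_interleaved[OF M strip gap il']) (use \<theta> \<rho> \<eta> in auto)
          also have "\<dots> \<le> (\<Sum>p\<in>near_points r q (\<theta> + \<eta>). int (?D p))"
            by (rule square_mass_le_sum(2)[OF r M strip gap]) (use \<theta> \<rho> \<eta> in auto)
          finally have "near_points r q (\<theta> + \<eta>) \<noteq> {}" by auto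
          then obtain p where p: "p \<in> near_points r q \<eta>" using \<theta>(3) by blast
          then have Dp: "?D p \<noteq> 0" and d: "linf_dist q p \<le> ennreal \<eta>" by (auto simp: near_points_def)
          have "gapped (\<kappa> - 2 * \<eta>) p"
            by (rule gapped_near[OF strip rank_diagram_in_strip[OF r M Dp] gap\<kappa> d \<eta>(1)])
          then have "gapped (\<kappa> / 2) p" by (rule gapped_mono) (use \<eta> \<rho> in simp)
          then have "p \<in> P" using Dp by (simp add: P_def)
          moreover have "q \<in> near_points r' p \<eta>"
            using q(1) d by (simp add: near_points_def linf_dist_commute)
          ultimately show False using q(2) by blast
        qed
      qed
    qed
  qed (use \<rho> in simp)
qed

text \<open>The radius in \<open>matched_near\<close> varies along the path without an evident
  positive lower bound, so Bolzano bisection joins the local matchings. Costs proportional to the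
  length of a subinterval add up exactly, and \<kappa> does not accumulate.\<close>

lemma bottleneck_path_le:
  fixes r :: "real \<Rightarrow> ereal \<Rightarrow> ereal \<Rightarrow> int"
  assumes r: "\<And>u. 0 \<le> u \<Longrightarrow> u \<le> 1 \<Longrightarrow> rect_nonneg (r u)"
    and M: "\<And>u. 0 \<le> u \<Longrightarrow> u \<le> 1 \<Longrightarrow> rank_bounded M (r u)"
    and il: "\<And>u v. 0 \<le> u \<Longrightarrow> u \<le> 1 \<Longrightarrow> 0 \<le> v \<Longrightarrow> v \<le> 1 \<Longrightarrow> interleaved (\<bar>u - v\<bar> * \<epsilon>) (r u) (r v)"
    and \<epsilon>: "\<epsilon> \<ge> 0"
  shows "bottleneck (rank_diagram (r 0)) (rank_diagram (r 1)) \<le> ennreal \<epsilon>"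
proof (rule ennreal_le_epsilon)
  fix \<kappa> :: real assume \<kappa>: "0 < \<kappa>"
  let ?D = "\<lambda>u. rank_diagram (r u)"
  let ?P = "\<lambda>a b. 0 \<le> a \<longrightarrow> b \<le> 1 \<longrightarrow> matched ((b - a) * \<epsilon>) ((b - a) * \<epsilon> + \<kappa>) (?D a) (?D b)"
  have "?P 0 1"
  proof (rule Bolzano[of 0 1 ?P])
    fix a b c :: real assume P: "?P a b" "?P b c" and ab: "a \<le> b" "b \<le> c"
    show "?P a c"
    proof (intro impI)
      assume "0 \<le> a" "c \<le> 1"
      then have "matched ((b - a) * \<epsilon>) ((b - a) * \<epsilon> + \<kappa>) (?D a) (?D b)"
        "matched ((c - b) * \<epsilon>) ((c - b) * \<epsilon> + \<kappa>) (?D b) (?D c)"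
        using P ab by simp_all
      then have "matched ((b - a) * \<epsilon> + (c - b) * \<epsilon>) ((b - a) * \<epsilon> + (c - b) * \<epsilon> + \<kappa>) (?D a) (?D c)"
        using \<epsilon> \<kappa> ab by (intro matched_trans) auto
      moreover have "(b - a) * \<epsilon> + (c - b) * \<epsilon> = (c - a) * \<epsilon>" by (simp add: algebra_simps)
      ultimately show "matched ((c - a) * \<epsilon>) ((c - a) * \<epsilon> + \<kappa>) (?D a) (?D c)" by simp
    qed
  next
    fix x :: real assume x: "0 \<le> x" "x \<le> 1"
    obtain \<delta> where \<delta>: "\<delta> > 0" and near: "\<And>r' \<eta>. rect_nonneg r' \<Longrightarrow> rank_bounded M r' \<Longrightarrow> 0 \<le> \<eta> \<Longrightarrow>
        \<eta> < \<delta> \<Longrightarrow> interleaved \<eta> (r x) r' \<Longrightarrow> interleaved \<eta> r' (r x) \<Longrightarrow> matched \<eta> \<kappa> (?D x) (rank_diagram r')"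
      using matched_near[OF r[OF x] M[OF x] \<kappa>] by blast
    \<comment> \<open>Division by \<open>\<epsilon> + 1\<close> covers the case \<epsilon> =
      0.\<close>
    have step: "matched (\<bar>u - x\<bar> * \<epsilon>) (\<bar>u - x\<bar> * \<epsilon> + \<kappa>) (?D x) (?D u)"
      if u: "0 \<le> u" "u \<le> 1" "\<bar>u - x\<bar> < \<delta> / (\<epsilon> + 1)" for u
    proof -
      have "\<bar>u - x\<bar> * \<epsilon> \<le> \<bar>u - x\<bar> * (\<epsilon> + 1)" by (intro mult_left_mono) auto
      also have "\<dots> < \<delta>" using u(3) \<epsilon> by (simp add: pos_less_divide_eq)
      finally have "matched (\<bar>u - x\<bar> * \<epsilon>) \<kappa> (?D x) (?D u)"
        using near[OF r[OF u(1,2)] M[OF u(1,2)], of "\<bar>u - x\<bar> * \<epsilon>"] il[OF u(1,2) x] il[OF x u(1,2)] \<epsilon>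
        by (simp add: abs_minus_commute)
      then show ?thesis by (rule matched_mono) (use \<epsilon> in simp)
    qed
    have "?P a b" if ab: "a \<le> x" "x \<le> b" "b - a < \<delta> / (\<epsilon> + 1)" for a b
    proof (intro impI)
      assume "0 \<le> a" "b \<le> 1"
      then have "matched (\<bar>a - x\<bar> * \<epsilon>) (\<bar>a - x\<bar> * \<epsilon> + \<kappa>) (?D a) (?D x)"
        "matched (\<bar>b - x\<bar> * \<epsilon>) (\<bar>b - x\<bar> * \<epsilon> + \<kappa>) (?D x) (?D b)"
        using step[of a] step[of b] ab matched_sym by auto
      then have "matched (\<bar>a - x\<bar> * \<epsilon> + \<bar>b - x\<bar> * \<epsilon>) (\<bar>a - x\<bar> * \<epsilon> + \<bar>b - x\<bar> * \<epsilon> + \<kappa>) (?D a) (?D b)"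
        using \<epsilon> \<kappa> by (intro matched_trans) auto
      moreover have "\<bar>a - x\<bar> * \<epsilon> + \<bar>b - x\<bar> * \<epsilon> = (b - a) * \<epsilon>" using ab by (simp add: algebra_simps)
      ultimately show "matched ((b - a) * \<epsilon>) ((b - a) * \<epsilon> + \<kappa>) (?D a) (?D b)" by simp
    qed
    then show "\<exists>d>0. \<forall>a b. a \<le> x \<and> x \<le> b \<and> b - a < d \<longrightarrow> ?P a b"
      using \<delta> \<epsilon> by (intro exI[of _ "\<delta> / (\<epsilon> + 1)"]) auto
  qed simp
  then have "bottleneck (?D 0) (?D 1) \<le> ennreal (\<epsilon> + \<kappa>)"
    using \<kappa> by (intro bottleneck_le_matched[of \<epsilon>]) auto
  then show "bottleneck (?D 0) (?D 1) \<le> ennreal \<epsilon> + ennreal \<kappa>" using \<epsilon> \<kappa> by simp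
qed

section \<open>Diagrams of loops\<close>

text \<open>Two functions of the segment differ by a multiple \<open>v - u\<close> of
  \<open>f - g\<close>, so the interleaving distance is proportional to the parameter. Tameness is
  asked of the whole segment; continuity supplies it on the Moebius band.\<close>

lemma bottleneck_PH_le:
  fixes f g :: "'a \<Rightarrow> real" and K :: "'k::field itself"
  assumes tame: "\<And>u. 0 \<le> u \<Longrightarrow> u \<le> 1 \<Longrightarrow> q_tame K i Y (\<lambda>y. (1 - u) * f y + u * g y)"
    and f: "\<And>y. y \<in> topspace Y \<Longrightarrow> \<bar>f y\<bar> \<le> M" and g: "\<And>y. y \<in> topspace Y \<Longrightarrow> \<bar>g y\<bar> \<le> M"
    and \<epsilon>: "\<epsilon> \<ge> 0" "\<And>y. y \<in> topspace Y \<Longrightarrow> \<bar>f y - g y\<bar> \<le> \<epsilon>"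
  shows "bottleneck (PH K i Y f) (PH K i Y g) \<le> ennreal \<epsilon>"
proof -
  let ?h = "\<lambda>u y. (1 - u) * f y + u * g y"
  have "bottleneck (rank_diagram (persistence_rank K i Y (?h 0)))
      (rank_diagram (persistence_rank K i Y (?h 1))) \<le> ennreal \<epsilon>"
  proof (rule bottleneck_path_le[where M=M])
    fix u :: real assume u: "0 \<le> u" "u \<le> 1"
    show "rect_nonneg (persistence_rank K i Y (?h u))"
      unfolding rect_nonneg_def using rect_mass_persistence_nonneg[OF tame[OF u]] by blast
    show "rank_bounded M (persistence_rank K i Y (?h u))"
    proof (rule rank_bounded_persistence_rank[OF tame[OF u]])
      fix y assume y: "y \<in> topspace Y"
      have "\<bar>?h u y\<bar> \<le> (1 - u) * \<bar>f y\<bar> + u * \<bar>g y\<bar>"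
        using u by (intro order_trans[OF abs_triangle_ineq]) (simp add: abs_mult)
      also have "\<dots> \<le> (1 - u) * M + u * M"
        using u f[OF y] g[OF y] by (intro add_mono mult_left_mono) auto
      finally show "\<bar>?h u y\<bar> \<le> M" by (simp add: algebra_simps)
    qed
    fix v :: real assume v: "0 \<le> v" "v \<le> 1"
    have "\<bar>?h u y - ?h v y\<bar> \<le> \<bar>u - v\<bar> * \<epsilon>" if "y \<in> topspace Y" for y
    proof -
      have "?h u y - ?h v y = (v - u) * (f y - g y)" by (simp add: algebra_simps)
      then have "\<bar>?h u y - ?h v y\<bar> = \<bar>u - v\<bar> * \<bar>f y - g y\<bar>"
        by (simp add: abs_mult abs_minus_commute)
      then show ?thesis using \<epsilon>(2)[OF that] by (simp add: mult_left_mono)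
    qed
    then show "interleaved (\<bar>u - v\<bar> * \<epsilon>) (persistence_rank K i Y (?h u)) (persistence_rank K i Y (?h v))"
      unfolding interleaved_def using \<epsilon>(1)
      by (intro allI impI rect_mass_persistence_le[OF tame[OF u] tame[OF v]]) auto
  qed (rule \<epsilon>(1))
  then show ?thesis by (simp add: PH_eq_rank_diagram)
qed

lemma continuous_map_F2_circle_bounded:
  assumes "continuous_map F2_circle euclideanreal f"
  obtains M where "M \<ge> 0" "\<And>A. A \<in> F2_carrier \<Longrightarrow> \<bar>f A\<bar> \<le> M"
proof -
  have "compactin F2_circle F2_carrier"
    using compact_space_F2_circle by (simp add: compact_space_def)
  from image_compactin[OF this assms] have "bounded (f ` F2_carrier)"
    by (simp add: compact_imp_bounded)
  then obtain M where M: "\<forall>A\<in>F2_carrier. \<bar>f A\<bar> \<le> M" by (auto simp: bounded_iff)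
  show thesis by (rule that[of "max 0 M"]) (use M in \<open>auto intro: le_max_iff_disj[THEN iffD2]\<close>)
qed

lemma bottleneck_PH_F2_circle_le:
  assumes f: "continuous_map F2_circle euclideanreal f" and g: "continuous_map F2_circle euclideanreal g"
    and \<epsilon>: "\<epsilon> \<ge> 0" "\<And>A. A \<in> F2_carrier \<Longrightarrow> \<bar>f A - g A\<bar> \<le> \<epsilon>"
  shows "bottleneck (PH K i F2_circle f) (PH K i F2_circle g) \<le> ennreal \<epsilon>"
proof -
  obtain M where M: "\<And>A. A \<in> F2_carrier \<Longrightarrow> \<bar>f A\<bar> \<le> M" using continuous_map_F2_circle_bounded[OF f] by metis
  obtain N where N: "\<And>A. A \<in> F2_carrier \<Longrightarrow> \<bar>g A\<bar> \<le> N" using continuous_map_F2_circle_bounded[OF g] by metis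
  show ?thesis
  proof (rule bottleneck_PH_le[where M="max M N"])
    show "q_tame K i F2_circle (\<lambda>A. (1 - u) * f A + u * g A)" for u
      by (intro q_tame_F2_circle continuous_map_add continuous_map_real_mult continuous_map_const[THEN iffD2] f g) auto
  qed (use M N \<epsilon> in \<open>auto intro: le_max_iff_disj[THEN iffD2]\<close>)
qed

lemma PH_F2_circle_in_Dgm:
  assumes "continuous_map F2_circle euclideanreal f"
  shows "PH K i F2_circle f \<in> Dgm"
proof -
  have "rect_nonneg (persistence_rank K i F2_circle f)"
    unfolding rect_nonneg_def using rect_mass_persistence_nonneg[OF q_tame_F2_circle[OF assms]] by blast
  then show ?thesis unfolding PH_eq_rank_diagram by (rule rank_diagram_in_Dgm)
qed

section \<open>Continuity and Lipschitz estimates for the functions attached to a loop\<close>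

lemma continuous_map_pair_dist:
  assumes "\<gamma> \<in> mspace (loop_space X)"
  shows "continuous_map F2_circle euclideanreal (pair_dist X \<gamma>)"
proof (rule continuous_map_F2_circle)
  have \<gamma>: "continuous_map circle (mtopology_of X) \<gamma>"
    using assms by (simp add: loop_space_def)
  show "continuous_map (prod_topology circle circle) euclideanreal (\<lambda>w. pair_dist X \<gamma> {fst w, snd w})"
    unfolding pair_dist_eq
    by (intro continuous_map_mdist continuous_map_compose[OF continuous_map_fst \<gamma>, unfolded o_def]
        continuous_map_compose[OF continuous_map_snd \<gamma>, unfolded o_def])
qed

lemma continuous_map_pair_energy:
  assumes "\<gamma> \<in> mspace (loop_space X)"
  shows "continuous_map F2_circle euclideanreal (pair_energy X \<gamma>)"
  unfolding pair_energy_def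
  by (intro continuous_map_real_divide continuous_map_real_pow continuous_map_pair_dist[OF assms]
      continuous_map_const[THEN iffD2]) auto

text \<open>Quadrangle inequality: both endpoints move, each by at most the distance of the loops,
  which is the origin of the factor 2.\<close>

lemma abs_pair_dist_diff_le:
  assumes \<gamma>: "\<gamma> \<in> mspace (loop_space X)" and \<gamma>': "\<gamma>' \<in> mspace (loop_space X)" and A: "A \<in> F2_carrier"
  shows "\<bar>pair_dist X \<gamma> A - pair_dist X \<gamma>' A\<bar> \<le> 2 * mdist (loop_space X) \<gamma> \<gamma>'"
proof -
  obtain z1 z2 where z: "norm z1 = 1" "norm z2 = 1" and Az: "A = {z1, z2}" using A by (rule F2_carrierE)
  have le: "mdist X (\<gamma> z) (\<gamma>' z) \<le> mdist (loop_space X) \<gamma> \<gamma>'" if "norm z = 1" for z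
    unfolding loop_space_def
    by (rule mdist_cfunspace_imp_mdist_le[where X=circle]) (use assms that in \<open>simp_all add: loop_space_def\<close>)
  have mem: "\<gamma> z \<in> mspace X" "\<gamma>' z \<in> mspace X" if "norm z = 1" for z
    using assms that by (auto simp: loop_space_def)
  have "mdist X (\<gamma> z1) (\<gamma> z2) \<le> mdist X (\<gamma> z1) (\<gamma>' z1) + mdist X (\<gamma>' z1) (\<gamma>' z2) + mdist X (\<gamma>' z2) (\<gamma> z2)"
    using mdist_triangle[of "\<gamma> z1" X "\<gamma>' z1" "\<gamma> z2"] mdist_triangle[of "\<gamma>' z1" X "\<gamma>' z2" "\<gamma> z2"] mem z by simp
  moreover have "mdist X (\<gamma>' z1) (\<gamma>' z2) \<le> mdist X (\<gamma>' z1) (\<gamma> z1) + mdist X (\<gamma> z1) (\<gamma> z2) + mdist X (\<gamma> z2) (\<gamma>' z2)"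
    using mdist_triangle[of "\<gamma>' z1" X "\<gamma> z1" "\<gamma>' z2"] mdist_triangle[of "\<gamma> z1" X "\<gamma> z2" "\<gamma>' z2"] mem z by simp
  ultimately show ?thesis
    using le[OF z(1)] le[OF z(2)] by (simp add: Az pair_dist_eq mdist_commute abs_le_iff)
qed

text \<open>Difference of squares: one factor is at most \<open>2 * \<rho>\<close>, the other at
  most \<open>2 * M + 2 * \<rho>\<close>. The bound \<open>M\<close> depends on the loop, so no
  uniform constant results.\<close>

lemma abs_pair_energy_diff_le:
  assumes \<gamma>: "\<gamma> \<in> mspace (loop_space X)" and \<gamma>': "\<gamma>' \<in> mspace (loop_space X)" and A: "A \<in> F2_carrier"
    and M: "\<bar>pair_dist X \<gamma> A\<bar> \<le> M"
  defines "\<rho> \<equiv> mdist (loop_space X) \<gamma> \<gamma>'"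
  shows "\<bar>pair_energy X \<gamma> A - pair_energy X \<gamma>' A\<bar> \<le> \<rho> * (2 * M + 2 * \<rho>)"
proof -
  let ?a = "pair_dist X \<gamma> A" and ?b = "pair_dist X \<gamma>' A"
  have ab: "\<bar>?a - ?b\<bar> \<le> 2 * \<rho>" unfolding \<rho>_def by (rule abs_pair_dist_diff_le[OF \<gamma> \<gamma>' A])
  then have "\<bar>?a + ?b\<bar> \<le> 2 * M + 2 * \<rho>" using M by linarith
  then have "\<bar>?a - ?b\<bar> * \<bar>?a + ?b\<bar> \<le> (2 * \<rho>) * (2 * M + 2 * \<rho>)"
    using ab by (intro mult_mono) auto
  moreover have "\<bar>pair_energy X \<gamma> A - pair_energy X \<gamma>' A\<bar> = \<bar>?a - ?b\<bar> * \<bar>?a + ?b\<bar> / 2"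
  proof -
    have "pair_energy X \<gamma> A - pair_energy X \<gamma>' A = (?a - ?b) * (?a + ?b) / 2"
      by (simp add: pair_energy_def power2_eq_square algebra_simps)
    then show ?thesis by (simp only: abs_mult abs_divide abs_numeral)
  qed
  ultimately show ?thesis by (simp add: algebra_simps)
qed

lemma bottleneck_PH_pair_energy_tendsto:
  assumes \<gamma>: "\<gamma> \<in> mspace (loop_space X)" and e: "e > 0"
  shows "\<exists>\<delta>>0. \<forall>\<gamma>'\<in>mspace (loop_space X). mdist (loop_space X) \<gamma> \<gamma>' < \<delta> \<longrightarrow>
    bottleneck (PH K i F2_circle (pair_energy X \<gamma>)) (PH K i F2_circle (pair_energy X \<gamma>')) < e"
proof -
  obtain M where M: "M \<ge> 0" "\<And>A. A \<in> F2_carrier \<Longrightarrow> \<bar>pair_dist X \<gamma> A\<bar> \<le> M"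
    using continuous_map_F2_circle_bounded[OF continuous_map_pair_dist[OF \<gamma>]] by metis
  \<comment> \<open>\<open>e\<close> may be \<infinity>, so a finite positive bound below it is
    chosen.\<close>
  obtain t where t: "0 < t" "ennreal t < e"
  proof -
    obtain s where s: "0 < s" "s < e" using dense e by blast
    then have "s < top_class.top" by (meson less_le_trans top_greatest)
    then show thesis using that[of "enn2real s"] s by (simp add: enn2real_positive_iff)
  qed
  \<comment> \<open>The minimum with 1 bounds the second factor by \<open>2 * M + 2\<close>; the
    other term then makes the product at most \<open>t\<close>.\<close>
  define \<delta> where "\<delta> = min 1 (t / (2 * M + 2))"
  have pos: "2 * M + 2 > 0" using M by simp
  have "\<delta> \<le> t / (2 * M + 2)" by (simp add: \<delta>_def)
  then have "\<delta> * (2 * M + 2) \<le> t" using pos by (simp only: pos_le_divide_eq)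
  moreover have "\<delta> > 0" "\<delta> \<le> 1" using t pos by (simp_all add: \<delta>_def)
  ultimately have \<delta>: "\<delta> > 0" "\<delta> \<le> 1" "\<delta> * (2 * M + 2) \<le> t" by blast+
  show ?thesis
  proof (intro exI[of _ \<delta>] conjI ballI impI)
    fix \<gamma>' assume \<gamma>': "\<gamma>' \<in> mspace (loop_space X)" and lt: "mdist (loop_space X) \<gamma> \<gamma>' < \<delta>"
    have "bottleneck (PH K i F2_circle (pair_energy X \<gamma>)) (PH K i F2_circle (pair_energy X \<gamma>')) \<le> ennreal t"
    proof (rule bottleneck_PH_F2_circle_le)
      show "\<bar>pair_energy X \<gamma> A - pair_energy X \<gamma>' A\<bar> \<le> t" if A: "A \<in> F2_carrier" for A
      proof -
        have "\<bar>pair_energy X \<gamma> A - pair_energy X \<gamma>' A\<bar>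
            \<le> mdist (loop_space X) \<gamma> \<gamma>' * (2 * M + 2 * mdist (loop_space X) \<gamma> \<gamma>')"
          by (rule abs_pair_energy_diff_le[OF \<gamma> \<gamma>' A M(2)[OF A]])
        also have "\<dots> \<le> \<delta> * (2 * M + 2)"
          using lt \<delta> M by (intro mult_mono) auto
        finally show ?thesis using \<delta>(3) by simp
      qed
    qed (use t continuous_map_pair_energy \<gamma> \<gamma>' in auto)
    then show "bottleneck (PH K i F2_circle (pair_energy X \<gamma>)) (PH K i F2_circle (pair_energy X \<gamma>')) < e"
      using t(2) by (rule le_less_trans)
  qed (rule \<delta>(1))
qed

theorem corollary3p3:
  fixes X :: "'x metric" and K :: "'k::field itself" and i :: nat
  shows "continuous_map (mtopology_of (loop_space X)) Dgm_topology
           (\<lambda>\<gamma>. PH K i F2_circle (pair_energy X \<gamma>))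
       \<and> (\<lambda>\<gamma>. PH K i F2_circle (pair_dist X \<gamma>)) \<in> mspace (loop_space X) \<rightarrow> Dgm
       \<and> (\<forall>\<gamma>\<in>mspace (loop_space X). \<forall>\<gamma>'\<in>mspace (loop_space X).
            bottleneck (PH K i F2_circle (pair_dist X \<gamma>)) (PH K i F2_circle (pair_dist X \<gamma>'))
              \<le> ennreal (2 * mdist (loop_space X) \<gamma> \<gamma>'))"
proof (intro conjI ballI)
  let ?\<Phi> = "\<lambda>\<gamma>. PH K i F2_circle (pair_energy X \<gamma>)"
  show "continuous_map (mtopology_of (loop_space X)) Dgm_topology ?\<Phi>"
    unfolding continuous_map_def topspace_Dgm_topology topspace_mtopology_of
  proof (intro conjI allI impI)
    show "?\<Phi> \<in> mspace (loop_space X) \<rightarrow> Dgm"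
      using PH_F2_circle_in_Dgm continuous_map_pair_energy by blast
    fix U assume U: "openin Dgm_topology U"
    let ?V = "{\<gamma> \<in> mspace (loop_space X). ?\<Phi> \<gamma> \<in> U}"
    have "\<exists>\<delta>>0. mball_of (loop_space X) \<gamma> \<delta> \<subseteq> ?V" if \<gamma>: "\<gamma> \<in> ?V" for \<gamma>
    proof -
      obtain e where e: "e > 0" "\<forall>E\<in>Dgm. bottleneck (?\<Phi> \<gamma>) E < e \<longrightarrow> E \<in> U"
        using U \<gamma> unfolding openin_Dgm_topology by blast
      have "\<gamma> \<in> mspace (loop_space X)" using \<gamma> by blast
      from bottleneck_PH_pair_energy_tendsto[OF this e(1), of K i]
      obtain \<delta> where "\<delta> > 0" and \<delta>: "\<forall>\<gamma>'\<in>mspace (loop_space X).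
          mdist (loop_space X) \<gamma> \<gamma>' < \<delta> \<longrightarrow> bottleneck (?\<Phi> \<gamma>) (?\<Phi> \<gamma>') < e" by blast
      have "mball_of (loop_space X) \<gamma> \<delta> \<subseteq> ?V"
      proof
        fix \<gamma>' assume "\<gamma>' \<in> mball_of (loop_space X) \<gamma> \<delta>"
        then have \<gamma>': "\<gamma>' \<in> mspace (loop_space X)" "mdist (loop_space X) \<gamma> \<gamma>' < \<delta>" by simp_all
        moreover have "?\<Phi> \<gamma>' \<in> Dgm" using PH_F2_circle_in_Dgm continuous_map_pair_energy \<gamma>'(1) by blast
        ultimately show "\<gamma>' \<in> ?V" using \<delta> e(2) by blast
      qed
      then show ?thesis using \<open>\<delta> > 0\<close> by blast
    qed
    then show "openin (mtopology_of (loop_space X)) ?V"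
      unfolding mtopology_of_def Metric_space.openin_mtopology[OF Metric_space_mspace_mdist]
      by (auto simp: mball_of_def)
  qed
next
  show "(\<lambda>\<gamma>. PH K i F2_circle (pair_dist X \<gamma>)) \<in> mspace (loop_space X) \<rightarrow> Dgm"
    using PH_F2_circle_in_Dgm continuous_map_pair_dist by blast
next
  fix \<gamma> \<gamma>' assume \<gamma>: "\<gamma> \<in> mspace (loop_space X)" and \<gamma>': "\<gamma>' \<in> mspace (loop_space X)"
  show "bottleneck (PH K i F2_circle (pair_dist X \<gamma>)) (PH K i F2_circle (pair_dist X \<gamma>'))
      \<le> ennreal (2 * mdist (loop_space X) \<gamma> \<gamma>')"
    using \<gamma> \<gamma>' by (intro bottleneck_PH_F2_circle_le continuous_map_pair_dist abs_pair_dist_diff_le) simp_all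
qed

end
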